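(* Let $K$ be a field. Then the Heisenberg group $H(K)$ is model complete (as a structure in the language of groups) if and only if $K$ is model complete (as a structure in the language of rings).
   Context: For a field $K$, the Heisenberg group $H(K)=\mathrm{UT}_3(K)$ is the group, under matrix multiplication, of upper unitriangular $3\times 3$ matrices with coefficients in $K$. A structure $M$ in a first-order language is called model complete if its complete theory $\mathrm{Th}(M)$ is model complete, i.e. every embedding between models of $\mathrm{Th}(M)$ is elementary. Fields are considered in the language of rings, and groups in the pure language of groups (no extra constants). *)

theory Defs
  imports "HOL-Analysis.Analysis" "HOL-Algebra.Group"
begin

section \<open>First-order logic over functional signatures\<close>

text \<open>
  A first-order language without relation symbols (other than equality, which is logical) is given
  by its arity function; constants are symbols of arity 0.  The languages of groups and of rings are
  of this form.  Terms and formulas are raw syntax: respecting the arities is the separate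
  condition \<open>wf_term\<close> / \<open>wf_formula\<close>, imposed wherever formulas of a language are meant.
\<close>

datatype 'f fterm = Var nat | App 'f "'f fterm list"

datatype 'f formula =
    Eq "'f fterm" "'f fterm"
  | Neg "'f formula"
  | Conj "'f formula" "'f formula"
  | Exi nat "'f formula"

primrec wf_term :: "('f \<Rightarrow> nat) \<Rightarrow> 'f fterm \<Rightarrow> bool" where
  "wf_term ar (Var n) = True"
| "wf_term ar (App f ts) = (length ts = ar f \<and> list_all (wf_term ar) ts)"

primrec wf_formula :: "('f \<Rightarrow> nat) \<Rightarrow> 'f formula \<Rightarrow> bool" where
  "wf_formula ar (Eq s t) = (wf_term ar s \<and> wf_term ar t)"
| "wf_formula ar (Neg \<phi>) = wf_formula ar \<phi>"
| "wf_formula ar (Conj \<phi> \<psi>) = (wf_formula ar \<phi> \<and> wf_formula ar \<psi>)"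
| "wf_formula ar (Exi n \<phi>) = wf_formula ar \<phi>"

primrec vars_term :: "'f fterm \<Rightarrow> nat set" where
  "vars_term (Var n) = {n}"
| "vars_term (App f ts) = \<Union> (set (map vars_term ts))"

primrec free_vars :: "'f formula \<Rightarrow> nat set" where
  "free_vars (Eq s t) = vars_term s \<union> vars_term t"
| "free_vars (Neg \<phi>) = free_vars \<phi>"
| "free_vars (Conj \<phi> \<psi>) = free_vars \<phi> \<union> free_vars \<psi>"
| "free_vars (Exi n \<phi>) = free_vars \<phi> - {n}"

definition sentence :: "('f \<Rightarrow> nat) \<Rightarrow> 'f formula \<Rightarrow> bool" where
  "sentence ar \<phi> \<longleftrightarrow> wf_formula ar \<phi> \<and> free_vars \<phi> = {}"

record ('f, 'a) struct =
  univ :: "'a set"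
  intp :: "'f \<Rightarrow> 'a list \<Rightarrow> 'a"

text \<open>The values of \<open>intp\<close> on lists of the wrong length or outside the universe are irrelevant.\<close>

definition is_struct :: "('f \<Rightarrow> nat) \<Rightarrow> ('f, 'a) struct \<Rightarrow> bool" where
  "is_struct ar M \<longleftrightarrow> univ M \<noteq> {} \<and>
     (\<forall>f xs. length xs = ar f \<and> set xs \<subseteq> univ M \<longrightarrow> intp M f xs \<in> univ M)"

primrec eval_term :: "('f, 'a) struct \<Rightarrow> (nat \<Rightarrow> 'a) \<Rightarrow> 'f fterm \<Rightarrow> 'a" where
  "eval_term M e (Var n) = e n"
| "eval_term M e (App f ts) = intp M f (map (eval_term M e) ts)"

primrec sat :: "('f, 'a) struct \<Rightarrow> (nat \<Rightarrow> 'a) \<Rightarrow> 'f formula \<Rightarrow> bool" where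
  "sat M e (Eq s t) = (eval_term M e s = eval_term M e t)"
| "sat M e (Neg \<phi>) = (\<not> sat M e \<phi>)"
| "sat M e (Conj \<phi> \<psi>) = (sat M e \<phi> \<and> sat M e \<psi>)"
| "sat M e (Exi n \<phi>) = (\<exists>x\<in>univ M. sat M (e(n := x)) \<phi>)"

definition valid_in :: "('f, 'a) struct \<Rightarrow> 'f formula \<Rightarrow> bool" where
  "valid_in M \<phi> \<longleftrightarrow> (\<forall>e. range e \<subseteq> univ M \<longrightarrow> sat M e \<phi>)"

definition Th :: "('f \<Rightarrow> nat) \<Rightarrow> ('f, 'a) struct \<Rightarrow> 'f formula set" where
  "Th ar M = {\<phi>. sentence ar \<phi> \<and> valid_in M \<phi>}"

definition is_model :: "('f \<Rightarrow> nat) \<Rightarrow> 'f formula set \<Rightarrow> ('f, 'a) struct \<Rightarrow> bool" where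
  "is_model ar T M \<longleftrightarrow> is_struct ar M \<and> (\<forall>\<phi>\<in>T. valid_in M \<phi>)"

definition embedding ::
  "('f \<Rightarrow> nat) \<Rightarrow> ('f, 'a) struct \<Rightarrow> ('f, 'b) struct \<Rightarrow> ('a \<Rightarrow> 'b) \<Rightarrow> bool" where
  "embedding ar M N h \<longleftrightarrow> h ` univ M \<subseteq> univ N \<and> inj_on h (univ M) \<and>
     (\<forall>f xs. length xs = ar f \<and> set xs \<subseteq> univ M \<longrightarrow> h (intp M f xs) = intp N f (map h xs))"

definition elementary ::
  "('f \<Rightarrow> nat) \<Rightarrow> ('f, 'a) struct \<Rightarrow> ('f, 'b) struct \<Rightarrow> ('a \<Rightarrow> 'b) \<Rightarrow> bool" where
  "elementary ar M N h \<longleftrightarrow> h ` univ M \<subseteq> univ N \<and>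
     (\<forall>\<phi> e. wf_formula ar \<phi> \<and> range e \<subseteq> univ M \<longrightarrow> (sat M e \<phi> \<longleftrightarrow> sat N (h \<circ> e) \<phi>))"

text \<open>
  Model completeness speaks about all models of a theory.  HOL cannot quantify over types inside a
  formula, so the type \<open>'u\<close> from which the models draw their elements is a parameter (a model may
  live on any subset of \<open>'u\<close>).  For a countable language and infinite \<open>'u\<close> this parameter does not
  matter: by downward Loewenheim--Skolem, applied to the pair of models together with the
  embedding, a non-elementary embedding between models of whatever size yields one between
  countable models.
\<close>

definition model_complete_theory :: "'u itself \<Rightarrow> ('f \<Rightarrow> nat) \<Rightarrow> 'f formula set \<Rightarrow> bool" where
  "model_complete_theory (_ :: 'u itself) ar T \<longleftrightarrow>
     (\<forall>(M :: ('f, 'u) struct) (N :: ('f, 'u) struct) h.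
        is_model ar T M \<and> is_model ar T N \<and> embedding ar M N h \<longrightarrow> elementary ar M N h)"

definition model_complete :: "'u itself \<Rightarrow> ('f \<Rightarrow> nat) \<Rightarrow> ('f, 'a) struct \<Rightarrow> bool" where
  "model_complete U ar M \<longleftrightarrow> model_complete_theory U ar (Th ar M)"


section \<open>Groups and rings as structures\<close>

datatype group_sym = GOne | GInv | GMult

primrec group_arity :: "group_sym \<Rightarrow> nat" where
  "group_arity GOne = 0"
| "group_arity GInv = 1"
| "group_arity GMult = 2"

primrec group_intp :: "('a, 'b) monoid_scheme \<Rightarrow> group_sym \<Rightarrow> 'a list \<Rightarrow> 'a" where
  "group_intp G GOne xs = \<one>\<^bsub>G\<^esub>"
| "group_intp G GInv xs = inv\<^bsub>G\<^esub> (xs ! 0)"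
| "group_intp G GMult xs = xs ! 0 \<otimes>\<^bsub>G\<^esub> xs ! 1"

definition group_struct :: "('a, 'b) monoid_scheme \<Rightarrow> (group_sym, 'a) struct" where
  "group_struct G = \<lparr>univ = carrier G, intp = group_intp G\<rparr>"

datatype ring_sym = RZero | ROne | RMinus | RAdd | RMult

primrec ring_arity :: "ring_sym \<Rightarrow> nat" where
  "ring_arity RZero = 0"
| "ring_arity ROne = 0"
| "ring_arity RMinus = 1"
| "ring_arity RAdd = 2"
| "ring_arity RMult = 2"

primrec ring_intp :: "ring_sym \<Rightarrow> 'a::ring_1 list \<Rightarrow> 'a" where
  "ring_intp RZero xs = 0"
| "ring_intp ROne xs = 1"
| "ring_intp RMinus xs = - (xs ! 0)"
| "ring_intp RAdd xs = xs ! 0 + xs ! 1"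
| "ring_intp RMult xs = xs ! 0 * xs ! 1"

definition ring_struct :: "(ring_sym, 'a::ring_1) struct" where
  "ring_struct = \<lparr>univ = UNIV, intp = ring_intp\<rparr>"


section \<open>The Heisenberg group\<close>

definition UT3 :: "('a::field ^ 3 ^ 3) set" where
  "UT3 = {A. A $ 1 $ 1 = 1 \<and> A $ 2 $ 2 = 1 \<and> A $ 3 $ 3 = 1 \<and>
             A $ 2 $ 1 = 0 \<and> A $ 3 $ 1 = 0 \<and> A $ 3 $ 2 = 0}"

definition Heisenberg :: "('a::field ^ 3 ^ 3) monoid" where
  "Heisenberg = \<lparr>carrier = UT3, mult = (**), one = mat 1\<rparr>"

lemma UT3_mult: "A \<in> UT3 \<Longrightarrow> B \<in> UT3 \<Longrightarrow> A ** B \<in> UT3"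
  by (simp add: UT3_def matrix_matrix_mult_def sum_3)

lemma UT3_one: "mat 1 \<in> UT3"
  by (simp add: UT3_def mat_def)

lemma UT3_inverse:
  assumes "A \<in> UT3"
  shows "\<exists>B\<in>UT3. B ** A = mat 1"
proof -
  define B :: "'a ^ 3 ^ 3" where
    "B = vector [vector [1, - A $ 1 $ 2, A $ 1 $ 2 * A $ 2 $ 3 - A $ 1 $ 3],
                 vector [0, 1, - A $ 2 $ 3],
                 vector [0, 0, 1]]"
  have "B \<in> UT3"
    by (simp add: B_def UT3_def)
  moreover have "B ** A = mat 1"
    using assms
    by (simp add: B_def UT3_def matrix_matrix_mult_def mat_def vec_eq_iff forall_3 sum_3)
  ultimately show ?thesis by blast
qed

lemma group_Heisenberg: "group (Heisenberg :: ('a::field ^ 3 ^ 3) monoid)"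
  by (rule Group.groupI; simp add: Heisenberg_def UT3_mult UT3_one UT3_inverse matrix_mul_assoc [symmetric])

lemma is_struct_group: "group G \<Longrightarrow> is_struct group_arity (group_struct G)"
proof -
  assume "group G"
  then interpret group G .
  have "group_intp G f xs \<in> carrier G"
    if "length xs = group_arity f" "set xs \<subseteq> carrier G" for f xs
    using that by (cases f) (auto simp: subset_iff)
  then show ?thesis
    using one_closed by (auto simp: is_struct_def group_struct_def)
qed

lemma is_struct_ring: "is_struct ring_arity ring_struct"
  by (simp add: is_struct_def ring_struct_def)

end

(*
  A model G of Th(H(K)) contains a pair a, b with [a, b] \<noteq> 1, and every such pair makes the centre Z of G into
  a field F, a model of Th(K): addition is the group operation, and [x, b] * [a, y] = [x, y] for x in the
  centralizer C(a) and y in C(b).  Since Z = C(a) \<inter> C(b) is defined without quantifiers and * existentially,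
  an embedding of models of Th(H(K)) restricts to an embedding of these fields.  In the other direction H(F)
  is interpreted in F coordinatewise.

  If H(K) is model complete and F \<subseteq> F' are models of Th(K), then H(F) \<subseteq> H(F') is elementary, and so is
  F \<subseteq> F', being interpreted in it with parameters in H(F).

  If K is model complete and G \<subseteq> G' are models of Th(H(K)), then F \<subseteq> F' is elementary.  Over the prime field
  the abelian group Z splits off C(a): it is divisible and torsion-free in characteristic 0, while in
  characteristic p the element a can be chosen with a^p = 1, and then C(a) has exponent p.  Complements of Z in C(a)
  and in C(b) identify G with H(F); choosing the complements for G' to contain those for G identifies G \<subseteq> G'
  with H(F) \<subseteq> H(F'), which is elementary.

  The two type parameters are immaterial by downward Loewenheim--Skolem.
*)

theory Submission
  imports Defs
begin

section \<open>Preservation of satisfaction\<close>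

text \<open>No non-commuting pair is definable in a group, since conjugation by \<open>a\<close>
  moves \<open>b\<close>. So the group axioms are stated for an arbitrary such pair and the
  translated ring formulas take the pair as parameters; in \<open>H(K)\<close> a change of pair only
  rescales the centre by the determinant of the pair. An injective homomorphism sends such a pair to
  such a pair, and it preserves the multiplication because that is single-valued and existentially
  defined.

  The delicate point is the identification of a model with \<open>H(F)\<close>. The complements come
  from Zorn's lemma, with no definition to carry them along an embedding, so the choices in the two
  groups have to be matched by extending the smaller complement.

  The condition on p-th powers is caused by characteristic 2. For odd p all p-th powers in
  \<open>H(K)\<close> are trivial, but the square of a matrix in characteristic 2 has corner entry
  \<open>x y\<close>, so some centralizers contain elements of order 4. In characteristic 0 the
  exponent \<open>CHAR('k)\<close> is 0 and the condition is empty, so one argument covers all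
  characteristics.\<close>

lemma eval_term_cong:
  "(\<And>n. n \<in> vars_term t \<Longrightarrow> e n = e' n) \<Longrightarrow> eval_term M e t = eval_term M e' t"
proof (induction t)
  case (App f ts)
  then have "map (eval_term M e) ts = map (eval_term M e') ts" by fastforce
  then show ?case by (simp only: eval_term.simps)
qed simp

lemma sat_cong:
  "(\<And>n. n \<in> free_vars \<phi> \<Longrightarrow> e n = e' n) \<Longrightarrow> sat M e \<phi> \<longleftrightarrow> sat M e' \<phi>"
proof (induction \<phi> arbitrary: e e')
  case (Eq s t)
  then have "eval_term M e s = eval_term M e' s" "eval_term M e t = eval_term M e' t"
    by (auto intro: eval_term_cong)
  then show ?case by simp
next
  case (Conj \<phi> \<psi>)
  have "sat M e \<phi> = sat M e' \<phi>" "sat M e \<psi> = sat M e' \<psi>"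
    by (rule Conj.IH; use Conj.prems in simp)+
  then show ?case by simp
next
  case (Exi n \<phi>)
  have "sat M (e(n := x)) \<phi> = sat M (e'(n := x)) \<phi>" for x
    by (rule Exi.IH) (use Exi.prems in auto)
  then show ?case by simp
next
  case (Neg \<phi>)
  have "sat M e \<phi> = sat M e' \<phi>"
    by (rule Neg.IH) (use Neg.prems in simp)
  then show ?case by simp
qed

lemma finite_vars_term [simp]: "finite (vars_term t)"
  by (induction t) auto

lemma finite_free_vars [simp]: "finite (free_vars \<phi>)"
  by (induction \<phi>) auto

lemma eval_term_closed:
  "\<lbrakk>is_struct ar M; wf_term ar t; \<And>n. n \<in> vars_term t \<Longrightarrow> e n \<in> univ M\<rbrakk> \<Longrightarrow> eval_term M e t \<in> univ M"
proof (induction t)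
  case (App f ts)
  then have "set (map (eval_term M e) ts) \<subseteq> univ M" by (auto simp: list_all_iff)
  with App.prems show ?case unfolding is_struct_def by simp
qed simp

lemma eval_term_embedding:
  assumes "is_struct ar M" "embedding ar M N h" "range e \<subseteq> univ M"
  shows "wf_term ar t \<Longrightarrow> h (eval_term M e t) = eval_term N (h \<circ> e) t"
proof (induction t)
  case (App f ts)
  have "set (map (eval_term M e) ts) \<subseteq> univ M"
    using App.prems assms eval_term_closed[OF assms(1)] by (fastforce simp: list_all_iff)
  then have "h (eval_term M e (App f ts)) = intp N f (map h (map (eval_term M e) ts))"
    using App.prems assms(2) by (simp add: embedding_def)
  also have "map h (map (eval_term M e) ts) = map (eval_term N (h \<circ> e)) ts"
    using App by (auto simp: list_all_iff comp_def)
  finally show ?case by (simp add: comp_def)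
qed simp

lemma range_upd: "range e \<subseteq> A \<Longrightarrow> x \<in> A \<Longrightarrow> range (e(n := x)) \<subseteq> A"
  by auto

section \<open>Isomorphisms and elementary maps\<close>

definition isomorphism ::
  "('f \<Rightarrow> nat) \<Rightarrow> ('f, 'a) struct \<Rightarrow> ('f, 'b) struct \<Rightarrow> ('a \<Rightarrow> 'b) \<Rightarrow> bool" where
  "isomorphism ar M N h \<longleftrightarrow> is_struct ar M \<and> embedding ar M N h \<and> h ` univ M = univ N"

text \<open>Embeddings already preserve equations between terms; surjectivity is what the quantifier
  step requires.\<close>

lemma sat_isomorphism:
  assumes "isomorphism ar M N h"
  shows "wf_formula ar \<phi> \<Longrightarrow> range e \<subseteq> univ M \<Longrightarrow> sat M e \<phi> \<longleftrightarrow> sat N (h \<circ> e) \<phi>"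
proof (induction \<phi> arbitrary: e)
  case (Eq s t)
  have emb: "is_struct ar M" "embedding ar M N h" using assms by (auto simp: isomorphism_def)
  have "eval_term M e s \<in> univ M" "eval_term M e t \<in> univ M"
    using Eq emb by (auto intro!: eval_term_closed)
  moreover have "inj_on h (univ M)" using emb by (simp add: embedding_def)
  ultimately have "eval_term M e s = eval_term M e t \<longleftrightarrow> h (eval_term M e s) = h (eval_term M e t)"
    by (simp add: inj_on_eq_iff)
  then show ?case
    using Eq by (simp add: eval_term_embedding[OF emb Eq(2)] comp_def)
next
  case (Exi n \<phi>)
  have "sat M (e(n := x)) \<phi> \<longleftrightarrow> sat N ((h \<circ> e)(n := h x)) \<phi>" if "x \<in> univ M" for x
    using Exi.IH[of "e(n := x)"] Exi.prems that range_upd[of e "univ M" x n]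
    by (simp add: fun_upd_comp del: fun_upd_apply)
  moreover have "(\<exists>y\<in>univ N. P y) \<longleftrightarrow> (\<exists>x\<in>univ M. P (h x))" for P
  proof -
    have "univ N = h ` univ M" using assms by (simp add: isomorphism_def)
    then show ?thesis by simp
  qed
  ultimately show ?case by (simp add: comp_def)
qed auto

lemma sat_elementary:
  "\<lbrakk>elementary ar M N h; wf_formula ar \<phi>; range e \<subseteq> univ M\<rbrakk> \<Longrightarrow> sat M e \<phi> \<longleftrightarrow> sat N (h \<circ> e) \<phi>"
  by (simp add: elementary_def)

lemma range_elementary:
  "\<lbrakk>elementary ar M N h; range e \<subseteq> univ M\<rbrakk> \<Longrightarrow> range (h \<circ> e) \<subseteq> univ N"
  unfolding elementary_def by fastforce

lemma elementary_isomorphism: "isomorphism ar M N h \<Longrightarrow> elementary ar M N h"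
  using sat_isomorphism unfolding elementary_def isomorphism_def by blast

lemma elementary_inv_isomorphism:
  assumes "isomorphism ar M N h"
  shows "elementary ar N M (inv_into (univ M) h)"
proof -
  have im: "univ N = h ` univ M" using assms by (simp add: isomorphism_def)
  have "inv_into (univ M) h ` univ N \<subseteq> univ M" unfolding im by (auto intro: inv_into_into)
  moreover have "sat N e \<phi> \<longleftrightarrow> sat M (inv_into (univ M) h \<circ> e) \<phi>"
    if wf: "wf_formula ar \<phi>" and e: "range e \<subseteq> univ N" for \<phi> e
  proof -
    have "e n \<in> h ` univ M" for n using e im by blast
    then have e': "range (inv_into (univ M) h \<circ> e) \<subseteq> univ M" "h \<circ> (inv_into (univ M) h \<circ> e) = e"
      by (auto simp: fun_eq_iff f_inv_into_f inv_into_into)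
    show ?thesis using sat_isomorphism[OF assms wf e'(1)] unfolding e'(2) by (rule sym)
  qed
  ultimately show ?thesis unfolding elementary_def by blast
qed

lemma elementary_comp:
  assumes "elementary ar M N h" "elementary ar N P g"
  shows "elementary ar M P (g \<circ> h)"
proof -
  have "(g \<circ> h) ` univ M \<subseteq> univ P"
    using assms unfolding elementary_def image_comp[symmetric] by blast
  moreover have "sat M e \<phi> \<longleftrightarrow> sat P (g \<circ> h \<circ> e) \<phi>" if "wf_formula ar \<phi>" "range e \<subseteq> univ M" for \<phi> e
  proof -
    have "range (h \<circ> e) \<subseteq> univ N" using range_elementary[OF assms(1) that(2)] .
    then show ?thesis using assms that by (simp add: elementary_def comp_assoc)
  qed
  ultimately show ?thesis unfolding elementary_def by blast
qed

lemma elementary_cong: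
  assumes "elementary ar M N h" "\<And>x. x \<in> univ M \<Longrightarrow> h x = h' x"
  shows "elementary ar M N h'"
proof -
  have "h \<circ> e = h' \<circ> e" if "range e \<subseteq> univ M" for e :: "nat \<Rightarrow> 'b"
    using that assms(2) by (auto simp: fun_eq_iff)
  moreover have "h' ` univ M = h ` univ M" using assms(2) by (intro image_cong) auto
  ultimately show ?thesis
    using assms(1) by (simp add: elementary_def)
qed

section \<open>Models of a complete theory\<close>

text \<open>\<open>Neg (Exi n (Neg \<psi>))\<close> is the universal quantifier. Validity already
  ranges over all environments, so a further universal quantifier adds nothing; conversely,
  instantiating it with the value \<open>e n\<close> recovers the formula.\<close>

lemma valid_in_foldr_All:
  "is_struct ar M \<Longrightarrow> valid_in M (foldr (\<lambda>n \<psi>. Neg (Exi n (Neg \<psi>))) ns \<phi>) \<longleftrightarrow> valid_in M \<phi>"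
proof (induction ns)
  case (Cons n ns)
  have "valid_in M (Neg (Exi n (Neg \<psi>))) \<longleftrightarrow> valid_in M \<psi>" for \<psi>
  proof
    assume *: "valid_in M (Neg (Exi n (Neg \<psi>)))"
    show "valid_in M \<psi>"
      unfolding valid_in_def
    proof (intro allI impI)
      fix e :: "nat \<Rightarrow> 'b" assume "range e \<subseteq> univ M"
      moreover from this have "e n \<in> univ M" by auto
      ultimately have "sat M (e(n := e n)) \<psi>"
        using * unfolding valid_in_def sat.simps by blast
      then show "sat M e \<psi>" by simp
    qed
  next
    assume *: "valid_in M \<psi>"
    show "valid_in M (Neg (Exi n (Neg \<psi>)))"
      unfolding valid_in_def sat.simps
    proof (intro allI impI notI, elim bexE)
      fix e x assume "range e \<subseteq> univ M" "x \<in> univ M" "\<not> sat M (e(n := x)) \<psi>"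
      then show False using * range_upd[of e "univ M" x n] unfolding valid_in_def by blast
    qed
  qed
  then show ?case using Cons by simp
qed simp

lemma is_model_ThI:
  assumes "is_struct ar N" "\<And>\<phi>. \<lbrakk>sentence ar \<phi>; valid_in M \<phi>\<rbrakk> \<Longrightarrow> valid_in N \<phi>"
  shows "is_model ar (Th ar M) N"
  using assms by (simp add: is_model_def Th_def)

text \<open>Passing to the universal closure lets open formulas be transferred as well.\<close>

lemma valid_in_model_Th:
  assumes N: "is_model ar (Th ar M) N" and M: "is_struct ar M"
    and \<phi>: "wf_formula ar \<phi>" "valid_in M \<phi>"
  shows "valid_in N \<phi>"
proof -
  obtain ns where ns: "set ns = free_vars \<phi>" using finite_list[OF finite_free_vars] by blast
  let ?c = "\<lambda>ns. foldr (\<lambda>n \<psi>. Neg (Exi n (Neg \<psi>))) ns \<phi>"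
  have "wf_formula ar (?c ns)" using \<phi>(1) by (induction ns) auto
  moreover have "free_vars (?c ns) = {}"
  proof -
    have "free_vars (?c ms) = free_vars \<phi> - set ms" for ms by (induction ms) auto
    then show ?thesis using ns by simp
  qed
  moreover have "valid_in M (?c ns)" using valid_in_foldr_All[OF M] \<phi>(2) by blast
  ultimately have "?c ns \<in> Th ar M"
    by (simp add: Th_def sentence_def)
  then have "valid_in N (?c ns)" using N by (simp add: is_model_def)
  moreover have "is_struct ar N" using N by (simp add: is_model_def)
  ultimately show ?thesis using valid_in_foldr_All by fast
qed

lemma valid_in_elementary:
  assumes "elementary ar M N h" "wf_formula ar \<phi>" "valid_in N \<phi>"
  shows "valid_in M \<phi>"
  unfolding valid_in_def
proof (intro allI impI)
  fix e :: "nat \<Rightarrow> _" assume e: "range e \<subseteq> univ M"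
  then have "range (h \<circ> e) \<subseteq> univ N" using range_elementary[OF assms(1)] by simp
  then have "sat N (h \<circ> e) \<phi>" using assms(3) by (simp add: valid_in_def)
  then show "sat M e \<phi>" using sat_elementary[OF assms(1,2) e] by simp
qed

lemma valid_in_isomorphism:
  assumes "isomorphism ar M N h" "wf_formula ar \<phi>"
  shows "valid_in N \<phi> \<longleftrightarrow> valid_in M \<phi>"
  using valid_in_elementary[OF elementary_isomorphism[OF assms(1)] assms(2)]
    valid_in_elementary[OF elementary_inv_isomorphism[OF assms(1)] assms(2)] ..

lemma Th_isomorphism: "isomorphism ar M N h \<Longrightarrow> Th ar N = Th ar M"
  using valid_in_isomorphism[of ar M N h] by (auto simp: Th_def sentence_def)

section \<open>The downward Loewenheim--Skolem theorem\<close>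

instance fterm :: (countable) countable by countable_datatype
instance formula :: (countable) countable by countable_datatype
instance group_sym :: countable by countable_datatype
instance ring_sym :: countable by countable_datatype

text \<open>Names for the elements of a Skolem hull: generators, and chosen witnesses for
  \<open>Exi n \<phi>\<close> when the variables 0, 1, ... take the values named in the list.
  Countability of the hull is countability of these names.\<close>

datatype 'f skolem = Base nat | Witness "'f formula" nat "'f skolem list"

instance skolem :: (countable) countable by countable_datatype

text \<open>A name carries finitely many parameters, while environments are total; hence the
  padding. The same device later feeds chosen group or ring elements to a formula.\<close>

definition list_env :: "'a \<Rightarrow> 'a list \<Rightarrow> nat \<Rightarrow> 'a" where
  "list_env d xs = (\<lambda>k. if k < length xs then xs ! k else d)"

text \<open>The generator \<open>e 0\<close> is both the padding and the value of a name without a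
  witness, so that every name denotes an element of the universe.\<close>

primrec skolem_val :: "('f, 'a) struct \<Rightarrow> (nat \<Rightarrow> 'a) \<Rightarrow> 'f skolem \<Rightarrow> 'a" where
  "skolem_val M e (Base n) = e n"
| "skolem_val M e (Witness \<phi> n ts) =
     (let P = \<lambda>x. x \<in> univ M \<and> sat M ((list_env (e 0) (map (skolem_val M e) ts))(n := x)) \<phi>
      in if \<exists>x. P x then SOME x. P x else e 0)"

lemma skolem_val_closed: "range e \<subseteq> univ M \<Longrightarrow> skolem_val M e t \<in> univ M"
proof (cases t)
  case (Witness \<phi> n ts)
  assume e: "range e \<subseteq> univ M"
  let ?P = "\<lambda>x. x \<in> univ M \<and> sat M ((list_env (e 0) (map (skolem_val M e) ts))(n := x)) \<phi>"
  have "?P (SOME x. ?P x)" if "\<exists>x. ?P x" using that by (rule someI_ex)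
  then show ?thesis using Witness e by (auto simp: Let_def)
qed auto

text \<open>Only the universe shrinks, so terms keep their values, and \<open>wit\<close> makes the
  quantifiers over \<open>S\<close> and over the whole universe agree.\<close>

lemma tarski_vaught:
  assumes S: "S \<subseteq> univ M"
    and wit: "\<And>\<phi> n e. range e \<subseteq> S \<Longrightarrow> \<exists>x\<in>univ M. sat M (e(n := x)) \<phi> \<Longrightarrow> \<exists>x\<in>S. sat M (e(n := x)) \<phi>"
  shows "range e \<subseteq> S \<Longrightarrow> sat (M\<lparr>univ := S\<rparr>) e \<phi> \<longleftrightarrow> sat M e \<phi>"
proof (induction \<phi> arbitrary: e)
  case (Eq s t)
  have "eval_term (M\<lparr>univ := S\<rparr>) e t = eval_term M e t" for t
    by (induction t) (auto intro!: arg_cong[where f = "intp M _"])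
  then show ?case by simp
next
  case (Exi n \<phi>)
  then have "sat (M\<lparr>univ := S\<rparr>) (e(n := x)) \<phi> = sat M (e(n := x)) \<phi>" if "x \<in> S" for x
    using that range_upd by metis
  then show ?case using wit[OF Exi.prems, of n \<phi>] S by auto
qed auto

lemma countable_elementary_substructure:
  fixes M :: "('f::countable, 'a) struct"
  assumes M: "is_struct ar M" and X: "countable X" "X \<subseteq> univ M"
  obtains S where "countable S" "X \<subseteq> S" "S \<subseteq> univ M" "is_struct ar (M\<lparr>univ := S\<rparr>)"
    "elementary ar (M\<lparr>univ := S\<rparr>) M id"
proof -
  obtain x0 where x0: "x0 \<in> univ M" using M by (auto simp: is_struct_def)
  define d where "d = from_nat_into (insert x0 X)"
  have range_d: "range d = insert x0 X" using X by (simp add: d_def)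
  then have d: "range d \<subseteq> univ M" using X x0 by auto
  define S where "S = range (skolem_val M d)"
  have S: "S \<subseteq> univ M" using skolem_val_closed[OF d] by (auto simp: S_def)
  have XS: "X \<subseteq> S"
  proof
    fix x assume "x \<in> X"
    then have "x \<in> range d" using range_d by simp
    then obtain n where "x = skolem_val M d (Base n)" by auto
    then show "x \<in> S" unfolding S_def by blast
  qed
  have d0: "d 0 \<in> S" unfolding S_def by (rule range_eqI[of _ _ "Base 0"]) simp
  have wit: "\<exists>x\<in>S. sat M (e(n := x)) \<phi>" if e: "range e \<subseteq> S" and ex: "\<exists>x\<in>univ M. sat M (e(n := x)) \<phi>" for \<phi> n e
  proof -
    \<comment> \<open>All free variables lie below \<open>m\<close>, so the first \<open>m\<close>
      values of \<open>e\<close> determine satisfaction. Inserting 0 keeps the maximum meaningful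
      for a formula without free variables.\<close>
    define m where "m = Suc (Max (insert 0 (free_vars \<phi>)))"
    define t where "t = (\<lambda>k. SOME t. skolem_val M d t = e k)"
    have t: "skolem_val M d (t k) = e k" for k
      unfolding t_def by (rule someI_ex) (use e in \<open>auto simp: S_def dest!: subsetD[where c = "e k"]\<close>)
    let ?e = "list_env (d 0) (map (skolem_val M d) (map t [0..<m]))"
    have "?e k = e k" if "k \<in> free_vars \<phi>" for k
    proof -
      have "k \<le> Max (insert 0 (free_vars \<phi>))" using that by simp
      then have "k < m" by (simp add: m_def)
      then show ?thesis by (simp add: list_env_def t)
    qed
    then have sat: "sat M (?e(n := x)) \<phi> = sat M (e(n := x)) \<phi>" for x by (intro sat_cong) simp
    let ?P = "\<lambda>x. x \<in> univ M \<and> sat M (?e(n := x)) \<phi>"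
    have P: "\<exists>x. ?P x" using ex sat by auto
    have "skolem_val M d (Witness \<phi> n (map t [0..<m])) = (SOME x. ?P x)"
      using P by (auto simp: Let_def simp del: map_map)
    moreover have "?P (SOME x. ?P x)" using P by (rule someI_ex)
    ultimately show ?thesis using sat by (metis S_def rangeI)
  qed
  \<comment> \<open>Closure under \<open>f\<close> is an instance of the witness property:
    \<open>f(xs)\<close> is the only solution of \<open>x = f(xs)\<close>, where the index
    \<open>length xs\<close> is a fresh variable for \<open>x\<close>.\<close>
  have "intp M f xs \<in> S" if "length xs = ar f" "set xs \<subseteq> S" for f xs
  proof -
    let ?n = "length xs" and ?e = "list_env (d 0) xs"
    let ?\<phi> = "Eq (Var ?n) (App f (map Var [0..<?n]))"
    have sat: "sat M (?e(?n := x)) ?\<phi> \<longleftrightarrow> x = intp M f xs" for x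
    proof -
      have "map (eval_term M (?e(?n := x))) (map Var [0..<?n]) = xs"
        by (auto simp: list_env_def intro!: nth_equalityI)
      then show ?thesis by (simp only: sat.simps eval_term.simps fun_upd_same)
    qed
    have "range ?e \<subseteq> S" using that d0 by (auto simp: list_env_def)
    moreover have "intp M f xs \<in> univ M" using M S that unfolding is_struct_def by blast
    ultimately show ?thesis using wit[of ?e ?n ?\<phi>] unfolding sat by blast
  qed
  then have "is_struct ar (M\<lparr>univ := S\<rparr>)" by (auto simp: is_struct_def S_def)
  moreover have "elementary ar (M\<lparr>univ := S\<rparr>) M id"
    using S tarski_vaught[OF S wit] by (simp add: elementary_def)
  moreover have "countable S" by (simp add: S_def)
  ultimately show ?thesis using that S XS by blast
qed

text \<open>A countable elementary substructure can be copied into any infinite type. The map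
  \<open>g\<close> leads from the copy back into the given structure.\<close>

lemma countable_elementary_pullback:
  fixes M :: "('f::countable, 'a) struct"
  assumes inf: "infinite (UNIV :: 'u set)" and M: "is_struct ar M" and X: "countable X" "X \<subseteq> univ M"
  obtains M' :: "('f, 'u) struct" and g where "is_struct ar M'" "embedding ar M' M g"
    "elementary ar M' M g" "X \<subseteq> g ` univ M'" "countable (univ M')"
proof -
  obtain S where S: "countable S" "X \<subseteq> S" "S \<subseteq> univ M" "is_struct ar (M\<lparr>univ := S\<rparr>)"
    "elementary ar (M\<lparr>univ := S\<rparr>) M id"
    using countable_elementary_substructure[OF M X] .
  obtain i :: "nat \<Rightarrow> 'u" where i: "inj i" using inf infinite_countable_subset by blast
  define j where "j = i \<circ> to_nat_on S"
  have j: "inj_on j S" using i S(1) inj_on_to_nat_on[of S]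
    unfolding j_def by (intro comp_inj_on) (auto intro: inj_on_subset)
  define g where "g = inv_into S j"
  have g: "g ` (j ` S) = S" "inj_on g (j ` S)" "\<And>x. x \<in> S \<Longrightarrow> g (j x) = x"
    using j by (auto simp: g_def inj_on_inv_into image_iff)
  define M' where "M' = \<lparr>univ = j ` S, intp = \<lambda>f xs. j (intp M f (map g xs))\<rparr>"
  have cl: "intp M f (map g xs) \<in> S" if "length xs = ar f" "set xs \<subseteq> j ` S" for f xs
  proof -
    have "set (map g xs) \<subseteq> S" using that g by auto
    then show ?thesis using S(4) that by (simp add: is_struct_def)
  qed
  then have M': "is_struct ar M'" using S(4) by (auto simp: is_struct_def M'_def)
  have "isomorphism ar M' (M\<lparr>univ := S\<rparr>) g"
    using M' cl g by (auto simp: isomorphism_def embedding_def M'_def)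
  then have "elementary ar M' M (id \<circ> g)" using elementary_isomorphism S(5) elementary_comp by blast
  moreover have "embedding ar M' M g"
    using g cl S(3) by (auto simp: embedding_def M'_def)
  moreover have "X \<subseteq> g ` univ M'" "countable (univ M')" using S g by (auto simp: M'_def)
  ultimately show ?thesis using that M' by simp
qed

lemma is_model_elementary:
  assumes "is_struct ar M" "elementary ar M N h" "is_model ar (Th ar K) N"
  shows "is_model ar (Th ar K) M"
  using assms valid_in_elementary by (fastforce simp: is_model_def Th_def sentence_def)

text \<open>This makes the type of the models immaterial. One environment takes countably many
  values: \<open>M\<close> is replaced by a countable copy \<open>M'\<close> over these values, then
  \<open>N\<close> by a countable copy \<open>N'\<close> over the image of \<open>M'\<close>. Model
  completeness applies to the induced map \<open>M' \<rightarrow> N'\<close>, and the elementary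
  maps \<open>g\<close> and \<open>k\<close> carry the result back.\<close>

lemma model_complete_elementary:
  fixes M :: "('f::countable, 'a) struct" and N :: "('f, 'b) struct"
  assumes mc: "model_complete TYPE('u) ar K" and inf: "infinite (UNIV :: 'u set)"
    and M: "is_model ar (Th ar K) M" and N: "is_model ar (Th ar K) N" and h: "embedding ar M N h"
  shows "elementary ar M N h"
proof -
  have "sat M e \<phi> \<longleftrightarrow> sat N (h \<circ> e) \<phi>" if wf: "wf_formula ar \<phi>" and e: "range e \<subseteq> univ M" for \<phi> e
  proof -
    have sM: "is_struct ar M" and sN: "is_struct ar N" using M N by (auto simp: is_model_def)
    obtain M' :: "('f, 'u) struct" and g where M': "is_struct ar M'" "embedding ar M' M g"
      "elementary ar M' M g" "range e \<subseteq> g ` univ M'" "countable (univ M')"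
      by (rule countable_elementary_pullback[OF inf sM _ e]) simp_all
    have gM: "g ` univ M' \<subseteq> univ M" and hM: "h ` univ M \<subseteq> univ N"
      using M'(2) h by (auto simp: embedding_def)
    have "countable (h ` g ` univ M')" "h ` g ` univ M' \<subseteq> univ N"
      using M'(5) gM hM by (simp, blast)
    then obtain N' :: "('f, 'u) struct" and k where N': "is_struct ar N'" "embedding ar N' N k"
      "elementary ar N' N k" "h ` g ` univ M' \<subseteq> k ` univ N'"
      by (rule countable_elementary_pullback[OF inf sN])
    \<comment> \<open>The map that closes the square, \<open>k \<circ> h' = h \<circ> g\<close>; it
      exists because \<open>N'\<close> was chosen to cover the image of \<open>M'\<close>.\<close>
    define h' where "h' = inv_into (univ N') k \<circ> h \<circ> g"
    have kh': "k (h' x) = h (g x)" "h' x \<in> univ N'" if "x \<in> univ M'" for x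
    proof -
      have "h (g x) \<in> k ` univ N'" using that N'(4) by auto
      then show "k (h' x) = h (g x)" "h' x \<in> univ N'"
        by (auto simp: h'_def f_inv_into_f inv_into_into)
    qed
    have k: "inj_on k (univ N')" using N'(2) by (simp add: embedding_def)
    have "embedding ar M' N' h'"
      unfolding embedding_def
    proof (intro conjI allI impI)
      show "h' ` univ M' \<subseteq> univ N'" using kh' by auto
      show "inj_on h' (univ M')"
      proof (rule inj_onI)
        fix x y assume "x \<in> univ M'" "y \<in> univ M'" "h' x = h' y"
        moreover from this have "h (g x) = h (g y)" using kh'(1)[of x] kh'(1)[of y] by simp
        moreover have "inj_on h (univ M)" "inj_on g (univ M')" using h M'(2) by (auto simp: embedding_def)
        moreover have "g x \<in> univ M" "g y \<in> univ M" using gM calculation(1,2) by auto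
        ultimately show "x = y" by (simp add: inj_on_eq_iff)
      qed
      fix f xs assume xs: "length xs = ar f \<and> set xs \<subseteq> univ M'"
      then have gxs: "set (map g xs) \<subseteq> univ M" and hxs: "set (map h' xs) \<subseteq> univ N'"
        using gM kh'(2) by (auto simp: image_subset_iff)
      have i: "intp M' f xs \<in> univ M'" using xs M'(1) by (simp add: is_struct_def)
      have "k (h' (intp M' f xs)) = h (g (intp M' f xs))" using kh' i by simp
      also have "\<dots> = h (intp M f (map g xs))" using xs M'(2) by (simp add: embedding_def)
      also have "\<dots> = intp N f (map h (map g xs))" using xs gxs h by (simp add: embedding_def)
      also have "map h (map g xs) = map k (map h' xs)" using xs kh' by auto
      also have "intp N f \<dots> = k (intp N' f (map h' xs))"
        using N'(2) xs hxs by (simp add: embedding_def)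
      finally have "k (h' (intp M' f xs)) = k (intp N' f (map h' xs))" .
      moreover have "intp N' f (map h' xs) \<in> univ N'" using N'(1) xs hxs by (simp add: is_struct_def)
      ultimately show "h' (intp M' f xs) = intp N' f (map h' xs)"
        using k kh'(2)[OF i] by (simp add: inj_on_eq_iff)
    qed
    moreover have "is_model ar (Th ar K) M'" "is_model ar (Th ar K) N'"
      using is_model_elementary M' N' M N by blast+
    ultimately have el: "elementary ar M' N' h'"
      using mc unfolding model_complete_def model_complete_theory_def by blast
    define e' where "e' = inv_into (univ M') g \<circ> e"
    have "e n \<in> g ` univ M'" for n using M'(4) by blast
    then have e': "range e' \<subseteq> univ M'" "g \<circ> e' = e"
      by (auto simp: e'_def fun_eq_iff f_inv_into_f inv_into_into)
    have he': "range (h' \<circ> e') \<subseteq> univ N'" using e' kh' by auto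
    have "k \<circ> (h' \<circ> e') = h \<circ> (g \<circ> e')" using kh'(1) e'(1) by (auto simp: fun_eq_iff image_subset_iff)
    then have "k \<circ> (h' \<circ> e') = h \<circ> e" by (simp only: e'(2))
    moreover have "sat M e \<phi> \<longleftrightarrow> sat M' e' \<phi>"
      using sat_elementary[OF M'(3) wf e'(1)] by (simp only: e'(2))
    moreover have "\<dots> \<longleftrightarrow> sat N' (h' \<circ> e') \<phi>" using el wf e'(1) by (rule sat_elementary)
    moreover have "\<dots> \<longleftrightarrow> sat N (k \<circ> (h' \<circ> e')) \<phi>" using N'(3) wf he' by (rule sat_elementary)
    ultimately show ?thesis by simp
  qed
  moreover have "h ` univ M \<subseteq> univ N" using h by (simp add: embedding_def)
  ultimately show ?thesis unfolding elementary_def by blast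
qed

section \<open>The Heisenberg group of a ring structure\<close>

abbreviation r0 :: "(ring_sym, 'a) struct \<Rightarrow> 'a" where "r0 F \<equiv> intp F RZero []"
abbreviation r1 :: "(ring_sym, 'a) struct \<Rightarrow> 'a" where "r1 F \<equiv> intp F ROne []"
abbreviation rneg :: "(ring_sym, 'a) struct \<Rightarrow> 'a \<Rightarrow> 'a" where "rneg F x \<equiv> intp F RMinus [x]"
abbreviation radd :: "(ring_sym, 'a) struct \<Rightarrow> 'a \<Rightarrow> 'a \<Rightarrow> 'a" where "radd F x y \<equiv> intp F RAdd [x, y]"
abbreviation rmul :: "(ring_sym, 'a) struct \<Rightarrow> 'a \<Rightarrow> 'a \<Rightarrow> 'a" where "rmul F x y \<equiv> intp F RMult [x, y]"
abbreviation g1 :: "(group_sym, 'a) struct \<Rightarrow> 'a" where "g1 G \<equiv> intp G GOne []"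
abbreviation ginv :: "(group_sym, 'a) struct \<Rightarrow> 'a \<Rightarrow> 'a" where "ginv G x \<equiv> intp G GInv [x]"
abbreviation gmul :: "(group_sym, 'a) struct \<Rightarrow> 'a \<Rightarrow> 'a \<Rightarrow> 'a" where "gmul G x y \<equiv> intp G GMult [x, y]"

primrec pick :: "'a \<times> 'a \<times> 'a \<Rightarrow> nat \<Rightarrow> 'a" where
  "pick p 0 = fst p"
| "pick p (Suc j) = (if j = 0 then fst (snd p) else snd (snd p))"

text \<open>The triple \<open>(x, y, z)\<close> stands for the unitriangular matrix with entries \<open>x\<close>, \<open>y\<close> next to the
  diagonal and \<open>z\<close> in the corner.\<close>

primrec heis_intp :: "(ring_sym, 'a) struct \<Rightarrow> group_sym \<Rightarrow> ('a \<times> 'a \<times> 'a) list \<Rightarrow> 'a \<times> 'a \<times> 'a" where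
  "heis_intp F GOne ps = (r0 F, r0 F, r0 F)"
| "heis_intp F GInv ps = (let p = ps ! 0 in
     (rneg F (pick p 0), rneg F (pick p 1), radd F (rmul F (pick p 0) (pick p 1)) (rneg F (pick p 2))))"
| "heis_intp F GMult ps = (let p = ps ! 0; q = ps ! 1 in
     (radd F (pick p 0) (pick q 0), radd F (pick p 1) (pick q 1),
      radd F (radd F (pick p 2) (pick q 2)) (rmul F (pick p 0) (pick q 1))))"

definition heis :: "(ring_sym, 'a) struct \<Rightarrow> (group_sym, 'a \<times> 'a \<times> 'a) struct" where
  "heis F = \<lparr>univ = univ F \<times> univ F \<times> univ F, intp = heis_intp F\<rparr>"

lemma pick_simps [simp]: "pick (x, y, z) 0 = x" "pick (x, y, z) (Suc 0) = y" "pick (x, y, z) 2 = z"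
  by (simp_all add: numeral_2_eq_2)

lemma heis_simps [simp]:
  "univ (heis F) = univ F \<times> univ F \<times> univ F"
  "g1 (heis F) = (r0 F, r0 F, r0 F)"
  "ginv (heis F) (x, y, z) = (rneg F x, rneg F y, radd F (rmul F x y) (rneg F z))"
  "gmul (heis F) (x, y, z) (x', y', z') =
     (radd F x x', radd F y y', radd F (radd F z z') (rmul F x y'))"
  by (simp_all add: heis_def Let_def)

lemma is_struct_group_iff:
  "is_struct group_arity G \<longleftrightarrow> g1 G \<in> univ G \<and> (\<forall>x\<in>univ G. ginv G x \<in> univ G) \<and>
     (\<forall>x\<in>univ G. \<forall>y\<in>univ G. gmul G x y \<in> univ G)" (is "?L \<longleftrightarrow> ?R")
proof
  assume ?L
  then have *: "\<And>f xs. length xs = group_arity f \<Longrightarrow> set xs \<subseteq> univ G \<Longrightarrow> intp G f xs \<in> univ G"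
    by (simp add: is_struct_def)
  show ?R using *[of "[]" GOne] *[of "[_]" GInv] *[of "[_, _]" GMult] by simp
next
  assume R: ?R
  have "intp G f xs \<in> univ G" if "length xs = group_arity f" "set xs \<subseteq> univ G" for f xs
    using that R by (cases f) (auto simp: length_Suc_conv numeral_2_eq_2)
  moreover have "univ G \<noteq> {}" using R by blast
  ultimately show ?L by (simp add: is_struct_def)
qed

lemma is_struct_ring_iff:
  "is_struct ring_arity F \<longleftrightarrow> r0 F \<in> univ F \<and> r1 F \<in> univ F \<and> (\<forall>x\<in>univ F. rneg F x \<in> univ F) \<and>
     (\<forall>x\<in>univ F. \<forall>y\<in>univ F. radd F x y \<in> univ F \<and> rmul F x y \<in> univ F)" (is "?L \<longleftrightarrow> ?R")
proof
  assume ?L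
  then have *: "\<And>f xs. length xs = ring_arity f \<Longrightarrow> set xs \<subseteq> univ F \<Longrightarrow> intp F f xs \<in> univ F"
    by (simp add: is_struct_def)
  show ?R using *[of "[]" RZero] *[of "[]" ROne] *[of "[_]" RMinus] *[of "[_, _]" RAdd] *[of "[_, _]" RMult]
    by simp
next
  assume R: ?R
  have "intp F f xs \<in> univ F" if "length xs = ring_arity f" "set xs \<subseteq> univ F" for f xs
    using that R by (cases f) (auto simp: length_Suc_conv numeral_2_eq_2)
  moreover have "univ F \<noteq> {}" using R by blast
  ultimately show ?L by (simp add: is_struct_def)
qed

lemma embedding_group_iff:
  "embedding group_arity G H h \<longleftrightarrow> h ` univ G \<subseteq> univ H \<and> inj_on h (univ G) \<and> h (g1 G) = g1 H \<and>
     (\<forall>x\<in>univ G. h (ginv G x) = ginv H (h x)) \<and>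
     (\<forall>x\<in>univ G. \<forall>y\<in>univ G. h (gmul G x y) = gmul H (h x) (h y))" (is "?L \<longleftrightarrow> ?R")
proof
  assume L: ?L
  then have *: "\<And>f xs. length xs = group_arity f \<Longrightarrow> set xs \<subseteq> univ G \<Longrightarrow> h (intp G f xs) = intp H f (map h xs)"
    by (simp add: embedding_def)
  show ?R using L *[of "[]" GOne] *[of "[_]" GInv] *[of "[_, _]" GMult] by (simp add: embedding_def)
next
  assume R: ?R
  have "h (intp G f xs) = intp H f (map h xs)" if "length xs = group_arity f" "set xs \<subseteq> univ G" for f xs
    using that R by (cases f) (auto simp: length_Suc_conv numeral_2_eq_2)
  with R show ?L by (simp add: embedding_def)
qed

lemma embedding_ring_iff:
  "embedding ring_arity F E h \<longleftrightarrow> h ` univ F \<subseteq> univ E \<and> inj_on h (univ F) \<and>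
     h (r0 F) = r0 E \<and> h (r1 F) = r1 E \<and>
     (\<forall>x\<in>univ F. h (rneg F x) = rneg E (h x)) \<and>
     (\<forall>x\<in>univ F. \<forall>y\<in>univ F. h (radd F x y) = radd E (h x) (h y)) \<and>
     (\<forall>x\<in>univ F. \<forall>y\<in>univ F. h (rmul F x y) = rmul E (h x) (h y))" (is "?L \<longleftrightarrow> ?R")
proof
  assume L: ?L
  then have *: "\<And>f xs. length xs = ring_arity f \<Longrightarrow> set xs \<subseteq> univ F \<Longrightarrow> h (intp F f xs) = intp E f (map h xs)"
    by (simp add: embedding_def)
  show ?R using L *[of "[]" RZero] *[of "[]" ROne] *[of "[_]" RMinus] *[of "[_, _]" RAdd] *[of "[_, _]" RMult]
    by (simp add: embedding_def)
next
  assume R: ?R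
  have "h (intp F f xs) = intp E f (map h xs)" if "length xs = ring_arity f" "set xs \<subseteq> univ F" for f xs
    using that R by (cases f) (auto simp: length_Suc_conv numeral_2_eq_2)
  with R show ?L by (simp add: embedding_def)
qed

lemma is_struct_heis: "is_struct ring_arity F \<Longrightarrow> is_struct group_arity (heis F)"
  unfolding is_struct_group_iff is_struct_ring_iff by auto

definition map3 :: "('a \<Rightarrow> 'b) \<Rightarrow> 'a \<times> 'a \<times> 'a \<Rightarrow> 'b \<times> 'b \<times> 'b" where
  "map3 h = map_prod h (map_prod h h)"

lemma map3_simp [simp]: "map3 h (x, y, z) = (h x, h y, h z)"
  by (simp add: map3_def)

lemma embedding_heis:
  assumes "is_struct ring_arity F" "embedding ring_arity F E h"
  shows "embedding group_arity (heis F) (heis E) (map3 h)"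
proof -
  have "inj_on h (univ F)" using assms(2) by (simp add: embedding_def)
  then have "inj_on (map3 h) (univ F \<times> univ F \<times> univ F)"
    by (auto simp: inj_on_def)
  then show ?thesis
    using assms unfolding embedding_group_iff embedding_ring_iff is_struct_ring_iff by auto
qed

section \<open>Interpreting the Heisenberg group in the ring\<close>

text \<open>A group term becomes a function from the coordinate index to ring terms. The combination
  step is kept apart from \<open>coord\<close> so that the latter is primitive recursive through the
  list of arguments.\<close>

primrec coord_op :: "group_sym \<Rightarrow> (nat \<Rightarrow> ring_sym fterm) list \<Rightarrow> nat \<Rightarrow> ring_sym fterm" where
  "coord_op GOne cs = (\<lambda>j. App RZero [])"
| "coord_op GInv cs = (\<lambda>j. if j = 2
     then App RAdd [App RMult [(cs ! 0) 0, (cs ! 0) 1], App RMinus [(cs ! 0) 2]]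
     else App RMinus [(cs ! 0) j])"
| "coord_op GMult cs = (\<lambda>j. if j = 2
     then App RAdd [App RAdd [(cs ! 0) 2, (cs ! 1) 2], App RMult [(cs ! 0) 0, (cs ! 1) 1]]
     else App RAdd [(cs ! 0) j, (cs ! 1) j])"

primrec coord :: "group_sym fterm \<Rightarrow> nat \<Rightarrow> ring_sym fterm" where
  "coord (Var n) = (\<lambda>j. Var (3 * n + j))"
| "coord (App f ts) = coord_op f (map coord ts)"

primrec coord_formula :: "group_sym formula \<Rightarrow> ring_sym formula" where
  "coord_formula (Eq s t) = Conj (Eq (coord s 0) (coord t 0))
     (Conj (Eq (coord s 1) (coord t 1)) (Eq (coord s 2) (coord t 2)))"
| "coord_formula (Neg \<phi>) = Neg (coord_formula \<phi>)"
| "coord_formula (Conj \<phi> \<psi>) = Conj (coord_formula \<phi>) (coord_formula \<psi>)"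
| "coord_formula (Exi n \<phi>) = Exi (3 * n) (Exi (3 * n + 1) (Exi (3 * n + 2) (coord_formula \<phi>)))"

text \<open>The environment side of the numbering \<open>3 * n + j\<close> in \<open>coord\<close>:
  triples assigned to group variables become values of blocks of three ring variables.\<close>

definition flatten :: "(nat \<Rightarrow> 'a \<times> 'a \<times> 'a) \<Rightarrow> nat \<Rightarrow> 'a" where
  "flatten e k = pick (e (k div 3)) (k mod 3)"

lemma less_3_cases: "(j::nat) < 3 \<Longrightarrow> j = 0 \<or> j = 1 \<or> j = 2"
  by auto

lemma wf_coord: "wf_term group_arity t \<Longrightarrow> wf_term ring_arity (coord t j)"
proof (induction t arbitrary: j)
  case (App f ts)
  then show ?case by (cases f) (auto simp: length_Suc_conv numeral_2_eq_2)
qed simp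

lemma wf_coord_formula: "wf_formula group_arity \<phi> \<Longrightarrow> wf_formula ring_arity (coord_formula \<phi>)"
  by (induction \<phi>) (auto simp: wf_coord)

lemma eval_coord:
  "wf_term group_arity t \<Longrightarrow> j < 3 \<Longrightarrow>
     eval_term F (flatten e) (coord t j) = pick (eval_term (heis F) e t) j"
proof (induction t arbitrary: j)
  case (Var n)
  then show ?case by (simp add: flatten_def)
next
  case (App f ts)
  show ?case
  proof (cases f)
    case GOne
    then show ?thesis using less_3_cases[OF App.prems(2)] by (auto simp: heis_def)
  next
    case GInv
    then obtain t where "ts = [t]" using App.prems by (auto simp: length_Suc_conv)
    then show ?thesis using less_3_cases[OF App.prems(2)] App.prems App.IH[of t] GInv
      by (auto simp: heis_def Let_def)
  next
    case GMult
    then obtain s t where "ts = [s, t]" using App.prems by (auto simp: length_Suc_conv numeral_2_eq_2)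
    then show ?thesis using less_3_cases[OF App.prems(2)] App.prems App.IH[of s] App.IH[of t] GMult
      by (auto simp: heis_def Let_def)
  qed
qed

lemma flatten_upd:
  "flatten (e(n := (x, y, z))) = (flatten e)(3 * n := x, 3 * n + 1 := y, 3 * n + 2 := z)"
proof
  fix k :: nat
  have "k = 3 * (k div 3) + k mod 3" by simp
  moreover have "k mod 3 < 3" by simp
  then have "k mod 3 = 0 \<or> k mod 3 = 1 \<or> k mod 3 = 2" by (rule less_3_cases)
  ultimately show "flatten (e(n := (x, y, z))) k = ((flatten e)(3 * n := x, 3 * n + 1 := y, 3 * n + 2 := z)) k"
    unfolding flatten_def by (cases "k div 3 = n") auto
qed

text \<open>Quantifying over a triple is quantifying over its three coordinates, because changing
  the group variable \<open>n\<close> changes exactly the block \<open>3 * n\<close>,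
  \<open>3 * n + 1\<close>, \<open>3 * n + 2\<close>.\<close>

lemma sat_coord_formula:
  "wf_formula group_arity \<phi> \<Longrightarrow> sat F (flatten e) (coord_formula \<phi>) \<longleftrightarrow> sat (heis F) e \<phi>"
proof (induction \<phi> arbitrary: e)
  case (Eq s t)
  have *: "p = q \<longleftrightarrow> pick p 0 = pick q 0 \<and> pick p 1 = pick q 1 \<and> pick p 2 = pick q 2" for p q :: "'a \<times> 'a \<times> 'a"
    by (cases p; cases q) auto
  show ?case using Eq
    by (simp add: eval_coord * [of "eval_term (heis F) e s"] del: pick.simps)
next
  case (Exi n \<phi>)
  have "sat F ((flatten e)(3 * n := x, 3 * n + 1 := y, 3 * n + 2 := z)) (coord_formula \<phi>)
      \<longleftrightarrow> sat (heis F) (e(n := (x, y, z))) \<phi>" for x y z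
    using Exi.IH[of "e(n := (x, y, z))"] Exi.prems by (simp only: flatten_upd wf_formula.simps)
  then show ?case by (simp del: fun_upd_apply)
qed auto

lemma range_flatten: "range e \<subseteq> A \<times> A \<times> A \<Longrightarrow> range (flatten e) \<subseteq> A"
proof -
  assume e: "range e \<subseteq> A \<times> A \<times> A"
  have "pick p j \<in> A" if "p \<in> A \<times> A \<times> A" for p j
    using that by (cases j) auto
  moreover have "e k \<in> A \<times> A \<times> A" for k using e by blast
  ultimately show ?thesis unfolding flatten_def by blast
qed

lemma flatten_surj: "range e \<subseteq> A \<Longrightarrow> \<exists>e'. range e' \<subseteq> A \<times> A \<times> A \<and> flatten e' = e"
proof (intro exI conjI)
  let ?e = "\<lambda>n. (e (3 * n), e (3 * n + 1), e (3 * n + 2))"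
  show "range e \<subseteq> A \<Longrightarrow> range ?e \<subseteq> A \<times> A \<times> A" by auto
  show "flatten ?e = e"
  proof
    fix k :: nat
    have k: "k = 3 * (k div 3) + k mod 3" by simp
    have "k mod 3 < 3" by simp
    then have "pick (?e (k div 3)) (k mod 3) = e (3 * (k div 3) + k mod 3)"
      using less_3_cases by fastforce
    then show "flatten ?e k = e k" using k unfolding flatten_def by simp
  qed
qed

lemma flatten_map3: "flatten (map3 h \<circ> e) = h \<circ> flatten e"
proof
  fix k
  have "pick (map3 h p) j = h (pick p j)" for p j
    by (cases p; cases j) auto
  then show "flatten (map3 h \<circ> e) k = (h \<circ> flatten e) k" by (simp add: flatten_def)
qed

text \<open>Every environment of the ring is a flattened one, hence the equivalence in both
  directions.\<close>

lemma valid_in_coord_formula: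
  assumes "wf_formula group_arity \<phi>"
  shows "valid_in F (coord_formula \<phi>) \<longleftrightarrow> valid_in (heis F) \<phi>"
proof
  assume *: "valid_in F (coord_formula \<phi>)"
  show "valid_in (heis F) \<phi>"
    unfolding valid_in_def
  proof (intro allI impI)
    fix e :: "nat \<Rightarrow> _" assume "range e \<subseteq> univ (heis F)"
    then have "range (flatten e) \<subseteq> univ F" by (simp add: range_flatten)
    then show "sat (heis F) e \<phi>" using * sat_coord_formula[OF assms, of F e] by (simp add: valid_in_def)
  qed
next
  assume *: "valid_in (heis F) \<phi>"
  show "valid_in F (coord_formula \<phi>)"
    unfolding valid_in_def
  proof (intro allI impI)
    fix e :: "nat \<Rightarrow> _" assume "range e \<subseteq> univ F"
    then obtain e' where "range e' \<subseteq> univ (heis F)" "flatten e' = e"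
      using flatten_surj[of e "univ F"] unfolding heis_simps by blast
    then show "sat F e (coord_formula \<phi>)"
      using * sat_coord_formula[OF assms, of F e'] by (simp add: valid_in_def)
  qed
qed

text \<open>The translation reduces truth in \<open>heis F\<close> to truth in \<open>F\<close>.
  Transfer of validity covers open formulas, so the free variables of the translated sentence need
  no analysis.\<close>

lemma is_model_heis:
  assumes F: "is_model ring_arity (Th ring_arity K) F" and K: "is_struct ring_arity K"
  shows "is_model group_arity (Th group_arity (heis K)) (heis F)"
proof (rule is_model_ThI)
  show "is_struct group_arity (heis F)" using F is_struct_heis[of F] by (simp add: is_model_def)
  fix \<phi> assume "sentence group_arity \<phi>" and K\<phi>: "valid_in (heis K) \<phi>"
  then have wf: "wf_formula group_arity \<phi>" by (simp add: sentence_def)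
  have "valid_in F (coord_formula \<phi>)"
    by (rule valid_in_model_Th[OF F K]) (use wf K\<phi> in \<open>simp_all add: wf_coord_formula valid_in_coord_formula\<close>)
  then show "valid_in (heis F) \<phi>" using valid_in_coord_formula[OF wf] by blast
qed

lemma elementary_heis:
  assumes "elementary ring_arity F E h"
  shows "elementary group_arity (heis F) (heis E) (map3 h)"
proof -
  have "h ` univ F \<subseteq> univ E" using assms by (simp add: elementary_def)
  then have "map3 h ` univ (heis F) \<subseteq> univ (heis E)" by auto
  moreover have "sat (heis F) e \<phi> \<longleftrightarrow> sat (heis E) (map3 h \<circ> e) \<phi>"
    if wf: "wf_formula group_arity \<phi>" and e: "range e \<subseteq> univ (heis F)" for \<phi> e
  proof -
    have "range (flatten e) \<subseteq> univ F" using e by (simp add: range_flatten)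
    from sat_elementary[OF assms wf_coord_formula[OF wf] this]
    show ?thesis
      by (simp only: sat_coord_formula[OF wf] flatten_map3[symmetric])
  qed
  ultimately show ?thesis unfolding elementary_def by blast
qed

lemma isomorphism_Heisenberg_heis:
  "isomorphism group_arity (group_struct (Heisenberg :: ('k::field ^ 3 ^ 3) monoid)) (heis ring_struct)
     (\<lambda>A. (A $ 1 $ 2, A $ 2 $ 3, A $ 1 $ 3))"
proof -
  let ?H = "Heisenberg :: ('k ^ 3 ^ 3) monoid"
  let ?c = "\<lambda>A :: 'k ^ 3 ^ 3. (A $ 1 $ 2, A $ 2 $ 3, A $ 1 $ 3)"
  interpret H: group ?H by (rule group_Heisenberg)
  have car: "carrier ?H = UT3" by (simp add: Heisenberg_def)
  have mult: "?c (A \<otimes>\<^bsub>?H\<^esub> B) = gmul (heis ring_struct) (?c A) (?c B)" if "A \<in> UT3" "B \<in> UT3" for A B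
    using that by (simp add: Heisenberg_def UT3_def matrix_matrix_mult_def sum_3 ring_struct_def algebra_simps)
  have inj: "inj_on ?c UT3"
    by (auto simp: inj_on_def UT3_def vec_eq_iff forall_3)
  have one: "?c \<one>\<^bsub>?H\<^esub> = g1 (heis ring_struct)"
    by (simp add: Heisenberg_def mat_def ring_struct_def)
  have inv: "?c (inv\<^bsub>?H\<^esub> A) = ginv (heis ring_struct) (?c A)" if A: "A \<in> UT3" for A
  proof -
    \<comment> \<open>The inverse of a matrix is known only through \<open>B A = 1\<close>; its
      three coordinates are solved from this equation.\<close>
    have "gmul (heis ring_struct) (?c (inv\<^bsub>?H\<^esub> A)) (?c A) = g1 (heis ring_struct)"
      using mult[of "inv\<^bsub>?H\<^esub> A" A] one H.l_inv[of A] H.inv_closed[of A] A by (simp only: car)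
    moreover define B where "B = inv\<^bsub>?H\<^esub> A"
    ultimately have "B $ 1 $ 2 + A $ 1 $ 2 = 0" "B $ 2 $ 3 + A $ 2 $ 3 = 0"
      "B $ 1 $ 3 + A $ 1 $ 3 + B $ 1 $ 2 * A $ 2 $ 3 = 0"
      by (simp_all add: ring_struct_def)
    then have "B $ 1 $ 2 = - A $ 1 $ 2" "B $ 2 $ 3 = - A $ 2 $ 3"
      "B $ 1 $ 3 = A $ 1 $ 2 * A $ 2 $ 3 + - A $ 1 $ 3"
      by (simp_all add: eq_neg_iff_add_eq_0) algebra
    then show ?thesis
      unfolding B_def by (simp add: ring_struct_def)
  qed
  have "p \<in> ?c ` UT3" for p :: "'k \<times> 'k \<times> 'k"
  proof -
    obtain x y z where p: "p = (x, y, z)" by (cases p)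
    let ?A = "vector [vector [1, x, z], vector [0, 1, y], vector [0, 0, 1]] :: 'k ^ 3 ^ 3"
    have "?A \<in> UT3" "p = ?c ?A" by (simp_all add: UT3_def p)
    then show ?thesis by (rule rev_image_eqI)
  qed
  then have "?c ` UT3 = UNIV" by blast
  moreover have "is_struct group_arity \<lparr>univ = UT3, intp = group_intp ?H\<rparr>"
    using is_struct_group[OF group_Heisenberg[where 'a = 'k]] unfolding group_struct_def car .
  ultimately show ?thesis
    using mult one inv inj
    unfolding isomorphism_def embedding_group_iff
    by (simp add: group_struct_def car ring_struct_def)
qed

section \<open>Interpreting the ring in the group\<close>

text \<open>This is the centre in the models of interest, but the translation of formulas below
  works over an arbitrary structure.\<close>

definition ring_dom :: "(group_sym, 'g) struct \<Rightarrow> 'g \<Rightarrow> 'g \<Rightarrow> 'g set" where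
  "ring_dom G a b = {z \<in> univ G. gmul G z a = gmul G a z \<and> gmul G z b = gmul G b z}"

text \<open>In terms of the commutator \<open>[x, y]\<close>, defined by \<open>x y = [x, y] y x\<close>: the product of
  \<open>u = [x, b]\<close> and \<open>v = [a, y]\<close> is \<open>[x, y]\<close>, where \<open>x\<close> commutes with \<open>a\<close> and \<open>y\<close> with \<open>b\<close>.\<close>

definition ring_prod :: "(group_sym, 'g) struct \<Rightarrow> 'g \<Rightarrow> 'g \<Rightarrow> 'g \<Rightarrow> 'g \<Rightarrow> 'g \<Rightarrow> bool" where
  "ring_prod G a b u v w \<longleftrightarrow> (\<exists>x\<in>univ G. \<exists>y\<in>univ G.
     gmul G x a = gmul G a x \<and> gmul G x b = gmul G u (gmul G b x) \<and>
     gmul G y b = gmul G b y \<and> gmul G a y = gmul G v (gmul G y a) \<and>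
     gmul G x y = gmul G w (gmul G y x))"

text \<open>Exactly what the translation of ring formulas uses. It is met in three situations:
  \<open>H(K)\<close> with any non-commuting pair, a model with the field on its own centre, and
  \<open>heis F\<close> with the standard pair over an abstract model \<open>F\<close>.\<close>

definition interprets ::
  "(ring_sym, 'a) struct \<Rightarrow> (group_sym, 'g) struct \<Rightarrow> 'g \<Rightarrow> 'g \<Rightarrow> ('a \<Rightarrow> 'g) \<Rightarrow> bool" where
  "interprets F G a b h \<longleftrightarrow> is_struct ring_arity F \<and> is_struct group_arity G \<and> a \<in> univ G \<and> b \<in> univ G \<and>
     bij_betw h (univ F) (ring_dom G a b) \<and> h (r0 F) = g1 G \<and>
     (\<forall>w\<in>univ G. gmul G a b = gmul G w (gmul G b a) \<longleftrightarrow> w = h (r1 F)) \<and>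
     (\<forall>x\<in>univ F. h (rneg F x) = ginv G (h x)) \<and>
     (\<forall>x\<in>univ F. \<forall>y\<in>univ F. h (radd F x y) = gmul G (h x) (h y)) \<and>
     (\<forall>x\<in>univ F. \<forall>y\<in>univ F. \<forall>w\<in>univ G. ring_prod G a b (h x) (h y) w \<longleftrightarrow> w = h (rmul F x y))"

abbreviation Mul :: "group_sym fterm \<Rightarrow> group_sym fterm \<Rightarrow> group_sym fterm" where
  "Mul s t \<equiv> App GMult [s, t]"

text \<open>The variables 0 and 1 hold the parameters \<open>a\<close> and \<open>b\<close>, and the ring variable \<open>n\<close> becomes the
  group variable \<open>n + 2\<close>.  The formula \<open>graph t d\<close> says that \<open>t\<close> has the value of the variable \<open>d\<close>;
  it uses variables above \<open>d\<close> for the values of subterms.\<close>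

primrec graph_op :: "ring_sym \<Rightarrow> (nat \<Rightarrow> group_sym formula) list \<Rightarrow> nat \<Rightarrow> group_sym formula" where
  "graph_op RZero gs = (\<lambda>d. Eq (Var d) (App GOne []))"
| "graph_op ROne gs = (\<lambda>d. Eq (Mul (Var 0) (Var 1)) (Mul (Var d) (Mul (Var 1) (Var 0))))"
| "graph_op RMinus gs = (\<lambda>d. Exi (d + 1) (Conj ((gs ! 0) (d + 1)) (Eq (Var d) (App GInv [Var (d + 1)]))))"
| "graph_op RAdd gs = (\<lambda>d. Exi (d + 1) (Conj ((gs ! 0) (d + 1))
     (Exi (d + 2) (Conj ((gs ! 1) (d + 2)) (Eq (Var d) (Mul (Var (d + 1)) (Var (d + 2))))))))"
| "graph_op RMult gs = (\<lambda>d. Exi (d + 1) (Conj ((gs ! 0) (d + 1))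
     (Exi (d + 2) (Conj ((gs ! 1) (d + 2))
       (Exi (d + 3) (Exi (d + 4)
         (Conj (Eq (Mul (Var (d + 3)) (Var 0)) (Mul (Var 0) (Var (d + 3))))
         (Conj (Eq (Mul (Var (d + 3)) (Var 1)) (Mul (Var (d + 1)) (Mul (Var 1) (Var (d + 3)))))
         (Conj (Eq (Mul (Var (d + 4)) (Var 1)) (Mul (Var 1) (Var (d + 4))))
         (Conj (Eq (Mul (Var 0) (Var (d + 4))) (Mul (Var (d + 2)) (Mul (Var (d + 4)) (Var 0))))
               (Eq (Mul (Var (d + 3)) (Var (d + 4))) (Mul (Var d) (Mul (Var (d + 4)) (Var (d + 3)))))))))))))))"

primrec graph :: "ring_sym fterm \<Rightarrow> nat \<Rightarrow> group_sym formula" where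
  "graph (Var n) = (\<lambda>d. Eq (Var d) (Var (n + 2)))"
| "graph (App f ts) = graph_op f (map graph ts)"

text \<open>The product of the ring is not a group term, so an equation becomes the existence of a
  common value of two graphs. That value sits at \<open>d\<close>: the ring variable
  \<open>n\<close> is the group variable \<open>n + 2\<close>, so adding 3 to the maximum gives an
  index above all of them and above the parameters. Quantifiers are restricted to
  \<open>ring_dom\<close>.\<close>

primrec group_formula :: "ring_sym formula \<Rightarrow> group_sym formula" where
  "group_formula (Eq s t) = (let d = Max (insert 0 (vars_term s \<union> vars_term t)) + 3
     in Exi d (Conj (graph s d) (graph t d)))"
| "group_formula (Neg \<phi>) = Neg (group_formula \<phi>)"
| "group_formula (Conj \<phi> \<psi>) = Conj (group_formula \<phi>) (group_formula \<psi>)"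
| "group_formula (Exi n \<phi>) = Exi (n + 2)
     (Conj (Conj (Eq (Mul (Var (n + 2)) (Var 0)) (Mul (Var 0) (Var (n + 2))))
                 (Eq (Mul (Var (n + 2)) (Var 1)) (Mul (Var 1) (Var (n + 2)))))
       (group_formula \<phi>))"

lemma wf_graph: "wf_term ring_arity t \<Longrightarrow> wf_formula group_arity (graph t d)"
proof (induction t arbitrary: d)
  case (App f ts)
  then show ?case by (cases f) (auto simp: length_Suc_conv numeral_2_eq_2)
qed simp

lemma wf_group_formula: "wf_formula ring_arity \<phi> \<Longrightarrow> wf_formula group_arity (group_formula \<phi>)"
  by (induction \<phi>) (auto simp: wf_graph Let_def)

context
  fixes F :: "(ring_sym, 'a) struct" and G :: "(group_sym, 'g) struct" and a b h
  assumes FG: "interprets F G a b h"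
begin

lemma interprets_closed: "x \<in> univ F \<Longrightarrow> h x \<in> univ G"
  using FG by (auto simp: interprets_def bij_betw_def ring_dom_def)

text \<open>Everything the term depends on is stored below \<open>d\<close>, and auxiliary values
  are stored above \<open>d\<close>, so the quantifiers of the graph never overwrite a variable or a
  parameter.\<close>

lemma sat_graph:
  assumes "wf_term ring_arity t" "\<forall>n\<in>vars_term t. n + 2 < d \<and> e' (n + 2) = h (e n)" "2 \<le> d"
    "range e \<subseteq> univ F" "range e' \<subseteq> univ G" "e' 0 = a" "e' 1 = b"
  shows "sat G e' (graph t d) \<longleftrightarrow> e' d = h (eval_term F e t)"
  using assms
proof (induction t arbitrary: e' d)
  case (App f ts)
  have st: "is_struct ring_arity F" using FG by (simp add: interprets_def)
  \<comment> \<open>The second argument is evaluated in an environment already updated at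
    \<open>d + 1\<close>, so the induction hypothesis is prepared for all environments that agree on
    the parameters and the variables of the term.\<close>
  have sub: "sat G (e'(d' := x)) (graph t d') \<longleftrightarrow> x = h (eval_term F e t)"
    if "t \<in> set ts" "x \<in> univ G" "d < d'" "range e' \<subseteq> univ G" "e' 0 = a" "e' 1 = b"
      "\<forall>n\<in>vars_term t. n + 2 < d \<and> e' (n + 2) = h (e n)" for t x d' and e' :: "nat \<Rightarrow> 'g"
  proof -
    have "wf_term ring_arity t" using App.prems that(1) by (auto simp: list_all_iff)
    have b: "n + 2 < d" if "n \<in> vars_term t" for n
      using App.prems(2) that \<open>t \<in> set ts\<close> by auto
    have "sat G (e'(d' := x)) (graph t d') \<longleftrightarrow> (e'(d' := x)) d' = h (eval_term F e t)"
    proof (rule App.IH)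
      show "\<forall>n\<in>vars_term t. n + 2 < d' \<and> (e'(d' := x)) (n + 2) = h (e n)"
        using b that by fastforce
    qed (use that App.prems(3,4) \<open>wf_term ring_arity t\<close> range_upd[OF that(4,2)] in auto)
    then show ?thesis by simp
  qed
  have val: "eval_term F e t \<in> univ F" if "t \<in> set ts" for t
  proof (rule eval_term_closed[OF st])
    show "wf_term ring_arity t" using App.prems(1) that by (simp add: list_all_iff)
  qed (use App.prems(4) in blast)
  have vt: "n + 2 < d \<and> e' (n + 2) = h (e n)" if "t \<in> set ts" "n \<in> vars_term t" for t n
    using App.prems(2) that by auto
  have sub1: "sat G (e'(Suc d := x)) (graph t (Suc d)) \<longleftrightarrow> x = h (eval_term F e t)"
    if "t \<in> set ts" "x \<in> univ G" for t x
    by (rule sub) (use that vt App.prems(5-7) in auto)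
  have sub2: "sat G (e'(Suc d := y, Suc (Suc d) := x)) (graph t (Suc (Suc d))) \<longleftrightarrow> x = h (eval_term F e t)"
    if "t \<in> set ts" "x \<in> univ G" "y \<in> univ G" for t x y
  proof (rule sub)
    show "\<forall>n\<in>vars_term t. n + 2 < d \<and> (e'(Suc d := y)) (n + 2) = h (e n)"
      using vt[OF that(1)] by fastforce
    show "range (e'(Suc d := y)) \<subseteq> univ G" using App.prems(5) that(3) by (rule range_upd)
  qed (use that App.prems(3,6,7) in auto)
  have d: "e' d \<in> univ G" using App.prems by auto
  show ?case
  proof (cases f)
    case RZero
    then show ?thesis using FG App.prems by (simp add: interprets_def)
  next
    case ROne
    then show ?thesis using FG App.prems d by (simp add: interprets_def)
  next
    case RMinus
    then obtain t where t: "ts = [t]" using App.prems by (auto simp: length_Suc_conv)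
    then show ?thesis using RMinus sub1[of t] val[of t] interprets_closed[of "eval_term F e t"] FG
      by (auto simp: interprets_def)
  next
    case RAdd
    then obtain s t where t: "ts = [s, t]" using App.prems by (auto simp: length_Suc_conv numeral_2_eq_2)
    then show ?thesis using RAdd sub1[of s] sub2[of t] val[of s] val[of t] FG
        interprets_closed[of "eval_term F e s"] interprets_closed[of "eval_term F e t"]
      by (auto simp: interprets_def)
  next
    case RMult
    then obtain s t where t: "ts = [s, t]" using App.prems by (auto simp: length_Suc_conv numeral_2_eq_2)
    let ?u = "h (eval_term F e s)" and ?v = "h (eval_term F e t)"
    have uv: "?u \<in> univ G" "?v \<in> univ G" using val t interprets_closed by auto
    have "d \<noteq> 0" "d \<noteq> 1" using App.prems by auto
    then have "sat G e' (graph (App f ts) d) \<longleftrightarrow> ring_prod G a b ?u ?v (e' d)"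
      using RMult t sub1[of s] sub2[of t] uv App.prems(6,7)
      by (simp add: ring_prod_def numeral_eq_Suc conj_assoc cong: conj_cong bex_cong)
    also have "\<dots> \<longleftrightarrow> e' d = h (rmul F (eval_term F e s) (eval_term F e t))"
      using FG d val t by (simp add: interprets_def)
    finally show ?thesis using RMult t by simp
  qed
qed auto

lemma sat_group_formula:
  assumes "wf_formula ring_arity \<phi>" "\<forall>n\<in>free_vars \<phi>. e' (n + 2) = h (e n)"
    "range e \<subseteq> univ F" "range e' \<subseteq> univ G" "e' 0 = a" "e' 1 = b"
  shows "sat G e' (group_formula \<phi>) \<longleftrightarrow> sat F e \<phi>"
  using assms
proof (induction \<phi> arbitrary: e e')
  case (Eq s t)
  define d where "d = Max (insert 0 (vars_term s \<union> vars_term t)) + 3"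
  have d: "n + 2 < d" if "n \<in> vars_term s \<union> vars_term t" for n
  proof -
    have "n \<le> Max (insert 0 (vars_term s \<union> vars_term t))" using that by simp
    then show ?thesis unfolding d_def by linarith
  qed
  have d2: "2 < d" by (simp add: d_def)
  have st: "is_struct ring_arity F" using FG by (simp add: interprets_def)
  have val: "eval_term F e s \<in> univ F" "eval_term F e t \<in> univ F"
    using Eq.prems by (auto intro!: eval_term_closed[OF st])
  have inj: "inj_on h (univ F)" using FG by (simp add: interprets_def bij_betw_def)
  have "sat G (e'(d := x)) (graph r d) \<longleftrightarrow> x = h (eval_term F e r)"
    if "x \<in> univ G" "r = s \<or> r = t" for x r
  proof -
    have "sat G (e'(d := x)) (graph r d) \<longleftrightarrow> (e'(d := x)) d = h (eval_term F e r)"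
    proof (rule sat_graph)
      show "\<forall>n\<in>vars_term r. n + 2 < d \<and> (e'(d := x)) (n + 2) = h (e n)"
        using Eq.prems that d by fastforce
    qed (use Eq.prems that d2 range_upd[OF Eq.prems(4) that(1)] in auto)
    then show ?thesis by simp
  qed
  then have "sat G e' (group_formula (Eq s t)) \<longleftrightarrow>
      (\<exists>x\<in>univ G. x = h (eval_term F e s) \<and> x = h (eval_term F e t))"
    by (simp add: Let_def flip: d_def cong: bex_cong)
  also have "\<dots> \<longleftrightarrow> eval_term F e s = eval_term F e t"
    using interprets_closed[OF val(1)] inj val by (auto simp: inj_on_eq_iff)
  finally show ?case by simp
next
  case (Exi n \<phi>)
  have dom: "ring_dom G a b = h ` univ F" using FG by (simp add: interprets_def bij_betw_def)
  have "sat G e' (group_formula (Exi n \<phi>)) \<longleftrightarrow>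
      (\<exists>z\<in>ring_dom G a b. sat G (e'(n + 2 := z)) (group_formula \<phi>))"
    using Exi.prems(5,6) by (auto simp: ring_dom_def)
  also have "\<dots> \<longleftrightarrow> (\<exists>x\<in>univ F. sat F (e(n := x)) \<phi>)"
    unfolding dom bex_simps
  proof (rule bex_cong[OF refl])
    fix x assume x: "x \<in> univ F"
    show "sat G (e'(n + 2 := h x)) (group_formula \<phi>) \<longleftrightarrow> sat F (e(n := x)) \<phi>"
    proof (rule Exi.IH)
      show "range (e(n := x)) \<subseteq> univ F" using Exi.prems(3) x by (rule range_upd)
      show "range (e'(n + 2 := h x)) \<subseteq> univ G" using Exi.prems(4) interprets_closed[OF x] by (rule range_upd)
    qed (use Exi.prems in auto)
  qed
  finally show ?case by simp
next
  case (Conj \<phi> \<psi>)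
  have "sat G e' (group_formula \<phi>) = sat F e \<phi>" "sat G e' (group_formula \<psi>) = sat F e \<psi>"
    by (rule Conj.IH; use Conj.prems in simp)+
  then show ?case by simp
next
  case (Neg \<phi>)
  then show ?case by simp
qed

end

section \<open>Complements in abelian groups\<close>

lemma (in group) subgroup_nat_pow: "subgroup H G \<Longrightarrow> x \<in> H \<Longrightarrow> x [^] (n::nat) \<in> H"
  by (induction n) (simp_all add: subgroup.one_closed subgroup.m_closed)

lemma (in group) subgroup_int_pow: "subgroup H G \<Longrightarrow> x \<in> H \<Longrightarrow> x [^] (n::int) \<in> H"
  unfolding int_pow_def2 by (cases "n < 0") (simp_all only: if_True if_False subgroup_nat_pow subgroup.m_inv_closed)

lemma (in group) subgroup_Union_chain:
  assumes "\<C> \<noteq> {}" "\<And>H. H \<in> \<C> \<Longrightarrow> subgroup H G" "\<And>H K. H \<in> \<C> \<Longrightarrow> K \<in> \<C> \<Longrightarrow> H \<subseteq> K \<or> K \<subseteq> H"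
  shows "subgroup (\<Union>\<C>) G"
proof (rule subgroupI)
  show "\<Union>\<C> \<subseteq> carrier G" using subgroup.subset[OF assms(2)] by fast
  obtain H where "H \<in> \<C>" using assms(1) by blast
  then show "\<Union>\<C> \<noteq> {}" using subgroup.one_closed[OF assms(2)] by fast
next
  fix x assume "x \<in> \<Union>\<C>"
  then show "inv x \<in> \<Union>\<C>" using subgroup.m_inv_closed[OF assms(2)] by fast
next
  fix x y assume "x \<in> \<Union>\<C>" "y \<in> \<Union>\<C>"
  then obtain H where "H \<in> \<C>" "x \<in> H" "y \<in> H" using assms(3) by blast
  then show "x \<otimes> y \<in> \<Union>\<C>" using subgroup.m_closed[OF assms(2)] by fast
qed

text \<open>A subgroup \<open>A\<close> maximal among those containing \<open>A\<^sub>0\<close> and meeting \<open>Z\<close> trivially is a complement: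
  if \<open>x\<close> lies outside \<open>A Z\<close>, then \<open>a x\<^sup>n = z\<close> with \<open>a \<in> A\<close> and \<open>1 \<noteq> z \<in> Z\<close>, so \<open>x\<^sup>n \<noteq> 1\<close>
  and \<open>z = w\<^sup>n\<close>; then \<open>y = x / w\<close> satisfies \<open>y\<^sup>n \<in> A\<close>, and torsion-freeness of \<open>Z\<close> puts \<open>y\<close> into \<open>A\<close>.\<close>

lemma (in group) complement_exists:
  assumes C: "subgroup C G" "\<And>x y. x \<in> C \<Longrightarrow> y \<in> C \<Longrightarrow> x \<otimes> y = y \<otimes> x"
    and Z: "subgroup Z G" "Z \<subseteq> C"
    and A0: "subgroup A0 G" "A0 \<subseteq> C" "A0 \<inter> Z \<subseteq> {\<one>}"
    and dich: "\<And>n::nat. (\<forall>x\<in>C. x [^] n = \<one>) \<or>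
       (\<forall>z\<in>Z. (\<exists>w\<in>Z. w [^] n = z) \<and> (z [^] n = \<one> \<longrightarrow> z = \<one>))"
  obtains A where "subgroup A G" "A0 \<subseteq> A" "A \<subseteq> C" "A \<inter> Z \<subseteq> {\<one>}"
    "\<And>x. x \<in> C \<Longrightarrow> \<exists>y\<in>A. \<exists>z\<in>Z. x = y \<otimes> z"
proof -
  let ?P = "{A. subgroup A G \<and> A0 \<subseteq> A \<and> A \<subseteq> C \<and> A \<inter> Z \<subseteq> {\<one>}}"
  have "\<exists>A\<in>?P. \<forall>X\<in>?P. A \<subseteq> X \<longrightarrow> X = A"
  proof (rule subset_Zorn_nonempty)
    show "?P \<noteq> {}" using A0 by blast
    fix \<C> assume \<C>: "\<C> \<noteq> {}" "subset.chain ?P \<C>"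
    have P: "H \<in> ?P" if "H \<in> \<C>" for H using \<C>(2) that unfolding subset_chain_def by blast
    have "subgroup (\<Union>\<C>) G"
    proof (rule subgroup_Union_chain[OF \<C>(1)])
      show "subgroup H G" if "H \<in> \<C>" for H using P[OF that] by simp
      show "H \<subseteq> K \<or> K \<subseteq> H" if "H \<in> \<C>" "K \<in> \<C>" for H K
        using \<C>(2) that unfolding subset_chain_def by blast
    qed
    moreover have "A0 \<subseteq> \<Union>\<C>" using P \<C>(1) by fast
    moreover have "\<Union>\<C> \<subseteq> C" using P by fast
    moreover have "\<Union>\<C> \<inter> Z \<subseteq> {\<one>}" using P by fast
    ultimately show "\<Union>\<C> \<in> ?P" by simp
  qed
  then obtain A where "A \<in> ?P" and max: "\<forall>X\<in>?P. A \<subseteq> X \<longrightarrow> X = A" ..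
  then have A: "subgroup A G" "A0 \<subseteq> A" "A \<subseteq> C" "A \<inter> Z \<subseteq> {\<one>}" by simp_all
  have CG: "x \<in> carrier G" if "x \<in> C" for x using subgroup.mem_carrier[OF C(1) that] .
  have AC: "x \<in> C" if "x \<in> A" for x using A(3) that by blast
  have Ccl: "x \<otimes> y \<in> C" if "x \<in> C" "y \<in> C" for x y using subgroup.m_closed[OF C(1) that] .
  have Acl: "x \<otimes> y \<in> A" if "x \<in> A" "y \<in> A" for x y using subgroup.m_closed[OF A(1) that] .
  have Ainv: "inv x \<in> A" if "x \<in> A" for x using subgroup.m_inv_closed[OF A(1) that] .
  have Cinv: "inv x \<in> C" if "x \<in> C" for x using subgroup.m_inv_closed[OF C(1) that] .
  have Zinv: "inv x \<in> Z" if "x \<in> Z" for x using subgroup.m_inv_closed[OF Z(1) that] .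
  have pow_C: "x [^] n \<in> C" if "x \<in> C" for x and n :: int
    using that C(1) by (simp add: subgroup_int_pow)
  have npow_C: "x [^] n \<in> C" if "x \<in> C" for x and n :: nat
    using pow_C[OF that, of "int n"] by (simp add: int_pow_int)
  have comm_pow: "(x \<otimes> y) [^] n = x [^] n \<otimes> y [^] n" if "x \<in> C" "y \<in> C" for x y and n :: nat
    using that C(2) CG by (intro pow_mult_distrib) auto
  \<comment> \<open>The subgroup generated by \<open>A\<close> and \<open>x\<close>; products have
    this form because all of it lies in the abelian group \<open>C\<close>.\<close>
  have ext: "subgroup {c \<otimes> x [^] (n::int) | c n. c \<in> A} G" "{c \<otimes> x [^] (n::int) | c n. c \<in> A} \<subseteq> C"
      "A \<subseteq> {c \<otimes> x [^] (n::int) | c n. c \<in> A}" "x \<in> {c \<otimes> x [^] (n::int) | c n. c \<in> A}"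
    if x: "x \<in> C" for x
  proof -
    let ?X = "{c \<otimes> x [^] (n::int) | c n. c \<in> A}"
    have xG: "x \<in> carrier G" using x CG by blast
    show sub: "?X \<subseteq> C" using AC Ccl pow_C[OF x] by auto
    have 1: "\<one> \<in> A" using subgroup.one_closed[OF A(1)] .
    show AX: "A \<subseteq> ?X"
    proof
      fix c assume "c \<in> A"
      then have "c = c \<otimes> x [^] (0::int)" using A(3) CG by auto
      then show "c \<in> ?X" using \<open>c \<in> A\<close> by blast
    qed
    have "x = \<one> \<otimes> x [^] (1::int)" using xG by simp
    then show "x \<in> ?X" using 1 by blast
    show "subgroup ?X G"
    proof (rule subgroupI)
      show "?X \<subseteq> carrier G" using sub CG by blast
      show "?X \<noteq> {}" using AX 1 by blast
      fix s assume "s \<in> ?X"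
      then obtain c n where c: "c \<in> A" "s = c \<otimes> x [^] (n::int)" by blast
      have cC: "c \<in> C" "inv c \<in> A" "inv c \<in> C" using c AC Ainv by auto
      have "inv s = inv (x [^] n) \<otimes> inv c" using c cC CG xG by (simp add: inv_mult_group)
      also have "\<dots> = inv c \<otimes> inv (x [^] n)" using C(2) cC(3) Cinv[OF pow_C[OF x, of n]] by simp
      also have "\<dots> = inv c \<otimes> x [^] (- n)" using xG by (simp add: int_pow_neg)
      finally show "inv s \<in> ?X" using cC by blast
      fix t assume "t \<in> ?X"
      then obtain d m where d: "d \<in> A" "t = d \<otimes> x [^] (m::int)" by blast
      have dC: "d \<in> C" using d A by blast
      have "s \<otimes> t = c \<otimes> (x [^] n \<otimes> d) \<otimes> x [^] m" using c d cC dC CG xG by (simp add: m_assoc)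
      also have "x [^] n \<otimes> d = d \<otimes> x [^] n" using C(2) dC pow_C[OF x] by blast
      also have "c \<otimes> (d \<otimes> x [^] n) \<otimes> x [^] m = (c \<otimes> d) \<otimes> x [^] (n + m)"
        using cC dC CG xG by (simp add: m_assoc int_pow_mult)
      finally show "s \<otimes> t \<in> ?X" using Acl[OF c(1) d(1)] by blast
    qed
  qed
  \<comment> \<open>Maximality forces the subgroup generated by \<open>A\<close> and
    \<open>x\<close> to meet \<open>Z\<close> nontrivially. Inverting the relation if necessary
    makes the exponent a natural number, as required by \<open>dich\<close>.\<close>
  have nat_rel: "\<exists>c\<in>A. \<exists>n::nat. \<exists>z\<in>Z. z \<noteq> \<one> \<and> c \<otimes> x [^] n = z" if x: "x \<in> C" "x \<notin> A" for x
  proof -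
    let ?X = "{c \<otimes> x [^] (n::int) | c n. c \<in> A}"
    have "\<not> ?X \<inter> Z \<subseteq> {\<one>}"
    proof
      assume "?X \<inter> Z \<subseteq> {\<one>}"
      then have "?X = A" using max[rule_format, of ?X] ext[OF x(1)] A(2) by simp
      then show False using ext(4)[OF x(1)] x(2) by simp
    qed
    then obtain c and n :: int where c: "c \<in> A" "c \<otimes> x [^] n \<in> Z" "c \<otimes> x [^] n \<noteq> \<one>" by blast
    have xG: "x \<in> carrier G" and cG: "c \<in> carrier G" using x c A CG by auto
    show ?thesis
    proof (cases "0 \<le> n")
      case True
      then have "x [^] n = x [^] nat n" by (simp only: pow_nat)
      then have "c \<otimes> x [^] nat n \<in> Z" "c \<otimes> x [^] nat n \<noteq> \<one>" using c by simp_all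
      then show ?thesis using c(1) by blast
    next
      case False
      then have n: "x [^] (- n) = x [^] nat (- n)" by (intro pow_nat[symmetric]) simp
      have "inv (c \<otimes> x [^] n) = inv c \<otimes> x [^] (- n)"
      proof -
        have "inv (c \<otimes> x [^] n) = inv (x [^] n \<otimes> c)" using C(2)[OF AC[OF c(1)] pow_C[OF x(1), of n]] by simp
        then show ?thesis using xG cG by (simp add: inv_mult_group int_pow_neg)
      qed
      then have e: "inv (c \<otimes> x [^] n) = inv c \<otimes> x [^] nat (- n)" by (simp only: n)
      have "inv (c \<otimes> x [^] n) \<in> Z" "inv (c \<otimes> x [^] n) \<noteq> \<one>"
        using c Zinv xG cG by simp_all
      then show ?thesis using Ainv[OF c(1)] unfolding e by blast
    qed
  qed
  have "\<exists>y\<in>A. \<exists>z\<in>Z. x = y \<otimes> z" if x: "x \<in> C" for x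
  proof (cases "x \<in> A")
    case True
    have "x = x \<otimes> \<one>" using CG[OF x] by simp
    then show ?thesis using True subgroup.one_closed[OF Z(1)] by blast
  next
    case False
    obtain c n z where c: "c \<in> A" "z \<in> Z" "z \<noteq> \<one>" "c \<otimes> x [^] (n::nat) = z" using nat_rel[OF x False] by blast
    have cG: "c \<in> carrier G" "x \<in> carrier G" "z \<in> carrier G" using c AC x Z(2) CG by auto
    have "x [^] n \<noteq> \<one>"
    proof
      assume "x [^] n = \<one>"
      then have "c = z" using c cG by simp
      then show False using c A(4) by blast
    qed
    then have Zn: "\<And>z. z \<in> Z \<Longrightarrow> (\<exists>w\<in>Z. w [^] n = z) \<and> (z [^] n = \<one> \<longrightarrow> z = \<one>)"
      using dich[of n] x by blast
    then obtain w where w: "w \<in> Z" "w [^] n = z" using c by blast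
    have wC: "w \<in> C" "inv w \<in> C" "w \<in> carrier G"
      using w Z(2) Cinv CG by blast+
    define y where "y = x \<otimes> inv w"
    have y: "y \<in> C" "y \<in> carrier G" using x wC Ccl CG by (auto simp: y_def)
    have xy: "x = y \<otimes> w" using cG wC by (simp add: y_def m_assoc)
    have "c \<otimes> y [^] n \<otimes> z = z"
    proof -
      have "c \<otimes> (y [^] n \<otimes> w [^] n) = z" using c(4) y wC comm_pow xy by simp
      then show ?thesis using cG y w(2) by (simp add: m_assoc)
    qed
    then have "c \<otimes> y [^] n = \<one>" using cG y by (simp add: r_cancel_one)
    then have "inv (y [^] n) = c" using cG y by (simp add: inv_equality)
    then have yn: "y [^] n = inv c" using y inv_inv[of "y [^] n"] by simp
    \<comment> \<open>Otherwise there is a second relation \<open>d y^m = t\<close> with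
      \<open>1 \<noteq> t\<close> in \<open>Z\<close>. As \<open>y^n\<close> lies in
      \<open>A\<close>, so does \<open>t^n\<close>; hence \<open>t^n = 1\<close>, against
      torsion-freeness.\<close>
    have "y \<in> A"
    proof (rule ccontr)
      assume "y \<notin> A"
      from nat_rel[OF y(1) this] obtain d m t where d: "d \<in> A" "t \<in> Z" "t \<noteq> \<one>" "d \<otimes> y [^] (m::nat) = t" by blast
      have dC: "d \<in> C" using d A by blast
      have "t [^] n = d [^] n \<otimes> (y [^] m) [^] n"
        using d(4) comm_pow[OF dC npow_C[OF y(1), of m], of n] by simp
      also have "(y [^] m) [^] n = (y [^] n) [^] m" using y by (simp add: nat_pow_pow mult.commute)
      also have "\<dots> = inv c [^] m" by (simp only: yn)
      finally have "t [^] n = d [^] n \<otimes> inv c [^] m" .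
      moreover have "d [^] n \<otimes> inv c [^] m \<in> A"
        using d(1) c(1) A(1) by (simp add: Acl Ainv subgroup_nat_pow)
      moreover have "t [^] n \<in> Z" using d(2) Z(1) by (simp add: subgroup_nat_pow)
      ultimately have "t [^] n = \<one>" using A(4) by auto
      then show False using Zn d by blast
    qed
    then show ?thesis using xy w by blast
  qed
  then show ?thesis using that A by blast
qed

section \<open>Groups with the elementary properties of a Heisenberg group\<close>

text \<open>All assumptions beyond the group laws are first-order in the parameters, so they pass
  from \<open>H(K)\<close> to its models. \<open>com_central\<close> is nilpotency of class 2;
  \<open>surj_a\<close> says that the commutator with \<open>b\<close> maps the centralizer of
  \<open>a\<close> onto the centre, and \<open>surj_b\<close> is its mirror image.\<close>

locale heis_group = group G for G (structure) +
  fixes a b :: 'a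
  assumes a [simp]: "a \<in> carrier G" and b [simp]: "b \<in> carrier G"
    and central: "\<lbrakk>z \<in> carrier G; z \<otimes> a = a \<otimes> z; z \<otimes> b = b \<otimes> z; x \<in> carrier G\<rbrakk> \<Longrightarrow> z \<otimes> x = x \<otimes> z"
    and com_central: "\<lbrakk>x \<in> carrier G; y \<in> carrier G; w \<in> carrier G; t \<in> carrier G; x \<otimes> y = w \<otimes> (y \<otimes> x)\<rbrakk>
      \<Longrightarrow> w \<otimes> t = t \<otimes> w"
    and surj_a: "\<lbrakk>z \<in> carrier G; z \<otimes> a = a \<otimes> z; z \<otimes> b = b \<otimes> z\<rbrakk>
      \<Longrightarrow> \<exists>x\<in>carrier G. x \<otimes> a = a \<otimes> x \<and> x \<otimes> b = z \<otimes> (b \<otimes> x)"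
    and surj_b: "\<lbrakk>z \<in> carrier G; z \<otimes> a = a \<otimes> z; z \<otimes> b = b \<otimes> z\<rbrakk>
      \<Longrightarrow> \<exists>y\<in>carrier G. y \<otimes> b = b \<otimes> y \<and> a \<otimes> y = z \<otimes> (y \<otimes> a)"
    and abelian_a: "\<lbrakk>x \<in> carrier G; y \<in> carrier G; x \<otimes> a = a \<otimes> x; y \<otimes> a = a \<otimes> y\<rbrakk> \<Longrightarrow> x \<otimes> y = y \<otimes> x"
    and abelian_b: "\<lbrakk>x \<in> carrier G; y \<in> carrier G; x \<otimes> b = b \<otimes> x; y \<otimes> b = b \<otimes> y\<rbrakk> \<Longrightarrow> x \<otimes> y = y \<otimes> x"
begin

section \<open>Commutator calculus\<close>

definition Z where "Z = {z \<in> carrier G. z \<otimes> a = a \<otimes> z \<and> z \<otimes> b = b \<otimes> z}"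
definition centralizer where "centralizer c = {x \<in> carrier G. x \<otimes> c = c \<otimes> x}"
definition com where "com x y = (x \<otimes> y) \<otimes> inv (y \<otimes> x)"

lemma Z_carrier [simp]: "z \<in> Z \<Longrightarrow> z \<in> carrier G"
  by (simp add: Z_def)

lemma centralizer_carrier [simp]: "x \<in> centralizer c \<Longrightarrow> x \<in> carrier G"
  by (simp add: centralizer_def)

lemma Z_comm: "z \<in> Z \<Longrightarrow> x \<in> carrier G \<Longrightarrow> x \<otimes> z = z \<otimes> x"
  unfolding Z_def by (blast intro: central[symmetric])

lemma Z_left_comm: "z \<in> Z \<Longrightarrow> x \<in> carrier G \<Longrightarrow> t \<in> carrier G \<Longrightarrow> x \<otimes> (z \<otimes> t) = z \<otimes> (x \<otimes> t)"
  by (simp only: m_assoc[symmetric] Z_carrier Z_comm[of z x])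

lemma com_closed [simp]: "x \<in> carrier G \<Longrightarrow> y \<in> carrier G \<Longrightarrow> com x y \<in> carrier G"
  by (simp add: com_def)

lemma com_eq: "x \<in> carrier G \<Longrightarrow> y \<in> carrier G \<Longrightarrow> x \<otimes> y = com x y \<otimes> (y \<otimes> x)"
  by (simp add: com_def m_assoc[of "x \<otimes> y" "inv (y \<otimes> x)" "y \<otimes> x"])

lemma com_iff:
  assumes "x \<in> carrier G" "y \<in> carrier G" "w \<in> carrier G"
  shows "x \<otimes> y = w \<otimes> (y \<otimes> x) \<longleftrightarrow> w = com x y"
proof
  assume "x \<otimes> y = w \<otimes> (y \<otimes> x)"
  then have "com x y = (w \<otimes> (y \<otimes> x)) \<otimes> inv (y \<otimes> x)" by (simp add: com_def)
  then show "w = com x y" using assms by (simp add: m_assoc[of w "y \<otimes> x" "inv (y \<otimes> x)"])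
next
  assume "w = com x y"
  then show "x \<otimes> y = w \<otimes> (y \<otimes> x)" using com_eq[OF assms(1,2)] by (simp only:)
qed

lemma com_Z [simp]:
  assumes "x \<in> carrier G" "y \<in> carrier G"
  shows "com x y \<in> Z"
proof -
  have "com x y \<otimes> t = t \<otimes> com x y" if "t \<in> carrier G" for t
    by (rule com_central[OF assms com_closed[OF assms] that com_eq[OF assms]])
  from this[OF a] this[OF b] show ?thesis
    unfolding Z_def mem_Collect_eq using com_closed[OF assms] by (intro conjI)
qed

lemma com_one_iff: "x \<in> carrier G \<Longrightarrow> y \<in> carrier G \<Longrightarrow> com x y = \<one> \<longleftrightarrow> x \<otimes> y = y \<otimes> x"
  using com_iff[of x y \<one>] by (simp add: eq_commute[of \<one>])

lemma subgroup_Z: "subgroup Z G"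
proof (rule subgroupI)
  have "\<one> \<in> Z" unfolding Z_def by simp
  then show "Z \<noteq> {}" by blast
next
  fix x assume x: "x \<in> Z"
  have "inv x \<otimes> c = c \<otimes> inv x" if "c \<in> carrier G" for c
  proof -
    have "inv x \<otimes> c = inv x \<otimes> (c \<otimes> x) \<otimes> inv x" using x that by (simp add: m_assoc)
    also have "c \<otimes> x = x \<otimes> c" using x that by (rule Z_comm)
    also have "inv x \<otimes> (x \<otimes> c) \<otimes> inv x = c \<otimes> inv x" using x that by (simp flip: m_assoc)
    finally show ?thesis .
  qed
  then show "inv x \<in> Z" using x unfolding Z_def by simp
next
  fix x y assume "x \<in> Z" "y \<in> Z"
  note xy = this
  have "x \<otimes> y \<otimes> c = c \<otimes> (x \<otimes> y)" if "c \<in> carrier G" for c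
  proof -
    have "x \<otimes> y \<otimes> c = x \<otimes> (c \<otimes> y)" using xy that by (simp only: m_assoc Z_carrier Z_comm[of y c])
    also have "\<dots> = c \<otimes> (x \<otimes> y)" using xy that by (simp only: Z_left_comm[of x c y] Z_carrier)
    finally show ?thesis .
  qed
  then show "x \<otimes> y \<in> Z" using xy unfolding Z_def by simp
qed (use Z_carrier in blast)

lemma Z_closed [simp]: "\<one> \<in> Z" "x \<in> Z \<Longrightarrow> inv x \<in> Z" "x \<in> Z \<Longrightarrow> y \<in> Z \<Longrightarrow> x \<otimes> y \<in> Z"
  using subgroup_Z by (simp_all add: subgroup.one_closed subgroup.m_inv_closed subgroup.m_closed)

text \<open>Commutators are central, so those created by moving \<open>y\<close> to the front can be
  collected outside; the commutator is therefore bilinear.\<close>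

lemma com_mult_left:
  assumes "x \<in> carrier G" "x' \<in> carrier G" "y \<in> carrier G"
  shows "com (x \<otimes> x') y = com x y \<otimes> com x' y"
proof -
  have "x \<otimes> x' \<otimes> y = x \<otimes> (com x' y \<otimes> (y \<otimes> x'))" using assms by (simp add: m_assoc com_eq[of x' y])
  also have "\<dots> = com x' y \<otimes> ((x \<otimes> y) \<otimes> x')" using assms by (simp add: Z_left_comm[of "com x' y" x] m_assoc)
  also have "\<dots> = com x' y \<otimes> (com x y \<otimes> (y \<otimes> x) \<otimes> x')" using assms by (simp only: com_eq[of x y])
  also have "\<dots> = com x y \<otimes> com x' y \<otimes> (y \<otimes> (x \<otimes> x'))"
    using assms by (simp add: m_assoc Z_left_comm[of "com x y" "com x' y"])
  finally show ?thesis using assms com_iff[of "x \<otimes> x'" y "com x y \<otimes> com x' y"] by simp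
qed

lemma com_swap: "x \<in> carrier G \<Longrightarrow> y \<in> carrier G \<Longrightarrow> com y x = inv (com x y)"
  unfolding com_def by (subst inv_mult_group) simp_all

lemma com_mult_right:
  assumes "x \<in> carrier G" "y \<in> carrier G" "y' \<in> carrier G"
  shows "com x (y \<otimes> y') = com x y \<otimes> com x y'"
proof -
  have "com x (y \<otimes> y') = inv (com y x \<otimes> com y' x)"
    using assms com_swap[of "y \<otimes> y'" x] by (simp add: com_mult_left)
  also have "\<dots> = inv (com y' x) \<otimes> inv (com y x)" using assms by (simp add: inv_mult_group)
  also have "\<dots> = com x y' \<otimes> com x y" using assms by (simp add: com_swap[of y] com_swap[of y'])
  also have "\<dots> = com x y \<otimes> com x y'" using assms by (intro Z_comm) simp_all
  finally show ?thesis .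
qed

lemma com_one [simp]: "y \<in> carrier G \<Longrightarrow> com \<one> y = \<one>" "y \<in> carrier G \<Longrightarrow> com y \<one> = \<one>"
  by (simp_all add: com_one_iff)

lemma com_inv_left: "x \<in> carrier G \<Longrightarrow> y \<in> carrier G \<Longrightarrow> com (inv x) y = inv (com x y)"
  using com_mult_left[of "inv x" x y] by (simp add: inv_equality)

lemma com_inv_right: "x \<in> carrier G \<Longrightarrow> y \<in> carrier G \<Longrightarrow> com x (inv y) = inv (com x y)"
  using com_mult_right[of x "inv y" y] by (simp add: inv_equality)

lemma com_Z_one [simp]: "z \<in> Z \<Longrightarrow> y \<in> carrier G \<Longrightarrow> com z y = \<one>" "z \<in> Z \<Longrightarrow> y \<in> carrier G \<Longrightarrow> com y z = \<one>"
  using Z_comm[of z y] by (simp_all add: com_one_iff)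

lemma centralizer_iff: "c \<in> carrier G \<Longrightarrow> x \<in> centralizer c \<longleftrightarrow> x \<in> carrier G \<and> com x c = \<one>"
  unfolding centralizer_def by (auto simp: com_one_iff)

lemma subgroup_centralizer:
  assumes "c \<in> carrier G"
  shows "subgroup (centralizer c) G"
proof (rule subgroupI)
  have "\<one> \<in> centralizer c" using assms unfolding centralizer_def by simp
  then show "centralizer c \<noteq> {}" by blast
qed (use assms in \<open>auto simp: centralizer_iff com_inv_left com_mult_left simp del: centralizer_carrier\<close>)

lemma centralizer_com [simp]: "x \<in> centralizer c \<Longrightarrow> c \<in> carrier G \<Longrightarrow> com x c = \<one>"
    "x \<in> centralizer c \<Longrightarrow> c \<in> carrier G \<Longrightarrow> com c x = \<one>"
  unfolding centralizer_def by (simp_all add: com_one_iff)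

lemma Z_eq: "Z = centralizer a \<inter> centralizer b"
  unfolding Z_def centralizer_def by blast

lemma centralizer_comm:
  "x \<in> centralizer a \<Longrightarrow> y \<in> centralizer a \<Longrightarrow> x \<otimes> y = y \<otimes> x"
  "x \<in> centralizer b \<Longrightarrow> y \<in> centralizer b \<Longrightarrow> x \<otimes> y = y \<otimes> x"
  unfolding centralizer_def using abelian_a abelian_b by blast+

text \<open>The quotient of \<open>x\<close> and \<open>x'\<close> commutes with \<open>a\<close>
  and with \<open>b\<close>, hence is central and invisible to commutators. This makes the product
  on the centre independent of the left representative.\<close>

lemma com_cong_left:
  assumes "x \<in> centralizer a" "x' \<in> centralizer a" "com x b = com x' b" "y \<in> carrier G"
  shows "x \<otimes> inv x' \<in> Z" "com x y = com x' y"
proof -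
  have c: "x \<in> carrier G" "x' \<in> carrier G" using assms by simp_all
  have "com (x \<otimes> inv x') b = \<one>" "com (x \<otimes> inv x') a = \<one>"
    using assms c by (simp_all add: com_mult_left com_inv_left)
  then show z: "x \<otimes> inv x' \<in> Z" using c unfolding Z_eq Int_iff centralizer_iff[OF a] centralizer_iff[OF b] by simp
  have "com x y \<otimes> inv (com x' y) = \<one>"
    using com_Z_one(1)[OF z assms(4)] c assms(4) by (simp add: com_mult_left com_inv_left)
  then show "com x y = com x' y" using c assms(4) by (metis com_closed inv_closed inv_equality inv_inv)
qed

lemma com_cong_right:
  assumes "y \<in> centralizer b" "y' \<in> centralizer b" "com a y = com a y'" "x \<in> carrier G"
  shows "y \<otimes> inv y' \<in> Z" "com x y = com x y'"
proof -
  have c: "y \<in> carrier G" "y' \<in> carrier G" using assms by simp_all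
  have "com a (y \<otimes> inv y') = \<one>" using assms(3) c by (simp add: com_mult_right com_inv_right)
  then have "com (y \<otimes> inv y') a = \<one>" using com_swap[of a "y \<otimes> inv y'"] c by simp
  moreover have "com (y \<otimes> inv y') b = \<one>" using assms c by (simp add: com_mult_left com_inv_left)
  ultimately show z: "y \<otimes> inv y' \<in> Z" using c unfolding Z_eq Int_iff centralizer_iff[OF a] centralizer_iff[OF b] by simp
  have "com x y \<otimes> inv (com x y') = \<one>"
    using com_Z_one(2)[OF z assms(4)] c assms(4) by (simp add: com_mult_right com_inv_right)
  then show "com x y = com x y'" using c assms(4) by (metis com_closed inv_closed inv_equality inv_inv)
qed

lemma ex_com_a:
  assumes "u \<in> Z"
  shows "\<exists>x. x \<in> centralizer a \<and> com x b = u"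
proof -
  obtain x where x: "x \<in> carrier G" "x \<otimes> a = a \<otimes> x" "x \<otimes> b = u \<otimes> (b \<otimes> x)"
    using surj_a[of u] assms unfolding Z_def by blast
  have "u = com x b" using com_iff[OF x(1) b, of u] x(3) assms by simp
  then show ?thesis using x(1,2) unfolding centralizer_def by blast
qed

lemma ex_com_b:
  assumes "v \<in> Z"
  shows "\<exists>y. y \<in> centralizer b \<and> com a y = v"
proof -
  obtain y where y: "y \<in> carrier G" "y \<otimes> b = b \<otimes> y" "a \<otimes> y = v \<otimes> (y \<otimes> a)"
    using surj_b[of v] assms unfolding Z_def by blast
  have "v = com a y" using com_iff[OF a y(1), of v] y(3) assms by simp
  then show ?thesis using y(1,2) unfolding centralizer_def by blast
qed

section \<open>The field multiplication on the centre\<close>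

definition prd where
  "prd u v = com (SOME x. x \<in> centralizer a \<and> com x b = u) (SOME y. y \<in> centralizer b \<and> com a y = v)"

text \<open>Any representatives compute the product, not only the chosen ones: they are exchanged
  one at a time by \<open>com_cong_left\<close> and \<open>com_cong_right\<close>.\<close>

lemma prd_com:
  assumes "x \<in> centralizer a" "y \<in> centralizer b"
  shows "prd (com x b) (com a y) = com x y"
proof -
  let ?x = "SOME x'. x' \<in> centralizer a \<and> com x' b = com x b"
  let ?y = "SOME y'. y' \<in> centralizer b \<and> com a y' = com a y"
  have x: "?x \<in> centralizer a \<and> com ?x b = com x b" by (rule someI[of _ x]) (use assms in simp)
  have y: "?y \<in> centralizer b \<and> com a ?y = com a y" by (rule someI[of _ y]) (use assms in simp)
  have "com ?x ?y = com x ?y" 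
    by (rule com_cong_left(2)[OF conjunct1[OF x] assms(1) conjunct2[OF x] centralizer_carrier[OF conjunct1[OF y]]])
  also have "\<dots> = com x y"
    by (rule com_cong_right(2)[OF conjunct1[OF y] assms(2) conjunct2[OF y] centralizer_carrier[OF assms(1)]])
  finally show ?thesis by (simp only: prd_def)
qed

lemma prd_closed [simp]:
  assumes "u \<in> Z" "v \<in> Z"
  shows "prd u v \<in> Z"
proof -
  obtain x y where "x \<in> centralizer a" "com x b = u" "y \<in> centralizer b" "com a y = v"
    using ex_com_a[OF assms(1)] ex_com_b[OF assms(2)] by blast
  then show ?thesis using prd_com[of x y] by auto
qed

text \<open>The left-hand side is \<open>ring_prod\<close> written out; this connects the chosen
  representatives with the existential definition.\<close>

lemma prd_iff:
  assumes u: "u \<in> Z" and v: "v \<in> Z" and w: "w \<in> carrier G"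
  shows "(\<exists>x\<in>carrier G. \<exists>y\<in>carrier G. x \<otimes> a = a \<otimes> x \<and> x \<otimes> b = u \<otimes> (b \<otimes> x) \<and>
      y \<otimes> b = b \<otimes> y \<and> a \<otimes> y = v \<otimes> (y \<otimes> a) \<and> x \<otimes> y = w \<otimes> (y \<otimes> x)) \<longleftrightarrow> w = prd u v" (is "?L \<longleftrightarrow> _")
proof
  assume ?L
  then obtain x y where xy: "x \<in> carrier G" "y \<in> carrier G" "x \<otimes> a = a \<otimes> x" "x \<otimes> b = u \<otimes> (b \<otimes> x)"
    "y \<otimes> b = b \<otimes> y" "a \<otimes> y = v \<otimes> (y \<otimes> a)" "x \<otimes> y = w \<otimes> (y \<otimes> x)" by blast
  have "u = com x b" using com_iff[OF xy(1) b, of u] xy(4) u by simp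
  moreover have "v = com a y" using com_iff[OF a xy(2), of v] xy(6) v by simp
  moreover have "w = com x y" using com_iff[OF xy(1,2) w] xy(7) by simp
  moreover have "x \<in> centralizer a" "y \<in> centralizer b" using xy unfolding centralizer_def by blast+
  ultimately show "w = prd u v" by (simp add: prd_com)
next
  assume "w = prd u v"
  obtain x y where xy: "x \<in> centralizer a" "com x b = u" "y \<in> centralizer b" "com a y = v"
    using ex_com_a[OF u] ex_com_b[OF v] by blast
  then have c: "x \<in> carrier G" "y \<in> carrier G" by simp_all
  have "w = com x y" using prd_com[of x y] xy \<open>w = prd u v\<close> by simp
  then have "x \<otimes> y = w \<otimes> (y \<otimes> x)" using com_eq[OF c] by (simp only:)
  moreover have "x \<otimes> a = a \<otimes> x" "y \<otimes> b = b \<otimes> y" using xy(1,3) unfolding centralizer_def by blast+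
  moreover have "x \<otimes> b = u \<otimes> (b \<otimes> x)" using com_eq[OF c(1) b] unfolding xy(2) .
  moreover have "a \<otimes> y = v \<otimes> (y \<otimes> a)" using com_eq[OF a c(2)] unfolding xy(4) .
  ultimately show ?L using c by blast
qed

text \<open>For inverses in coordinates. The field laws as a whole reach the centre through the
  theory of \<open>K\<close>, not through commutator identities.\<close>

lemma prd_inv_left:
  assumes "u \<in> Z" "v \<in> Z"
  shows "prd (inv u) v = inv (prd u v)"
proof -
  obtain x y where xy: "x \<in> centralizer a" "com x b = u" "y \<in> centralizer b" "com a y = v"
    using ex_com_a[OF assms(1)] ex_com_b[OF assms(2)] by blast
  have "inv x \<in> centralizer a" using xy(1) by (simp add: subgroup.m_inv_closed[OF subgroup_centralizer])
  then have "prd (com (inv x) b) (com a y) = com (inv x) y" using xy by (intro prd_com)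
  then show ?thesis using xy prd_com[of x y] by (simp add: com_inv_left)
qed

end

section \<open>Coordinates from complements of the centre\<close>

locale heis_split = heis_group +
  fixes A B
  assumes A: "subgroup A G" "A \<subseteq> centralizer a" "A \<inter> Z \<subseteq> {\<one>}"
      "\<And>x. x \<in> centralizer a \<Longrightarrow> \<exists>y\<in>A. \<exists>z\<in>Z. x = y \<otimes> z"
    and B: "subgroup B G" "B \<subseteq> centralizer b" "B \<inter> Z \<subseteq> {\<one>}"
      "\<And>x. x \<in> centralizer b \<Longrightarrow> \<exists>y\<in>B. \<exists>z\<in>Z. x = y \<otimes> z"
begin

text \<open>The commutator with \<open>b\<close> maps the centralizer of \<open>a\<close> onto the
  centre with kernel the centre, so it is an isomorphism on the complement \<open>A\<close>; this is
  its inverse.\<close>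

definition sec_a where "sec_a u = (THE x. x \<in> A \<and> com x b = u)"
definition sec_b where "sec_b v = (THE y. y \<in> B \<and> com a y = v)"
text \<open>The factor from \<open>B\<close> comes first: with matrices, (0, v, 0) times (u, 0, 0)
  is (u, v, 0), whereas the opposite order adds \<open>u v\<close> in the corner.\<close>

definition elt where "elt p = (case p of (u, v, w) \<Rightarrow> sec_b v \<otimes> sec_a u \<otimes> w)"

lemma sec_a_eqI:
  assumes "x \<in> A" "com x b = u"
  shows "sec_a u = x"
  unfolding sec_a_def
proof (rule the_equality)
  fix y assume y: "y \<in> A \<and> com y b = u"
  have xy: "x \<in> centralizer a" "y \<in> centralizer a" using A(2) assms y by auto
  have "y \<otimes> inv x \<in> Z" using xy y assms by (intro com_cong_left[of _ _ \<one>]) auto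
  moreover have "y \<otimes> inv x \<in> A" using A(1) y assms by (simp add: subgroup.m_closed subgroup.m_inv_closed)
  ultimately have "y \<otimes> inv x = \<one>" using A(3) by blast
  then show "y = x" using xy by (metis centralizer_carrier inv_closed inv_equality inv_inv)
qed (use assms in simp)

lemma sec_b_eqI:
  assumes "x \<in> B" "com a x = v"
  shows "sec_b v = x"
  unfolding sec_b_def
proof (rule the_equality)
  fix y assume y: "y \<in> B \<and> com a y = v"
  have xy: "x \<in> centralizer b" "y \<in> centralizer b" using B(2) assms y by auto
  have "y \<otimes> inv x \<in> Z" using xy y assms by (intro com_cong_right[of _ _ \<one>]) auto
  moreover have "y \<otimes> inv x \<in> B" using B(1) y assms by (simp add: subgroup.m_closed subgroup.m_inv_closed)
  ultimately have "y \<otimes> inv x = \<one>" using B(3) by blast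
  then show "y = x" using xy by (metis centralizer_carrier inv_closed inv_equality inv_inv)
qed (use assms in simp)

lemma sec_a:
  assumes "u \<in> Z"
  shows "sec_a u \<in> A" "com (sec_a u) b = u" "sec_a u \<in> centralizer a" "sec_a u \<in> carrier G"
proof -
  obtain x where x: "x \<in> centralizer a" "com x b = u" using ex_com_a[OF assms] by blast
  then obtain y z where yz: "y \<in> A" "z \<in> Z" "x = y \<otimes> z" using A(4) by blast
  then have y: "y \<in> centralizer a" using A(2) by blast
  have "com y b = u" using x yz y by (simp add: com_mult_left)
  then have "sec_a u = y" using yz by (intro sec_a_eqI)
  then show "sec_a u \<in> A" "com (sec_a u) b = u" "sec_a u \<in> centralizer a" "sec_a u \<in> carrier G"
    using yz y \<open>com y b = u\<close> by simp_all
qed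

lemma sec_b:
  assumes "v \<in> Z"
  shows "sec_b v \<in> B" "com a (sec_b v) = v" "sec_b v \<in> centralizer b" "sec_b v \<in> carrier G"
proof -
  obtain x where x: "x \<in> centralizer b" "com a x = v" using ex_com_b[OF assms] by blast
  then obtain y z where yz: "y \<in> B" "z \<in> Z" "x = y \<otimes> z" using B(4) by blast
  then have y: "y \<in> centralizer b" using B(2) by blast
  have "com a y = v" using x yz y by (simp add: com_mult_right)
  then have "sec_b v = y" using yz by (intro sec_b_eqI)
  then show "sec_b v \<in> B" "com a (sec_b v) = v" "sec_b v \<in> centralizer b" "sec_b v \<in> carrier G"
    using yz y \<open>com a y = v\<close> by simp_all
qed

lemma sec_a_mult:
  assumes "u \<in> Z" "u' \<in> Z"
  shows "sec_a (u \<otimes> u') = sec_a u \<otimes> sec_a u'"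
  using assms A(1) by (intro sec_a_eqI) (simp_all add: sec_a com_mult_left subgroup.m_closed)

lemma sec_b_mult:
  assumes "u \<in> Z" "u' \<in> Z"
  shows "sec_b (u \<otimes> u') = sec_b u \<otimes> sec_b u'"
  using assms B(1) by (intro sec_b_eqI) (simp_all add: sec_b com_mult_right subgroup.m_closed)

lemma sec_one: "sec_a \<one> = \<one>" "sec_b \<one> = \<one>"
  using A(1) B(1) by (simp_all add: sec_a_eqI sec_b_eqI subgroup.one_closed)

lemma elt_closed: "p \<in> Z \<times> Z \<times> Z \<Longrightarrow> elt p \<in> carrier G"
  by (auto simp: elt_def sec_a sec_b)

lemma com_elt:
  assumes "u \<in> Z" "v \<in> Z" "w \<in> Z"
  shows "com (elt (u, v, w)) b = u" "com a (elt (u, v, w)) = v"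
  using assms by (simp_all add: elt_def com_mult_left com_mult_right sec_a sec_b)

lemma inj_elt: "inj_on elt (Z \<times> Z \<times> Z)"
proof (rule inj_onI)
  fix p q assume "p \<in> Z \<times> Z \<times> Z" "q \<in> Z \<times> Z \<times> Z" "elt p = elt q"
  then obtain u v w u' v' w' where pq: "p = (u, v, w)" "q = (u', v', w')"
    and Z: "u \<in> Z" "v \<in> Z" "w \<in> Z" "u' \<in> Z" "v' \<in> Z" "w' \<in> Z" and eq: "elt (u, v, w) = elt (u', v', w')"
    by (elim SigmaE) simp
  have "u = u'" "v = v'" using com_elt[OF Z(1-3)] com_elt[OF Z(4-6)] eq by simp_all
  moreover from this have "w = w'" using eq Z by (simp add: elt_def sec_a sec_b)
  ultimately show "p = q" by (simp add: pq)
qed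

lemma elt_surj:
  assumes g: "g \<in> carrier G"
  shows "g \<in> elt ` (Z \<times> Z \<times> Z)"
proof -
  \<comment> \<open>The first two coordinates are read off as commutators with the parameters. What
    remains of \<open>g\<close> commutes with both parameters and is the central coordinate.\<close>
  define u v where "u = com g b" and "v = com a g"
  have uv: "u \<in> Z" "v \<in> Z" using g by (simp_all add: u_def v_def)
  define k where "k = inv (sec_b v \<otimes> sec_a u) \<otimes> g"
  have k: "k \<in> carrier G" using uv g by (simp add: k_def sec_a sec_b)
  have "com k b = \<one>"
    using uv g by (simp add: k_def com_mult_left com_inv_left sec_a sec_b) (simp add: u_def)
  moreover have "com a k = \<one>"
    using uv g by (simp add: k_def com_mult_right com_inv_right sec_a sec_b) (simp add: v_def)
  ultimately have "k \<in> Z" using k unfolding Z_eq Int_iff centralizer_iff[OF a] centralizer_iff[OF b]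
    by (simp add: com_swap[of a k])
  moreover have "elt (u, v, k) = g" using uv g by (simp add: elt_def k_def sec_a sec_b flip: m_assoc)
  ultimately show ?thesis using uv by (metis image_eqI mem_Sigma_iff)
qed

lemma elt_image: "elt ` (Z \<times> Z \<times> Z) = carrier G"
  using elt_closed elt_surj by blast

text \<open>To collect factors, \<open>sec_a u\<close> must pass \<open>sec_b v'\<close>; the
  commutator that appears is \<open>prd u v'\<close>, the corner term of matrix
  multiplication.\<close>

lemma elt_mult:
  assumes "u \<in> Z" "v \<in> Z" "w \<in> Z" "u' \<in> Z" "v' \<in> Z" "w' \<in> Z"
  shows "elt (u \<otimes> u', v \<otimes> v', (w \<otimes> w') \<otimes> prd u v') = elt (u, v, w) \<otimes> elt (u', v', w')"
proof -
  let ?x = "sec_a u" and ?y = "sec_b v" and ?x' = "sec_a u'" and ?y' = "sec_b v'"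
  have c: "?x \<in> carrier G" "?y \<in> carrier G" "?x' \<in> carrier G" "?y' \<in> carrier G"
    using assms by (simp_all add: sec_a sec_b)
  have xy: "com ?x ?y' = prd u v'" using prd_com[of ?x ?y'] assms by (simp add: sec_a sec_b)
  have "elt (u, v, w) \<otimes> elt (u', v', w') = (w \<otimes> w') \<otimes> (?y \<otimes> (?x \<otimes> ?y') \<otimes> ?x')"
    using assms c
    by (simp add: elt_def m_assoc Z_comm[of w' ?x'] Z_left_comm[of w' ?y'] Z_left_comm[of w ?x]
        Z_left_comm[of w' ?x] Z_left_comm[of w ?y] Z_left_comm[of w' ?y])
  also have "?x \<otimes> ?y' = prd u v' \<otimes> (?y' \<otimes> ?x)" using com_eq[of ?x ?y'] c xy by simp
  also have "(w \<otimes> w') \<otimes> (?y \<otimes> (prd u v' \<otimes> (?y' \<otimes> ?x)) \<otimes> ?x') =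
      (?y \<otimes> ?y') \<otimes> (?x \<otimes> ?x') \<otimes> ((w \<otimes> w') \<otimes> prd u v')"
    using assms c
    by (simp add: m_assoc Z_comm[of "prd u v'" w'] Z_comm[of w' ?x']
        Z_left_comm[of "prd u v'" w] Z_left_comm[of "prd u v'" w'] Z_left_comm[of "prd u v'" ?y]
        Z_left_comm[of "prd u v'" ?y'] Z_left_comm[of "prd u v'" ?x] Z_left_comm[of "prd u v'" ?x']
        Z_left_comm[of w ?y] Z_left_comm[of w ?y'] Z_left_comm[of w ?x] Z_left_comm[of w ?x']
        Z_left_comm[of w' ?y] Z_left_comm[of w' ?y'] Z_left_comm[of w' ?x])
  finally show ?thesis using assms by (simp add: elt_def sec_a_mult sec_b_mult)
qed

lemma elt_one: "elt (\<one>, \<one>, \<one>) = \<one>"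
  by (simp add: elt_def sec_one)

lemma elt_inv:
  assumes "u \<in> Z" "v \<in> Z" "w \<in> Z"
  shows "elt (inv u, inv v, prd u v \<otimes> inv w) = inv (elt (u, v, w))"
proof -
  have "elt (inv u, inv v, prd u v \<otimes> inv w) \<otimes> elt (u, v, w) =
      elt (inv u \<otimes> u, inv v \<otimes> v, (prd u v \<otimes> inv w \<otimes> w) \<otimes> prd (inv u) v)"
    by (rule elt_mult[symmetric]) (use assms in simp_all)
  also have "(prd u v \<otimes> inv w \<otimes> w) \<otimes> prd (inv u) v = \<one>"
    using assms by (simp add: prd_inv_left m_assoc)
  finally show ?thesis using assms elt_one elt_closed by (simp add: inv_equality)
qed

end

section \<open>First-order properties of Heisenberg groups over fields\<close>

definition grp :: "(group_sym, 'g) struct \<Rightarrow> 'g monoid" where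
  "grp G = \<lparr>carrier = univ G, mult = gmul G, one = g1 G\<rparr>"

lemma grp_simps [simp]:
  "carrier (grp G) = univ G" "x \<otimes>\<^bsub>grp G\<^esub> y = gmul G x y" "\<one>\<^bsub>grp G\<^esub> = g1 G"
  by (simp_all add: grp_def)

abbreviation heis_field :: "(group_sym, 'k::field \<times> 'k \<times> 'k) struct" where
  "heis_field \<equiv> heis ring_struct"

lemma ring_struct_simps [simp]:
  "univ ring_struct = UNIV" "r0 ring_struct = 0" "r1 ring_struct = 1" "rneg ring_struct x = - x"
  "radd ring_struct x y = x + y" "rmul ring_struct x y = x * y"
  by (simp_all add: ring_struct_def)

lemma is_struct_heis_field: "is_struct group_arity heis_field"
  using is_struct_heis is_struct_ring by blast

lemma heis_field_simps:
  "univ heis_field = UNIV"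
  "g1 heis_field = (0, 0, 0)"
  "gmul heis_field p q = (fst p + fst q, fst (snd p) + fst (snd q), snd (snd p) + snd (snd q) + fst p * fst (snd q))"
  "ginv heis_field p = (- fst p, - fst (snd p), fst p * fst (snd p) - snd (snd p))"
  by (cases p; cases q; simp)+

lemma heis_field_comm_iff:
  "gmul heis_field p q = gmul heis_field q p \<longleftrightarrow> fst p * fst (snd q) = fst q * fst (snd p)"
  by (auto simp: heis_field_simps algebra_simps)

text \<open>The commutator of two matrices is central, and its corner entry is the determinant of
  their first two coordinates. Commuting means that this determinant vanishes.\<close>

lemma heis_field_com_iff:
  "gmul heis_field p q = gmul heis_field w (gmul heis_field q p) \<longleftrightarrow>
     fst w = 0 \<and> fst (snd w) = 0 \<and> fst p * fst (snd q) - fst q * fst (snd p) = snd (snd w)"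
  by (auto simp: heis_field_simps algebra_simps)

text \<open>Cramer's rule: a vector parallel to two linearly independent vectors vanishes.\<close>

lemma cross_eq_0:
  fixes x y a1 a2 b1 b2 :: "'k::field"
  assumes "a1 * b2 \<noteq> b1 * a2" "x * a2 = a1 * y" "x * b2 = b1 * y"
  shows "x = 0" "y = 0"
proof -
  have "x * (a1 * b2 - b1 * a2) = 0" "y * (a1 * b2 - b1 * a2) = 0" using assms(2,3) by algebra+
  then show "x = 0" "y = 0" using assms(1) by simp_all
qed

lemma heis_field_central:
  fixes a b z :: "'k::field \<times> 'k \<times> 'k"
  assumes "gmul heis_field a b \<noteq> gmul heis_field b a"
    "gmul heis_field z a = gmul heis_field a z" "gmul heis_field z b = gmul heis_field b z"
  shows "fst z = 0" "fst (snd z) = 0"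
  using assms cross_eq_0[of "fst a" "fst (snd b)" "fst b" "fst (snd a)" "fst z" "fst (snd z)"]
  unfolding heis_field_comm_iff by blast+

text \<open>The k-th further factor contributes \<open>k\<close> times the product of the first two
  coordinates to the corner, and 1 + ... + (n - 1) is \<open>n choose 2\<close>. For n = p odd this
  is zero in characteristic p, for p = 2 it is 1.\<close>

lemma heis_field_pow:
  "p [^]\<^bsub>grp heis_field\<^esub> (n::nat) = (of_nat n * fst p, of_nat n * fst (snd p),
     of_nat n * snd (snd p) + of_nat (n choose 2) * (fst p * fst (snd p)))"
proof (induction n)
  case 0
  show ?case by (simp add: nat_pow_def heis_field_simps binomial_eq_0)
next
  case (Suc n)
  have "p [^]\<^bsub>grp heis_field\<^esub> Suc n = gmul heis_field (p [^]\<^bsub>grp heis_field\<^esub> n) p"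
    by (simp add: nat_pow_def)
  also have "Suc n choose 2 = (n choose 2) + n" by (simp add: numeral_2_eq_2)
  ultimately show ?case using Suc by (simp add: heis_field_simps algebra_simps)
qed

text \<open>The parameters \<open>a\<close>, \<open>b\<close> rescale the central coordinate by \<open>\<Delta> = a\<^sub>1 b\<^sub>2 - b\<^sub>1 a\<^sub>2\<close>, the value of
  their commutator.  The formula for products is the Pluecker relation.\<close>

lemma interprets_heis_field:
  fixes a b :: "'k::field \<times> 'k \<times> 'k"
  assumes ab: "gmul heis_field a b \<noteq> gmul heis_field b a"
  defines "d \<equiv> fst a * fst (snd b) - fst b * fst (snd a)"
  shows "interprets ring_struct heis_field a b (\<lambda>x. (0, 0, x * d))"
proof -
  have d: "d \<noteq> 0" using ab by (simp add: heis_field_comm_iff d_def)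
  have dom: "ring_dom heis_field a b = {(0, 0, z) | z. True}"
  proof (intro equalityI subsetI)
    fix z assume "z \<in> ring_dom heis_field a b"
    then have "fst z = 0" "fst (snd z) = 0" using heis_field_central[OF ab] by (simp_all add: ring_dom_def)
    then show "z \<in> {(0, 0, z) | z. True}" by (cases z) auto
  qed (auto simp: ring_dom_def heis_field_simps)
  have bij: "bij_betw (\<lambda>x. (0, 0, x * d)) UNIV {(0 :: 'k, 0 :: 'k, z :: 'k) | z. True}"
  proof (rule bij_betwI')
    fix y :: "'k \<times> 'k \<times> 'k" assume "y \<in> {(0, 0, z) | z. True}"
    then obtain z where "y = (0, 0, z)" by auto
    then show "\<exists>x\<in>UNIV. y = (0, 0, x * d)" using d by (intro bexI[of _ "z / d"]) auto
  qed (use d in auto)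
  have prod: "ring_prod heis_field a b (0, 0, x * d) (0, 0, y * d) w \<longleftrightarrow> w = (0, 0, x * y * d)" for x y w
  proof
    assume "ring_prod heis_field a b (0, 0, x * d) (0, 0, y * d) w"
    then obtain p q where
      p: "fst p * fst (snd a) = fst a * fst (snd p)" "fst p * fst (snd b) - fst b * fst (snd p) = x * d"
      and q: "fst q * fst (snd b) = fst b * fst (snd q)" "fst a * fst (snd q) - fst q * fst (snd a) = y * d"
      and w: "fst w = 0" "fst (snd w) = 0" "fst p * fst (snd q) - fst q * fst (snd p) = snd (snd w)"
      unfolding ring_prod_def heis_field_comm_iff heis_field_com_iff by auto
    have "d * (fst p * fst (snd q) - fst q * fst (snd p)) =
        (fst p * fst (snd b) - fst b * fst (snd p)) * (fst a * fst (snd q) - fst q * fst (snd a))"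
      unfolding d_def using p(1) q(1) by algebra
    then have "d * snd (snd w) = (x * d) * (y * d)" by (simp only: p(2) q(2) w(3))
    then have "snd (snd w) = x * y * d" using d by (simp add: mult_ac)
    then show "w = (0, 0, x * y * d)" using w by (simp add: prod_eq_iff)
  next
    assume w: "w = (0, 0, x * y * d)"
    \<comment> \<open>The multiples \<open>x a\<close> and \<open>y b\<close> of the coordinate
      vectors: \<open>?p\<close> commutes with \<open>a\<close>, \<open>?q\<close> with
      \<open>b\<close>, and by bilinearity the determinants are \<open>x d\<close>,
      \<open>y d\<close> and \<open>x y d\<close>.\<close>
    let ?p = "(x * fst a, x * fst (snd a), 0)" and ?q = "(y * fst b, y * fst (snd b), 0)"
    show "ring_prod heis_field a b (0, 0, x * d) (0, 0, y * d) w"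
      unfolding ring_prod_def heis_field_comm_iff heis_field_com_iff
      by (rule bexI[of _ ?p], rule bexI[of _ ?q]) (simp_all add: w d_def heis_field_simps algebra_simps)
  qed
  show ?thesis
    unfolding interprets_def dom
    using bij prod is_struct_ring is_struct_heis_field
    by (auto simp: heis_field_com_iff heis_field_simps prod_eq_iff d_def algebra_simps)
qed

section \<open>Models of the theory of a Heisenberg group\<close>

primrec power_term :: "group_sym fterm \<Rightarrow> nat \<Rightarrow> group_sym fterm" where
  "power_term t 0 = App GOne []"
| "power_term t (Suc n) = Mul (power_term t n) t"

lemma eval_power_term [simp]: "eval_term G e (power_term t n) = eval_term G e t [^]\<^bsub>grp G\<^esub> n"
  by (induction n) (simp_all add: nat_pow_def)

lemma wf_power_term [simp]: "wf_term group_arity (power_term t n) \<longleftrightarrow> n = 0 \<or> wf_term group_arity t"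
  by (induction n) auto

abbreviation Imp :: "'f formula \<Rightarrow> 'f formula \<Rightarrow> 'f formula" where
  "Imp \<phi> \<psi> \<equiv> Neg (Conj \<phi> (Neg \<psi>))"

abbreviation Comm :: "nat \<Rightarrow> nat \<Rightarrow> group_sym formula" where
  "Comm m n \<equiv> Eq (Mul (Var m) (Var n)) (Mul (Var n) (Var m))"

abbreviation Com :: "nat \<Rightarrow> nat \<Rightarrow> nat \<Rightarrow> group_sym formula" where
  "Com m n k \<equiv> Eq (Mul (Var m) (Var n)) (Mul (Var k) (Mul (Var n) (Var m)))"

lemma range_list_env: "set (x # xs) \<subseteq> A \<Longrightarrow> range (list_env x xs) \<subseteq> A"
  by (auto simp: list_env_def)

context
  fixes G :: "(group_sym, 'g) struct"
  assumes G: "is_model group_arity (Th group_arity (heis_field :: (group_sym, 'k::field \<times> 'k \<times> 'k) struct)) G"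
begin

text \<open>The way every axiom is obtained: an open formula is checked by computation in
  \<open>H(K)\<close> and then evaluated in \<open>G\<close>, the elements concerned being supplied
  by \<open>list_env\<close>.\<close>

lemma model_sat:
  assumes "wf_formula group_arity \<phi>" "\<And>e. sat (heis_field :: (group_sym, 'k \<times> 'k \<times> 'k) struct) e \<phi>"
    and "range e \<subseteq> univ G"
  shows "sat G e \<phi>"
proof -
  have "valid_in (heis_field :: (group_sym, 'k \<times> 'k \<times> 'k) struct) \<phi>" using assms(2) by (simp add: valid_in_def)
  then have "valid_in G \<phi>" using valid_in_model_Th[OF G is_struct_heis_field assms(1)] by blast
  then show ?thesis using assms(3) by (simp add: valid_in_def)
qed

lemma model_closed:
  "g1 G \<in> univ G" "x \<in> univ G \<Longrightarrow> ginv G x \<in> univ G" "x \<in> univ G \<Longrightarrow> y \<in> univ G \<Longrightarrow> gmul G x y \<in> univ G"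
  using G by (simp_all add: is_model_def is_struct_group_iff)

lemma group_model: "group (grp G)"
proof (rule groupI)
  fix x y z assume xyz: "x \<in> carrier (grp G)" "y \<in> carrier (grp G)" "z \<in> carrier (grp G)"
  have "sat G (list_env x [x, y, z]) (Eq (Mul (Mul (Var 0) (Var 1)) (Var 2)) (Mul (Var 0) (Mul (Var 1) (Var 2))))"
    by (rule model_sat) (use xyz in \<open>simp_all add: range_list_env heis_field_simps algebra_simps\<close>)
  then show "x \<otimes>\<^bsub>grp G\<^esub> y \<otimes>\<^bsub>grp G\<^esub> z = x \<otimes>\<^bsub>grp G\<^esub> (y \<otimes>\<^bsub>grp G\<^esub> z)" by (simp add: list_env_def)
next
  fix x assume x: "x \<in> carrier (grp G)"
  have "sat G (list_env x [x]) (Eq (Mul (App GOne []) (Var 0)) (Var 0))"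
    by (rule model_sat) (use x in \<open>simp_all add: range_list_env heis_field_simps prod_eq_iff\<close>)
  then show "\<one>\<^bsub>grp G\<^esub> \<otimes>\<^bsub>grp G\<^esub> x = x" by (simp add: list_env_def)
  have "sat G (list_env x [x]) (Eq (Mul (App GInv [Var 0]) (Var 0)) (App GOne []))"
    by (rule model_sat) (use x in \<open>simp_all add: range_list_env heis_field_simps prod_eq_iff\<close>)
  then have "gmul G (ginv G x) x = g1 G" by (simp add: list_env_def)
  then show "\<exists>y\<in>carrier (grp G). y \<otimes>\<^bsub>grp G\<^esub> x = \<one>\<^bsub>grp G\<^esub>" using x model_closed(2) by auto
qed (use model_closed in simp_all)

lemma inv_model: "x \<in> univ G \<Longrightarrow> inv\<^bsub>grp G\<^esub> x = ginv G x"
proof -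
  assume x: "x \<in> univ G"
  have "sat G (list_env x [x]) (Eq (Mul (App GInv [Var 0]) (Var 0)) (App GOne []))"
    by (rule model_sat) (use x in \<open>simp_all add: range_list_env heis_field_simps prod_eq_iff\<close>)
  then show ?thesis
    using group.inv_equality[OF group_model, of "ginv G x" x] x model_closed(2) by (simp add: list_env_def)
qed

text \<open>In \<open>H(K)\<close> the coordinate vector of \<open>a\<close> is nonzero, as
  \<open>b\<close> shows, and two vectors parallel to it are parallel to each other.\<close>

lemma model_abelian:
  assumes "a \<in> univ G" "b \<in> univ G" "gmul G a b \<noteq> gmul G b a" "x \<in> univ G" "y \<in> univ G"
    "gmul G x a = gmul G a x" "gmul G y a = gmul G a y"
  shows "gmul G x y = gmul G y x"
proof -
  have "sat G (list_env a [a, b, x, y]) (Imp (Conj (Neg (Comm 0 1)) (Conj (Comm 2 0) (Comm 3 0))) (Comm 2 3))"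
  proof (rule model_sat)
    fix e :: "nat \<Rightarrow> 'k \<times> 'k \<times> 'k"
    have "x1 * y2 = y1 * x2" if "a1 * b2 \<noteq> b1 * a2" "x1 * a2 = a1 * x2" "y1 * a2 = a1 * y2"
      for a1 a2 b1 b2 x1 x2 y1 y2 :: 'k
    proof (cases "a1 = 0")
      case True
      then have "a2 \<noteq> 0" using that by auto
      then show ?thesis using that True by auto
    next
      case False
      have "a1 * (x1 * y2) = a1 * (y1 * x2)" using that by algebra
      then show ?thesis using False by simp
    qed
    from this[of "fst (e 0)" "fst (snd (e 1))" "fst (e 1)" "fst (snd (e 0))" "fst (e 2)" "fst (snd (e 2))"
        "fst (e 3)" "fst (snd (e 3))"]
    show "sat heis_field e (Imp (Conj (Neg (Comm 0 1)) (Conj (Comm 2 0) (Comm 3 0))) (Comm 2 3))"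
      unfolding sat.simps eval_term.simps list.map heis_field_comm_iff by blast
  qed (use assms in \<open>simp_all add: range_list_env\<close>)
  then show ?thesis using assms by (simp add: list_env_def)
qed

lemma heis_group_model:
  assumes ab: "a \<in> univ G" "b \<in> univ G" "gmul G a b \<noteq> gmul G b a"
  shows "heis_group (grp G) a b"
proof (intro heis_group.intro group_model heis_group_axioms.intro; unfold grp_simps)
  show "a \<in> univ G" "b \<in> univ G" by fact+
next
  fix z x
  assume *: "z \<in> univ G" "gmul G z a = gmul G a z" "gmul G z b = gmul G b z" "x \<in> univ G"
  have "sat G (list_env a [a, b, z, x]) (Imp (Conj (Neg (Comm 0 1)) (Conj (Comm 2 0) (Comm 2 1))) (Comm 2 3))"
  proof (rule model_sat)
    fix e :: "nat \<Rightarrow> 'k \<times> 'k \<times> 'k"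
    show "sat heis_field e (Imp (Conj (Neg (Comm 0 1)) (Conj (Comm 2 0) (Comm 2 1))) (Comm 2 3))"
      using heis_field_central[of "e 0" "e (Suc 0)" "e 2"] 
      by (cases "gmul heis_field (e 0) (e (Suc 0)) = gmul heis_field (e (Suc 0)) (e 0)")
        (auto simp: heis_field_comm_iff[of "e 2" "e 3"])
  qed (use ab * in \<open>simp_all add: range_list_env\<close>)
  then show "gmul G z x = gmul G x z" using ab * by (simp add: list_env_def)
next
  fix x y w t
  assume *: "x \<in> univ G" "y \<in> univ G" "w \<in> univ G" "t \<in> univ G" "gmul G x y = gmul G w (gmul G y x)"
  have "sat G (list_env x [x, y, w, t]) (Imp (Com 0 1 2) (Comm 2 3))"
    by (rule model_sat) (use * in \<open>auto simp: range_list_env heis_field_comm_iff heis_field_com_iff\<close>)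
  then show "gmul G w t = gmul G t w" using * by (simp add: list_env_def)
next
  fix z assume *: "z \<in> univ G" "gmul G z a = gmul G a z" "gmul G z b = gmul G b z"
  let ?d = "\<lambda>e :: nat \<Rightarrow> 'k \<times> 'k \<times> 'k. fst (e 0) * fst (snd (e 1)) - fst (e 1) * fst (snd (e 0))"
  have "sat G (list_env a [a, b, z]) (Imp (Conj (Neg (Comm 0 1)) (Conj (Comm 2 0) (Comm 2 1)))
      (Exi 3 (Conj (Comm 3 0) (Com 3 1 2))))" (is "sat G _ ?\<phi>")
  proof (rule model_sat)
    fix e :: "nat \<Rightarrow> 'k \<times> 'k \<times> 'k"
    have "fst (e 0) * fst (snd (e 1)) \<noteq> fst (e 1) * fst (snd (e 0)) \<and>
        fst (e 2) * fst (snd (e 0)) = fst (e 0) * fst (snd (e 2)) \<and>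
        fst (e 2) * fst (snd (e 1)) = fst (e 1) * fst (snd (e 2)) \<longrightarrow>
      fst (e 2) = 0 \<and> fst (snd (e 2)) = 0 \<and> (\<exists>p :: 'k \<times> 'k \<times> 'k. fst p * fst (snd (e 0)) = fst (e 0) * fst (snd p) \<and>
          fst p * fst (snd (e 1)) - fst (e 1) * fst (snd p) = snd (snd (e 2)))"
    proof (intro impI conjI)
      assume *: "fst (e 0) * fst (snd (e 1)) \<noteq> fst (e 1) * fst (snd (e 0)) \<and>
        fst (e 2) * fst (snd (e 0)) = fst (e 0) * fst (snd (e 2)) \<and>
        fst (e 2) * fst (snd (e 1)) = fst (e 1) * fst (snd (e 2))"
      then show "fst (e 2) = 0" "fst (snd (e 2)) = 0"
        using cross_eq_0[of "fst (e 0)" "fst (snd (e 1))" "fst (e 1)" "fst (snd (e 0))" "fst (e 2)" "fst (snd (e 2))"]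
        by blast+
      \<comment> \<open>Multiplying the coordinate vector of \<open>a\<close> by \<open>s\<close>,
        the corner of \<open>z\<close> divided by the determinant of the pair, preserves commutation
        with \<open>a\<close> and makes the commutator with \<open>b\<close> equal to
        \<open>z\<close>.\<close>
      have "snd (snd (e 2)) / ?d e * ?d e = snd (snd (e 2))" using * by simp
      then obtain s where "s * ?d e = snd (snd (e 2))" by blast
      then show "\<exists>p :: 'k \<times> 'k \<times> 'k. fst p * fst (snd (e 0)) = fst (e 0) * fst (snd p) \<and>
          fst p * fst (snd (e 1)) - fst (e 1) * fst (snd p) = snd (snd (e 2))"
        by (intro exI[of _ "(s * fst (e 0), s * fst (snd (e 0)), 0)"]) (simp add: algebra_simps)
    qed
    note * = this
    show "sat heis_field e ?\<phi>"
      unfolding sat.simps heis_field_simps(1)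
      by (simp add: heis_field_comm_iff heis_field_com_iff del: split_paired_Ex) (use * in force)
  qed (use ab * in \<open>simp_all add: range_list_env\<close>)
  then show "\<exists>x\<in>univ G. gmul G x a = gmul G a x \<and> gmul G x b = gmul G z (gmul G b x)"
    using ab * by (simp add: list_env_def)
  have "sat G (list_env a [a, b, z]) (Imp (Conj (Neg (Comm 0 1)) (Conj (Comm 2 0) (Comm 2 1)))
      (Exi 3 (Conj (Comm 3 1) (Com 0 3 2))))" (is "sat G _ ?\<phi>")
  proof (rule model_sat)
    fix e :: "nat \<Rightarrow> 'k \<times> 'k \<times> 'k"
    have "fst (e 0) * fst (snd (e 1)) \<noteq> fst (e 1) * fst (snd (e 0)) \<and>
        fst (e 2) * fst (snd (e 0)) = fst (e 0) * fst (snd (e 2)) \<and>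
        fst (e 2) * fst (snd (e 1)) = fst (e 1) * fst (snd (e 2)) \<longrightarrow>
      fst (e 2) = 0 \<and> fst (snd (e 2)) = 0 \<and> (\<exists>p :: 'k \<times> 'k \<times> 'k. fst p * fst (snd (e 1)) = fst (e 1) * fst (snd p) \<and>
          fst (e 0) * fst (snd p) - fst p * fst (snd (e 0)) = snd (snd (e 2)))"
    proof (intro impI conjI)
      assume *: "fst (e 0) * fst (snd (e 1)) \<noteq> fst (e 1) * fst (snd (e 0)) \<and>
        fst (e 2) * fst (snd (e 0)) = fst (e 0) * fst (snd (e 2)) \<and>
        fst (e 2) * fst (snd (e 1)) = fst (e 1) * fst (snd (e 2))"
      then show "fst (e 2) = 0" "fst (snd (e 2)) = 0"
        using cross_eq_0[of "fst (e 0)" "fst (snd (e 1))" "fst (e 1)" "fst (snd (e 0))" "fst (e 2)" "fst (snd (e 2))"]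
        by blast+
      have "snd (snd (e 2)) / ?d e * ?d e = snd (snd (e 2))" using * by simp
      then obtain s where "s * ?d e = snd (snd (e 2))" by blast
      then show "\<exists>p :: 'k \<times> 'k \<times> 'k. fst p * fst (snd (e 1)) = fst (e 1) * fst (snd p) \<and>
          fst (e 0) * fst (snd p) - fst p * fst (snd (e 0)) = snd (snd (e 2))"
        by (intro exI[of _ "(s * fst (e 1), s * fst (snd (e 1)), 0)"]) (simp add: algebra_simps)
    qed
    note * = this
    show "sat heis_field e ?\<phi>"
      unfolding sat.simps heis_field_simps(1)
      by (simp add: heis_field_comm_iff heis_field_com_iff del: split_paired_Ex) (use * in force)
  qed (use ab * in \<open>simp_all add: range_list_env\<close>)
  then show "\<exists>y\<in>univ G. gmul G y b = gmul G b y \<and> gmul G a y = gmul G z (gmul G y a)"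
    using ab * by (simp add: list_env_def)
next
  show "gmul G x y = gmul G y x" if "x \<in> univ G" "y \<in> univ G" "gmul G x a = gmul G a x" "gmul G y a = gmul G a y" for x y
    using model_abelian[OF ab that] .
  show "gmul G x y = gmul G y x" if "x \<in> univ G" "y \<in> univ G" "gmul G x b = gmul G b x" "gmul G y b = gmul G b y" for x y
    using model_abelian[OF ab(2,1) ab(3)[symmetric] that] .
qed

text \<open>The centre of \<open>H(K)\<close> is the additive group of \<open>K\<close>, where
  multiplication by \<open>n\<close> is invertible unless the characteristic divides
  \<open>n\<close>.\<close>

lemma model_divisible:
  assumes ab: "a \<in> univ G" "b \<in> univ G" "gmul G a b \<noteq> gmul G b a" and n: "\<not> CHAR('k) dvd n"
    and z: "z \<in> ring_dom G a b"
  shows "\<exists>w\<in>ring_dom G a b. w [^]\<^bsub>grp G\<^esub> n = z" "z [^]\<^bsub>grp G\<^esub> n = g1 G \<Longrightarrow> z = g1 G"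
proof -
  have n0: "of_nat n \<noteq> (0 :: 'k)" using n by (simp add: of_nat_eq_0_iff_char_dvd)
  have "sat G (list_env a [a, b, z]) (Imp (Conj (Neg (Comm 0 1)) (Conj (Comm 2 0) (Comm 2 1)))
      (Exi 3 (Conj (Conj (Comm 3 0) (Comm 3 1)) (Eq (power_term (Var 3) n) (Var 2)))))" (is "sat G _ ?\<phi>")
  proof (rule model_sat)
    fix e :: "nat \<Rightarrow> 'k \<times> 'k \<times> 'k"
    have "fst (e 0) * fst (snd (e 1)) \<noteq> fst (e 1) * fst (snd (e 0)) \<and>
        fst (e 2) * fst (snd (e 0)) = fst (e 0) * fst (snd (e 2)) \<and>
        fst (e 2) * fst (snd (e 1)) = fst (e 1) * fst (snd (e 2)) \<longrightarrow>
      (\<exists>p. (fst p * fst (snd (e 0)) = fst (e 0) * fst (snd p) \<and> fst p * fst (snd (e 1)) = fst (e 1) * fst (snd p)) \<and>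
        p [^]\<^bsub>grp heis_field\<^esub> n = e 2)"
    proof
      assume *: "fst (e 0) * fst (snd (e 1)) \<noteq> fst (e 1) * fst (snd (e 0)) \<and>
        fst (e 2) * fst (snd (e 0)) = fst (e 0) * fst (snd (e 2)) \<and>
        fst (e 2) * fst (snd (e 1)) = fst (e 1) * fst (snd (e 2))"
      have "fst (e 2) = 0" "fst (snd (e 2)) = 0"
        using * cross_eq_0[of "fst (e 0)" "fst (snd (e 1))" "fst (e 1)" "fst (snd (e 0))" "fst (e 2)" "fst (snd (e 2))"]
        by blast+
      then show "\<exists>p. (fst p * fst (snd (e 0)) = fst (e 0) * fst (snd p) \<and> fst p * fst (snd (e 1)) = fst (e 1) * fst (snd p)) \<and>
          p [^]\<^bsub>grp heis_field\<^esub> n = e 2"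
        using n0 by (intro exI[of _ "(0, 0, snd (snd (e 2)) / of_nat n)"]) (simp add: heis_field_pow prod_eq_iff)
    qed
    note * = this
    show "sat heis_field e ?\<phi>"
      unfolding sat.simps heis_field_simps(1)
      by (simp add: heis_field_comm_iff del: split_paired_Ex) (use * in force)
  qed (use ab z in \<open>simp_all add: range_list_env ring_dom_def\<close>)
  then show "\<exists>w\<in>ring_dom G a b. w [^]\<^bsub>grp G\<^esub> n = z"
    using ab z by (simp add: list_env_def ring_dom_def) blast
  have "sat G (list_env a [a, b, z]) (Imp (Conj (Neg (Comm 0 1)) (Conj (Conj (Comm 2 0) (Comm 2 1))
      (Eq (power_term (Var 2) n) (App GOne [])))) (Eq (Var 2) (App GOne [])))" (is "sat G _ ?\<phi>")
  proof (rule model_sat)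
    fix e :: "nat \<Rightarrow> 'k \<times> 'k \<times> 'k"
    have "fst (e 0) * fst (snd (e 1)) \<noteq> fst (e 1) * fst (snd (e 0)) \<and>
        fst (e 2) * fst (snd (e 0)) = fst (e 0) * fst (snd (e 2)) \<and>
        fst (e 2) * fst (snd (e 1)) = fst (e 1) * fst (snd (e 2)) \<longrightarrow>
      e 2 [^]\<^bsub>grp heis_field\<^esub> n = (0, 0, 0) \<longrightarrow> e 2 = (0, 0, 0)"
    proof (intro impI)
      assume *: "fst (e 0) * fst (snd (e 1)) \<noteq> fst (e 1) * fst (snd (e 0)) \<and>
        fst (e 2) * fst (snd (e 0)) = fst (e 0) * fst (snd (e 2)) \<and>
        fst (e 2) * fst (snd (e 1)) = fst (e 1) * fst (snd (e 2))" and pow: "e 2 [^]\<^bsub>grp heis_field\<^esub> n = (0, 0, 0)"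
      have "fst (e 2) = 0" "fst (snd (e 2)) = 0"
        using * cross_eq_0[of "fst (e 0)" "fst (snd (e 1))" "fst (e 1)" "fst (snd (e 0))" "fst (e 2)" "fst (snd (e 2))"]
        by blast+
      then show "e 2 = (0, 0, 0)" using pow n0 by (simp add: heis_field_pow prod_eq_iff)
    qed
    note * = this
    show "sat heis_field e ?\<phi>"
      by (simp add: heis_field_comm_iff) (use * in force)
  qed (use ab z in \<open>simp_all add: range_list_env ring_dom_def\<close>)
  then show "z [^]\<^bsub>grp G\<^esub> n = g1 G \<Longrightarrow> z = g1 G"
    using ab z by (simp add: list_env_def ring_dom_def)
qed

text \<open>The p-th power of \<open>x\<close> in \<open>H(K)\<close> is \<open>p choose 2\<close>
  times the product of its first two coordinates, in the corner. If this is zero for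
  \<open>a\<close>, then the coefficient vanishes or \<open>a\<close> lies on a coordinate axis; an
  \<open>x\<close> that commutes with \<open>a\<close> lies on the same axis.\<close>

lemma model_exponent:
  assumes ab: "a \<in> univ G" "b \<in> univ G" "gmul G a b \<noteq> gmul G b a" and "a [^]\<^bsub>grp G\<^esub> CHAR('k) = g1 G"
    and x: "x \<in> univ G" "gmul G x a = gmul G a x"
  shows "x [^]\<^bsub>grp G\<^esub> CHAR('k) = g1 G"
proof -
  have "sat G (list_env a [a, b, x]) (Imp (Conj (Neg (Comm 0 1)) (Conj (Comm 2 0) (Eq (power_term (Var 0) CHAR('k)) (App GOne []))))
     (Eq (power_term (Var 2) CHAR('k)) (App GOne [])))" (is "sat G _ ?\<phi>")
  proof (rule model_sat)
    fix e :: "nat \<Rightarrow> 'k \<times> 'k \<times> 'k"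
    have "c = 0 \<or> x1 = 0 \<or> x2 = 0" if "a1 * b2 \<noteq> b1 * a2" "x1 * a2 = a1 * x2" "c = 0 \<or> a1 = 0 \<or> a2 = 0"
      for a1 a2 b1 b2 x1 x2 c :: 'k
      using that by auto
    from this[of "fst (e 0)" "fst (snd (e 1))" "fst (e 1)" "fst (snd (e 0))" "fst (e 2)" "fst (snd (e 2))"
        "of_nat (CHAR('k) choose 2)"]
    show "sat heis_field e ?\<phi>"
      by (simp add: heis_field_comm_iff heis_field_pow heis_field_simps) blast
  qed (use ab x in \<open>simp_all add: range_list_env\<close>)
  then show ?thesis using assms by (simp add: list_env_def)
qed

text \<open>In \<open>H(K)\<close> the standard pair (1, 0, 0), (0, 1, 0) works in every
  characteristic, because the product of the first two coordinates is zero.\<close>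

lemma model_ex_pair:
  "\<exists>a\<in>univ G. \<exists>b\<in>univ G. gmul G a b \<noteq> gmul G b a \<and>
     a [^]\<^bsub>grp G\<^esub> CHAR('k) = g1 G \<and> b [^]\<^bsub>grp G\<^esub> CHAR('k) = g1 G"
proof -
  obtain x where x: "x \<in> univ G" using model_closed(1) by blast
  have "sat G (\<lambda>_. x) (Exi 0 (Exi 1 (Conj (Neg (Comm 0 1))
     (Conj (Eq (power_term (Var 0) CHAR('k)) (App GOne [])) (Eq (power_term (Var 1) CHAR('k)) (App GOne []))))))"
    (is "sat G _ ?\<phi>")
  proof (rule model_sat)
    fix e :: "nat \<Rightarrow> 'k \<times> 'k \<times> 'k"
    have "\<exists>p q :: 'k \<times> 'k \<times> 'k. fst p * fst (snd q) \<noteq> fst q * fst (snd p) \<and>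
       p [^]\<^bsub>grp heis_field\<^esub> CHAR('k) = (0, 0, 0) \<and> q [^]\<^bsub>grp heis_field\<^esub> CHAR('k) = (0, 0, 0)"
      by (intro exI[of _ "(1, 0, 0)"] exI[of _ "(0, 1, 0)"]) (simp add: heis_field_pow)
    then show "sat heis_field e ?\<phi>"
      by (simp add: heis_field_comm_iff heis_field_simps(1,2))
  qed (use x in auto)
  then show ?thesis by simp
qed

end

section \<open>The field of a model\<close>

primrec fld_intp :: "(group_sym, 'g) struct \<Rightarrow> 'g \<Rightarrow> 'g \<Rightarrow> ring_sym \<Rightarrow> 'g list \<Rightarrow> 'g" where
  "fld_intp G a b RZero xs = g1 G"
| "fld_intp G a b ROne xs = heis_group.com (grp G) a b"
| "fld_intp G a b RMinus xs = ginv G (xs ! 0)"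
| "fld_intp G a b RAdd xs = gmul G (xs ! 0) (xs ! 1)"
| "fld_intp G a b RMult xs = heis_group.prd (grp G) a b (xs ! 0) (xs ! 1)"

text \<open>The field lives on elements of the group, so an embedding of groups is itself the
  candidate for the embedding of fields.\<close>

definition fld :: "(group_sym, 'g) struct \<Rightarrow> 'g \<Rightarrow> 'g \<Rightarrow> (ring_sym, 'g) struct" where
  "fld G a b = \<lparr>univ = ring_dom G a b, intp = fld_intp G a b\<rparr>"

lemma fld_simps [simp]:
  "univ (fld G a b) = ring_dom G a b"
  "r0 (fld G a b) = g1 G"
  "r1 (fld G a b) = heis_group.com (grp G) a b"
  "rneg (fld G a b) x = ginv G x"
  "radd (fld G a b) x y = gmul G x y"
  "rmul (fld G a b) x y = heis_group.prd (grp G) a b x y"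
  by (simp_all add: fld_def)

lemma Z_grp: "heis_group (grp G) a b \<Longrightarrow> heis_group.Z (grp G) a b = ring_dom G a b"
  by (simp add: heis_group.Z_def ring_dom_def)

lemma interprets_fld:
  assumes "heis_group (grp G) a b" and st: "is_struct group_arity G"
    and inv: "\<And>x. x \<in> univ G \<Longrightarrow> inv\<^bsub>grp G\<^esub> x = ginv G x"
  shows "interprets (fld G a b) G a b (\<lambda>x. x)"
proof -
  interpret H: heis_group "grp G" a b by fact
  have Z: "H.Z = ring_dom G a b" using Z_grp[OF assms(1)] .
  have dom: "x \<in> univ G" if "x \<in> ring_dom G a b" for x using that by (simp add: ring_dom_def)
  have "is_struct ring_arity (fld G a b)"
    unfolding is_struct_ring_iff
    using H.Z_closed(1) H.com_Z[OF H.a H.b] H.Z_closed(2) H.Z_closed(3) H.prd_closed inv dom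
    by (simp add: Z)
  moreover have "ring_prod G a b x y w \<longleftrightarrow> w = H.prd x y"
    if "x \<in> ring_dom G a b" "y \<in> ring_dom G a b" "w \<in> univ G" for x y w
    using H.prd_iff[of x y w] that by (simp add: Z ring_prod_def)
  moreover have "gmul G a b = gmul G w (gmul G b a) \<longleftrightarrow> w = H.com a b" if "w \<in> univ G" for w
    using H.com_iff[OF H.a H.b, of w] that by simp
  ultimately show ?thesis
    using st H.a H.b by (simp add: interprets_def bij_betw_def)
qed

text \<open>For a sentence true in \<open>K\<close>, the implication from
  \<open>a b \<noteq> b a\<close> to its translation holds in \<open>H(K)\<close> for all pairs. It
  therefore holds in \<open>G\<close>, where the translation evaluates in
  \<open>fld G a b\<close>.\<close>

lemma is_model_fld:
  assumes G: "is_model group_arity (Th group_arity (heis_field :: (group_sym, 'k::field \<times> 'k \<times> 'k) struct)) G"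
    and ab: "a \<in> univ G" "b \<in> univ G" "gmul G a b \<noteq> gmul G b a"
  shows "is_model ring_arity (Th ring_arity (ring_struct :: (ring_sym, 'k) struct)) (fld G a b)"
proof (rule is_model_ThI)
  have "is_struct group_arity G" using G by (simp add: is_model_def)
  then have int: "interprets (fld G a b) G a b (\<lambda>x. x)"
    using heis_group_model[OF G ab] inv_model[OF G] by (intro interprets_fld)
  then show "is_struct ring_arity (fld G a b)" by (simp add: interprets_def)
  fix \<phi> assume sen: "sentence ring_arity \<phi>" and valid: "valid_in (ring_struct :: (ring_sym, 'k) struct) \<phi>"
  have wf: "wf_formula ring_arity \<phi>" and fv: "free_vars \<phi> = {}" using sen by (simp_all add: sentence_def)
  have sat: "sat G e (Imp (Neg (Comm 0 1)) (group_formula \<phi>))" if "range e \<subseteq> univ G" for e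
  proof (rule model_sat[OF G _ _ that])
    fix e :: "nat \<Rightarrow> 'k \<times> 'k \<times> 'k"
    have "sat heis_field e (group_formula \<phi>)"
      if nc: "gmul heis_field (e 0) (e 1) \<noteq> gmul heis_field (e 1) (e 0)"
    proof -
      \<comment> \<open>The sentence has no free variables, so the ring environment may be
        constantly 0.\<close>
      have "sat heis_field e (group_formula \<phi>) \<longleftrightarrow> sat ring_struct (\<lambda>_. 0 :: 'k) \<phi>"
        by (rule sat_group_formula[OF interprets_heis_field[OF nc] wf]) (simp_all add: fv)
      also have "\<dots>" using valid by (simp add: valid_in_def)
      finally show ?thesis by simp
    qed
    then show "sat heis_field e (Imp (Neg (Comm 0 1)) (group_formula \<phi>))" by auto
  qed (simp add: wf_group_formula[OF wf])
  show "valid_in (fld G a b) \<phi>"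
    unfolding valid_in_def
  proof (intro allI impI)
    fix e :: "nat \<Rightarrow> _" assume e: "range e \<subseteq> univ (fld G a b)"
    define e' where "e' = (\<lambda>n. if n = 0 then a else if n = 1 then b else e (n - 2))"
    have "e n \<in> univ G" for n using e by (auto simp: ring_dom_def)
    then have e': "range e' \<subseteq> univ G" using ab by (auto simp: e'_def)
    then have "sat G e' (group_formula \<phi>)" using sat[OF e'] ab(3) by (simp add: e'_def)
    moreover have "sat G e' (group_formula \<phi>) \<longleftrightarrow> sat (fld G a b) e \<phi>"
      by (rule sat_group_formula[OF int wf]) (use e e' in \<open>simp_all add: fv e'_def\<close>)
    ultimately show "sat (fld G a b) e \<phi>" by simp
  qed
qed

lemma isomorphism_elt:
  assumes "heis_split (grp G) a b A B" and st: "is_struct group_arity G"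
    and inv: "\<And>x. x \<in> univ G \<Longrightarrow> inv\<^bsub>grp G\<^esub> x = ginv G x"
  shows "isomorphism group_arity (heis (fld G a b)) G (heis_split.elt (grp G) a b A B)"
proof -
  interpret H: heis_split "grp G" a b A B by fact
  have hg: "heis_group (grp G) a b" by unfold_locales
  have Z: "H.Z = ring_dom G a b" using Z_grp[OF hg] .
  have fld: "is_struct ring_arity (fld G a b)"
    using interprets_fld[OF hg st inv] by (simp add: interprets_def)
  have dom: "x \<in> univ G" if "x \<in> ring_dom G a b" for x using that by (simp add: ring_dom_def)
  have "embedding group_arity (heis (fld G a b)) G H.elt"
    unfolding embedding_group_iff
  proof (intro conjI ballI)
    show "H.elt ` univ (heis (fld G a b)) \<subseteq> univ G" "inj_on H.elt (univ (heis (fld G a b)))"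
      using H.elt_image H.inj_elt by (simp_all add: Z)
    show "H.elt (g1 (heis (fld G a b))) = g1 G" using H.elt_one by simp
    fix p assume p: "p \<in> univ (heis (fld G a b))"
    then obtain u v w where puvw: "p = (u, v, w)" "u \<in> H.Z" "v \<in> H.Z" "w \<in> H.Z" by (auto simp: Z)
    then have "H.elt p \<in> univ G" using H.elt_closed[of p] by simp
    then show "H.elt (ginv (heis (fld G a b)) p) = ginv G (H.elt p)"
      using H.elt_inv[OF puvw(2-4)] puvw inv dom by (simp add: Z)
    fix q assume "q \<in> univ (heis (fld G a b))"
    then obtain u' v' w' where "q = (u', v', w')" "u' \<in> H.Z" "v' \<in> H.Z" "w' \<in> H.Z" by (auto simp: Z)
    then show "H.elt (gmul (heis (fld G a b)) p q) = gmul G (H.elt p) (H.elt q)"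
      using H.elt_mult[OF puvw(2-4), of u' v' w'] puvw by simp
  qed
  then show ?thesis
    using H.elt_image is_struct_heis[OF fld] by (simp add: isomorphism_def Z)
qed

section \<open>Embeddings between models\<close>

locale heis_hom = group_hom G G' h + H: heis_group G a b + H': heis_group G' "h a" "h b"
  for G (structure) and a b and G' (structure) and h +
  assumes inj: "inj_on h (carrier G)"
begin

lemma hom_com: "x \<in> carrier G \<Longrightarrow> y \<in> carrier G \<Longrightarrow> h (H.com x y) = H'.com (h x) (h y)"
  by (simp add: H.com_def H'.com_def)

lemma hom_centralizer_iff:
  assumes "x \<in> carrier G" "c \<in> carrier G"
  shows "h x \<in> H'.centralizer (h c) \<longleftrightarrow> x \<in> H.centralizer c"
proof -
  have "h x \<otimes>\<^bsub>G'\<^esub> h c = h c \<otimes>\<^bsub>G'\<^esub> h x \<longleftrightarrow> h (x \<otimes> c) = h (c \<otimes> x)" using assms by simp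
  also have "\<dots> \<longleftrightarrow> x \<otimes> c = c \<otimes> x" using assms by (intro inj_on_eq_iff[OF inj]) simp_all
  finally show ?thesis using assms unfolding H.centralizer_def H'.centralizer_def by simp
qed

lemma hom_Z_iff: "x \<in> carrier G \<Longrightarrow> h x \<in> H'.Z \<longleftrightarrow> x \<in> H.Z"
  by (simp add: H.Z_eq H'.Z_eq hom_centralizer_iff)

text \<open>Representatives are mapped to representatives of the images, and by
  \<open>prd_com\<close> in the larger group these compute the product there.\<close>

lemma hom_prd:
  assumes "u \<in> H.Z" "v \<in> H.Z"
  shows "h (H.prd u v) = H'.prd (h u) (h v)"
proof -
  obtain x where x: "x \<in> H.centralizer a" "H.com x b = u" using H.ex_com_a[OF assms(1)] by blast
  obtain y where y: "y \<in> H.centralizer b" "H.com a y = v" using H.ex_com_b[OF assms(2)] by blast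
  have c: "x \<in> carrier G" "y \<in> carrier G" using x y by simp_all
  have "h x \<in> H'.centralizer (h a)" "h y \<in> H'.centralizer (h b)"
    using x(1) y(1) c by (simp_all add: hom_centralizer_iff)
  then have "H'.prd (H'.com (h x) (h b)) (H'.com (h a) (h y)) = H'.com (h x) (h y)"
    by (rule H'.prd_com)
  moreover have "H'.com (h x) (h b) = h u" "H'.com (h a) (h y) = h v"
    using hom_com[OF c(1) H.b] hom_com[OF H.a c(2)] x(2) y(2) by simp_all
  moreover have "H.prd u v = H.com x y" using H.prd_com[OF x(1) y(1)] x(2) y(2) by simp
  ultimately show ?thesis using hom_com[OF c] by simp
qed

text \<open>The image of a section value lies in the larger complement and has the right commutator,
  so by uniqueness it is the section value there. This is where compatibility of the complements
  enters.\<close>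

lemma hom_elt:
  assumes "heis_split G a b A B" "heis_split G' (h a) (h b) A' B'" "h ` A \<subseteq> A'" "h ` B \<subseteq> B'"
    and Z: "u \<in> H.Z" "v \<in> H.Z" "w \<in> H.Z"
  shows "h (heis_split.elt G a b A B (u, v, w)) = heis_split.elt G' (h a) (h b) A' B' (h u, h v, h w)"
proof -
  interpret S: heis_split G a b A B by fact
  interpret S': heis_split G' "h a" "h b" A' B' by fact
  have "S'.sec_a (h u) = h (S.sec_a u)"
  proof (rule S'.sec_a_eqI)
    show "h (S.sec_a u) \<in> A'" using S.sec_a(1)[OF Z(1)] assms(3) by blast
    show "H'.com (h (S.sec_a u)) (h b) = h u" using S.sec_a[OF Z(1)] by (simp flip: hom_com)
  qed
  moreover have "S'.sec_b (h v) = h (S.sec_b v)"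
  proof (rule S'.sec_b_eqI)
    show "h (S.sec_b v) \<in> B'" using S.sec_b(1)[OF Z(2)] assms(4) by blast
    show "H'.com (h a) (h (S.sec_b v)) = h v" using S.sec_b[OF Z(2)] by (simp flip: hom_com)
  qed
  ultimately show ?thesis using Z by (simp add: S.elt_def S'.elt_def S.sec_a S.sec_b)
qed

end

lemma embedding_hom:
  assumes "embedding group_arity G G' h"
  shows "h \<in> hom (grp G) (grp G')"
  using assms unfolding embedding_group_iff by (auto simp: hom_def)

lemma embedding_fld:
  assumes h: "embedding group_arity G G' h" and hom: "heis_hom (grp G) a b (grp G') h"
  shows "embedding ring_arity (fld G a b) (fld G' (h a) (h b)) h"
proof -
  interpret heis_hom "grp G" a b "grp G'" h by fact
  have Z: "H.Z = ring_dom G a b" "H'.Z = ring_dom G' (h a) (h b)"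
    by (rule Z_grp, unfold_locales)+
  have dom: "x \<in> univ G" if "x \<in> ring_dom G a b" for x using that by (simp add: ring_dom_def)
  have "h ` ring_dom G a b \<subseteq> ring_dom G' (h a) (h b)"
    using hom_Z_iff dom by (auto simp: Z)
  moreover have "inj_on h (ring_dom G a b)" using inj dom by (auto intro: inj_on_subset)
  moreover have "h (H.com a b) = H'.com (h a) (h b)" using H.a H.b by (rule hom_com)
  moreover have "h (H.prd x y) = H'.prd (h x) (h y)" if "x \<in> ring_dom G a b" "y \<in> ring_dom G a b" for x y
    using hom_prd that by (simp add: Z)
  ultimately show ?thesis
    using h dom unfolding embedding_ring_iff embedding_group_iff by simp
qed

context
  fixes G :: "(group_sym, 'g) struct" and a b
  assumes G: "is_model group_arity (Th group_arity (heis_field :: (group_sym, 'k::field \<times> 'k \<times> 'k) struct)) G"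
    and ab: "a \<in> univ G" "b \<in> univ G" "gmul G a b \<noteq> gmul G b a"
    and pow: "a [^]\<^bsub>grp G\<^esub> CHAR('k) = g1 G" "b [^]\<^bsub>grp G\<^esub> CHAR('k) = g1 G"
begin

text \<open>If the characteristic divides \<open>n\<close>, the centralizer has exponent dividing
  \<open>n\<close>; otherwise the centre is uniquely \<open>n\<close>-divisible. In characteristic 0
  the first case is just \<open>n = 0\<close>. For \<open>c = b\<close> the roles of the two
  parameters are exchanged.\<close>

lemma model_dichotomy:
  assumes "c = a \<or> c = b"
  shows "(\<forall>x\<in>heis_group.centralizer (grp G) c. x [^]\<^bsub>grp G\<^esub> (n::nat) = \<one>\<^bsub>grp G\<^esub>) \<or>
    (\<forall>z\<in>heis_group.Z (grp G) a b. (\<exists>w\<in>heis_group.Z (grp G) a b. w [^]\<^bsub>grp G\<^esub> n = z) \<and>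
       (z [^]\<^bsub>grp G\<^esub> n = \<one>\<^bsub>grp G\<^esub> \<longrightarrow> z = \<one>\<^bsub>grp G\<^esub>))"
proof -
  interpret H: heis_group "grp G" a b by (rule heis_group_model[OF G ab])
  have Z: "H.Z = ring_dom G a b" by (rule Z_grp, unfold_locales)
  show ?thesis
  proof (cases "CHAR('k) dvd n")
    case True
    then obtain m where n: "n = CHAR('k) * m" by blast
    have "x [^]\<^bsub>grp G\<^esub> n = \<one>\<^bsub>grp G\<^esub>" if "x \<in> H.centralizer c" for x
    proof -
      have x: "x \<in> univ G" "gmul G x c = gmul G c x" using that by (simp_all add: H.centralizer_def)
      have "x [^]\<^bsub>grp G\<^esub> CHAR('k) = g1 G"
      proof (cases "c = a")
        case True
        then show ?thesis using model_exponent[OF G ab pow(1) x(1)] x(2) by simp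
      next
        case False
        then have "c = b" using assms by simp
        then show ?thesis using model_exponent[OF G ab(2,1) ab(3)[symmetric] pow(2) x(1)] x(2) by simp
      qed
      then have "(x [^]\<^bsub>grp G\<^esub> CHAR('k)) [^]\<^bsub>grp G\<^esub> m = \<one>\<^bsub>grp G\<^esub>"
        using H.nat_pow_one[of m] by (simp only: grp_simps)
      then show ?thesis using x(1) H.nat_pow_pow[of x "CHAR('k)" m] by (simp only: n grp_simps)
    qed
    then show ?thesis by blast
  next
    case False
    show ?thesis using model_divisible[OF G ab False] by (simp add: Z)
  qed
qed

text \<open>In an embedding of models, a complement in the smaller group extends to one in the larger.\<close>

lemma model_complement:
  assumes c: "c = a \<or> c = b"
    and A0: "subgroup A0 (grp G)" "A0 \<subseteq> heis_group.centralizer (grp G) c"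
      "A0 \<inter> heis_group.Z (grp G) a b \<subseteq> {g1 G}"
  obtains A where "subgroup A (grp G)" "A0 \<subseteq> A" "A \<subseteq> heis_group.centralizer (grp G) c"
    "A \<inter> heis_group.Z (grp G) a b \<subseteq> {\<one>\<^bsub>grp G\<^esub>}"
    "\<And>x. x \<in> heis_group.centralizer (grp G) c \<Longrightarrow>
       \<exists>y\<in>A. \<exists>z\<in>heis_group.Z (grp G) a b. x = y \<otimes>\<^bsub>grp G\<^esub> z"
proof -
  interpret H: heis_group "grp G" a b by (rule heis_group_model[OF G ab])
  have cG: "c \<in> carrier (grp G)" using c ab by auto
  have sub: "H.Z \<subseteq> H.centralizer c" using c by (auto simp: H.Z_eq)
  have comm: "x \<otimes>\<^bsub>grp G\<^esub> y = y \<otimes>\<^bsub>grp G\<^esub> x" if "x \<in> H.centralizer c" "y \<in> H.centralizer c" for x y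
    using c that H.centralizer_comm by blast
  have A0': "A0 \<inter> H.Z \<subseteq> {\<one>\<^bsub>grp G\<^esub>}" using A0(3) by simp
  show thesis
    by (rule H.complement_exists[OF H.subgroup_centralizer[OF cG] comm H.subgroup_Z sub A0(1,2) A0' model_dichotomy[OF c]])
      (assumption+, rule that)
qed

end

section \<open>From fields to Heisenberg groups\<close>

lemma elementary_heis_models:
  fixes G :: "(group_sym, 'g) struct" and G' :: "(group_sym, 'h) struct"
  assumes mc: "model_complete TYPE('v) ring_arity (ring_struct :: (ring_sym, 'k::field) struct)"
    and inf: "infinite (UNIV :: 'v set)"
    and G: "is_model group_arity (Th group_arity (heis_field :: (group_sym, 'k \<times> 'k \<times> 'k) struct)) G"
    and G': "is_model group_arity (Th group_arity (heis_field :: (group_sym, 'k \<times> 'k \<times> 'k) struct)) G'"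
    and h: "embedding group_arity G G' h"
  shows "elementary group_arity G G' h"
proof -
  obtain a b where ab: "a \<in> univ G" "b \<in> univ G" "gmul G a b \<noteq> gmul G b a"
    and pow: "a [^]\<^bsub>grp G\<^esub> CHAR('k) = g1 G" "b [^]\<^bsub>grp G\<^esub> CHAR('k) = g1 G"
    using model_ex_pair[OF G] by blast
  have st: "is_struct group_arity G" "is_struct group_arity G'" using G G' by (simp_all add: is_model_def)
  have inj: "inj_on h (univ G)" and hG: "h ` univ G \<subseteq> univ G'" using h by (simp_all add: embedding_def)
  have hm: "h (gmul G x y) = gmul G' (h x) (h y)" if "x \<in> univ G" "y \<in> univ G" for x y
    using h that unfolding embedding_group_iff by blast
  have ab': "h a \<in> univ G'" "h b \<in> univ G'" "gmul G' (h a) (h b) \<noteq> gmul G' (h b) (h a)"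
  proof -
    show "h a \<in> univ G'" "h b \<in> univ G'" using ab hG by auto
    have "gmul G a b \<in> univ G" "gmul G b a \<in> univ G" using model_closed(3)[OF G] ab by simp_all
    then have "h (gmul G a b) \<noteq> h (gmul G b a)" using ab(3) inj by (simp add: inj_on_eq_iff)
    then show "gmul G' (h a) (h b) \<noteq> gmul G' (h b) (h a)" using hm ab by simp
  qed
  have hom: "heis_hom (grp G) a b (grp G') h"
    by (intro heis_hom.intro group_hom.intro group_hom_axioms.intro heis_hom_axioms.intro
        group_model[OF G] group_model[OF G'] heis_group_model[OF G ab] heis_group_model[OF G' ab']
        embedding_hom[OF h]) (simp add: inj)
  interpret heis_hom "grp G" a b "grp G'" h by (rule hom)
  have pow': "h a [^]\<^bsub>grp G'\<^esub> CHAR('k) = g1 G'" "h b [^]\<^bsub>grp G'\<^esub> CHAR('k) = g1 G'"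
    using hom_nat_pow[of a "CHAR('k)"] hom_nat_pow[of b "CHAR('k)"] hom_one ab pow by simp_all
  have split: "\<exists>A A'. (subgroup A (grp G) \<and> A \<subseteq> H.centralizer c \<and> A \<inter> H.Z \<subseteq> {\<one>\<^bsub>grp G\<^esub>} \<and>
       (\<forall>x\<in>H.centralizer c. \<exists>y\<in>A. \<exists>z\<in>H.Z. x = y \<otimes>\<^bsub>grp G\<^esub> z)) \<and>
     (subgroup A' (grp G') \<and> A' \<subseteq> H'.centralizer (h c) \<and> A' \<inter> H'.Z \<subseteq> {\<one>\<^bsub>grp G'\<^esub>} \<and>
       (\<forall>x\<in>H'.centralizer (h c). \<exists>y\<in>A'. \<exists>z\<in>H'.Z. x = y \<otimes>\<^bsub>grp G'\<^esub> z)) \<and> h ` A \<subseteq> A'"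
    if c: "c = a \<or> c = b" for c
  proof -
    have cG: "c \<in> carrier (grp G)" using c ab by auto
    have "\<one>\<^bsub>grp G\<^esub> \<in> H.centralizer c" using subgroup.one_closed[OF H.subgroup_centralizer[OF cG]] .
    \<comment> \<open>In the smaller group the complement may be arbitrary, so the extension starts
      from the trivial subgroup.\<close>
    then obtain A where A: "subgroup A (grp G)" "A \<subseteq> H.centralizer c" "A \<inter> H.Z \<subseteq> {\<one>\<^bsub>grp G\<^esub>}"
      "\<And>x. x \<in> H.centralizer c \<Longrightarrow> \<exists>y\<in>A. \<exists>z\<in>H.Z. x = y \<otimes>\<^bsub>grp G\<^esub> z"
      by (rule_tac model_complement[OF G ab pow c group.triv_subgroup[OF group_model[OF G]]]) simp_all
    have "subgroup (h ` A) (grp G')" using A(1) by (rule subgroup_img_is_subgroup)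
    moreover have "h ` A \<subseteq> H'.centralizer (h c)"
      using A(2) hom_centralizer_iff[OF _ cG] H.centralizer_carrier by blast
    \<comment> \<open>An embedding reflects membership in the centre, so the image of the complement
      still meets the larger centre trivially and can be extended.\<close>
    moreover have "h ` A \<inter> H'.Z \<subseteq> {g1 G'}"
    proof
      fix y assume "y \<in> h ` A \<inter> H'.Z"
      then obtain x where x: "x \<in> A" "y = h x" "h x \<in> H'.Z" by blast
      then have "x \<in> H.Z" using hom_Z_iff[of x] A(2) H.centralizer_carrier by blast
      then have "x = \<one>\<^bsub>grp G\<^esub>" using A(3) x(1) by blast
      then show "y \<in> {g1 G'}" using x(2) hom_one by simp
    qed
    moreover have "h c = h a \<or> h c = h b" using c by blast
    ultimately obtain A' where "subgroup A' (grp G')" "h ` A \<subseteq> A'" "A' \<subseteq> H'.centralizer (h c)"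
      "A' \<inter> H'.Z \<subseteq> {\<one>\<^bsub>grp G'\<^esub>}"
      "\<And>x. x \<in> H'.centralizer (h c) \<Longrightarrow> \<exists>y\<in>A'. \<exists>z\<in>H'.Z. x = y \<otimes>\<^bsub>grp G'\<^esub> z"
      using model_complement[OF G' ab' pow'] by metis
    with A show ?thesis by blast
  qed
  obtain A A' where A: "subgroup A (grp G)" "A \<subseteq> H.centralizer a" "A \<inter> H.Z \<subseteq> {\<one>\<^bsub>grp G\<^esub>}"
       "\<forall>x\<in>H.centralizer a. \<exists>y\<in>A. \<exists>z\<in>H.Z. x = y \<otimes>\<^bsub>grp G\<^esub> z"
     and A': "subgroup A' (grp G')" "A' \<subseteq> H'.centralizer (h a)" "A' \<inter> H'.Z \<subseteq> {\<one>\<^bsub>grp G'\<^esub>}"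
       "\<forall>x\<in>H'.centralizer (h a). \<exists>y\<in>A'. \<exists>z\<in>H'.Z. x = y \<otimes>\<^bsub>grp G'\<^esub> z" and hA: "h ` A \<subseteq> A'"
    using split[of a] by blast
  obtain B B' where B: "subgroup B (grp G)" "B \<subseteq> H.centralizer b" "B \<inter> H.Z \<subseteq> {\<one>\<^bsub>grp G\<^esub>}"
       "\<forall>x\<in>H.centralizer b. \<exists>y\<in>B. \<exists>z\<in>H.Z. x = y \<otimes>\<^bsub>grp G\<^esub> z"
     and B': "subgroup B' (grp G')" "B' \<subseteq> H'.centralizer (h b)" "B' \<inter> H'.Z \<subseteq> {\<one>\<^bsub>grp G'\<^esub>}"
       "\<forall>x\<in>H'.centralizer (h b). \<exists>y\<in>B'. \<exists>z\<in>H'.Z. x = y \<otimes>\<^bsub>grp G'\<^esub> z" and hB: "h ` B \<subseteq> B'"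
    using split[of b] by blast
  have S: "heis_split (grp G) a b A B"
    by (intro heis_split.intro heis_split_axioms.intro heis_group_model[OF G ab]) (use A B in simp_all)
  have S': "heis_split (grp G') (h a) (h b) A' B'"
    by (intro heis_split.intro heis_split_axioms.intro heis_group_model[OF G' ab']) (use A' B' in simp_all)
  let ?F = "fld G a b" and ?F' = "fld G' (h a) (h b)"
  let ?elt = "heis_split.elt (grp G) a b A B" and ?elt' = "heis_split.elt (grp G') (h a) (h b) A' B'"
  have iso: "isomorphism group_arity (heis ?F) G ?elt"
    using S st(1) inv_model[OF G] by (rule isomorphism_elt)
  have iso': "isomorphism group_arity (heis ?F') G' ?elt'"
    using S' st(2) inv_model[OF G'] by (rule isomorphism_elt)
  have "elementary ring_arity ?F ?F' h"
    using mc inf is_model_fld[OF G ab] is_model_fld[OF G' ab'] embedding_fld[OF h hom]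
    by (rule model_complete_elementary)
  then have "elementary group_arity (heis ?F) (heis ?F') (map3 h)" by (rule elementary_heis)
  then have el: "elementary group_arity (heis ?F) G' (?elt' \<circ> map3 h)"
    using elementary_isomorphism[OF iso'] by (rule elementary_comp)
  have hel: "elementary group_arity (heis ?F) G' (h \<circ> ?elt)"
  proof (rule elementary_cong[OF el])
    have Z: "H.Z = ring_dom G a b" by (rule Z_grp, unfold_locales)
    fix p assume "p \<in> univ (heis ?F)"
    then obtain u v w where "p = (u, v, w)" "u \<in> H.Z" "v \<in> H.Z" "w \<in> H.Z" by (auto simp: Z)
    then show "(?elt' \<circ> map3 h) p = (h \<circ> ?elt) p" using hom_elt[OF S S' hA hB] by simp
  qed
  \<comment> \<open>The embedding is recovered as
    \<open>h = (h \<circ> ?elt) \<circ> ?elt^{-1}\<close>, a composition of elementary maps.\<close>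
  define g where "g = inv_into (univ (heis ?F)) ?elt"
  have "elementary group_arity G (heis ?F) g"
    unfolding g_def by (rule elementary_inv_isomorphism[OF iso])
  then have "elementary group_arity G G' ((h \<circ> ?elt) \<circ> g)" using hel by (rule elementary_comp)
  moreover have "((h \<circ> ?elt) \<circ> g) x = h x" if "x \<in> univ G" for x
    using that iso f_inv_into_f[of x ?elt "univ (heis ?F)"] unfolding g_def isomorphism_def by simp
  ultimately show ?thesis by (rule elementary_cong)
qed

section \<open>From Heisenberg groups to fields\<close>

context
  fixes F :: "(ring_sym, 'a) struct"
  assumes F: "is_model ring_arity (Th ring_arity (ring_struct :: (ring_sym, 'k::field) struct)) F"
begin

lemma ring_model_sat:
  assumes "wf_formula ring_arity \<phi>" "\<And>e. sat (ring_struct :: (ring_sym, 'k) struct) e \<phi>"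
    and "range e \<subseteq> univ F"
  shows "sat F e \<phi>"
proof -
  have "valid_in (ring_struct :: (ring_sym, 'k) struct) \<phi>" using assms(2) by (simp add: valid_in_def)
  then have "valid_in F \<phi>" using valid_in_model_Th[OF F is_struct_ring assms(1)] by blast
  then show ?thesis using assms(3) by (simp add: valid_in_def)
qed

lemma ring_model_simps:
  assumes "x \<in> univ F"
  shows "radd F (r0 F) x = x" "radd F x (r0 F) = x" "rmul F (r0 F) x = r0 F" "rmul F x (r0 F) = r0 F"
    "rmul F (r1 F) x = x" "rmul F x (r1 F) = x" "rneg F (r0 F) = r0 F"
proof -
  let ?z = "App RZero []" and ?u = "App ROne []" and ?x = "Var 0"
  have "sat F (\<lambda>_. x) (Conj (Eq (App RAdd [?z, ?x]) ?x) (Conj (Eq (App RAdd [?x, ?z]) ?x)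
    (Conj (Eq (App RMult [?z, ?x]) ?z) (Conj (Eq (App RMult [?x, ?z]) ?z)
    (Conj (Eq (App RMult [?u, ?x]) ?x) (Conj (Eq (App RMult [?x, ?u]) ?x) (Eq (App RMinus [?z]) ?z)))))))"
    by (rule ring_model_sat) (use assms in auto)
  then show "radd F (r0 F) x = x" "radd F x (r0 F) = x" "rmul F (r0 F) x = r0 F" "rmul F x (r0 F) = r0 F"
    "rmul F (r1 F) x = x" "rmul F x (r1 F) = x" "rneg F (r0 F) = r0 F" by simp_all
qed

lemma ring_model_comm: "x \<in> univ F \<Longrightarrow> y \<in> univ F \<Longrightarrow> radd F x y = radd F y x"
proof -
  assume "x \<in> univ F" "y \<in> univ F"
  then have "sat F (list_env x [x, y]) (Eq (App RAdd [Var 0, Var 1]) (App RAdd [Var 1, Var 0]))"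
    by (intro ring_model_sat range_list_env) (simp_all add: add.commute)
  then show ?thesis by (simp add: list_env_def)
qed

text \<open>The common summand stands on opposite sides because this is how it appears when the
  corner entries in \<open>x y = w y x\<close> are compared.\<close>

lemma ring_model_cancel:
  assumes "x \<in> univ F" "y \<in> univ F" "z \<in> univ F"
  shows "radd F z x = radd F y z \<longleftrightarrow> x = y"
proof
  have "sat F (list_env x [x, y, z]) (Imp (Eq (App RAdd [Var 2, Var 0]) (App RAdd [Var 1, Var 2])) (Eq (Var 0) (Var 1)))"
    by (intro ring_model_sat range_list_env) (use assms in \<open>simp_all add: add.commute\<close>)
  then show "radd F z x = radd F y z \<Longrightarrow> x = y" by (simp add: list_env_def)
qed (use ring_model_comm assms in simp)

text \<open>The parameters are built from the constants 0 and 1, so \<open>map3 h\<close> sends them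
  to the corresponding parameters over the other field. \<open>F\<close> is an abstract model, hence
  the calculation with the transferred identities in place of ring arithmetic.\<close>

lemma interprets_heis:
  "interprets F (heis F) (r1 F, r0 F, r0 F) (r0 F, r1 F, r0 F) (\<lambda>x. (r0 F, r0 F, x))"
proof -
  let ?a = "(r1 F, r0 F, r0 F)" and ?b = "(r0 F, r1 F, r0 F)"
  have st: "is_struct ring_arity F" using F by (simp add: is_model_def)
  have cl: "r0 F \<in> univ F" "r1 F \<in> univ F" "\<And>x. x \<in> univ F \<Longrightarrow> rneg F x \<in> univ F"
    "\<And>x y. x \<in> univ F \<Longrightarrow> y \<in> univ F \<Longrightarrow> radd F x y \<in> univ F"
    "\<And>x y. x \<in> univ F \<Longrightarrow> y \<in> univ F \<Longrightarrow> rmul F x y \<in> univ F"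
    using st unfolding is_struct_ring_iff by blast+
  note simps = ring_model_simps cl
  have zero1: "radd F x y = x \<longleftrightarrow> y = r0 F" and zero2: "radd F y x = x \<longleftrightarrow> y = r0 F"
    if "x \<in> univ F" "y \<in> univ F" for x y
  proof -
    show "radd F x y = x \<longleftrightarrow> y = r0 F"
      using ring_model_cancel[of y "r0 F" x] that by (simp add: simps)
    then show "radd F y x = x \<longleftrightarrow> y = r0 F" using ring_model_comm[OF that] by simp
  qed
  have comm_a: "gmul (heis F) (x, y, z) ?a = gmul (heis F) ?a (x, y, z) \<longleftrightarrow> y = r0 F"
    if "x \<in> univ F" "y \<in> univ F" "z \<in> univ F" for x y z
    using that ring_model_comm[OF cl(2) that(1)] zero1[of z y] by (auto simp: simps)
  have comm_b: "gmul (heis F) (x, y, z) ?b = gmul (heis F) ?b (x, y, z) \<longleftrightarrow> x = r0 F"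
    if "x \<in> univ F" "y \<in> univ F" "z \<in> univ F" for x y z
    using that ring_model_comm[OF cl(2) that(2)] zero1[of z x] by (auto simp: simps)
  have com_b: "gmul (heis F) (x, y, z) ?b = gmul (heis F) (r0 F, r0 F, u) (gmul (heis F) ?b (x, y, z)) \<longleftrightarrow> x = u"
    if "x \<in> univ F" "y \<in> univ F" "z \<in> univ F" "u \<in> univ F" for x y z u
    using that ring_model_comm[OF cl(2) that(2)] ring_model_cancel[of x u z] by (simp add: simps)
  have com_a: "gmul (heis F) ?a (x, y, z) = gmul (heis F) (r0 F, r0 F, u) (gmul (heis F) (x, y, z) ?a) \<longleftrightarrow> y = u"
    if "x \<in> univ F" "y \<in> univ F" "z \<in> univ F" "u \<in> univ F" for x y z u
    using that ring_model_comm[OF cl(2) that(1)] ring_model_cancel[of y u z] by (simp add: simps)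
  have com: "gmul (heis F) (u, r0 F, x) (r0 F, v, y) = gmul (heis F) w (gmul (heis F) (r0 F, v, y) (u, r0 F, x)) \<longleftrightarrow>
      w = (r0 F, r0 F, rmul F u v)" (is "?L \<longleftrightarrow> ?R")
    if uv: "u \<in> univ F" "v \<in> univ F" and xy: "x \<in> univ F" "y \<in> univ F" and w: "w \<in> univ (heis F)" for u v x y w
  proof -
    obtain w1 w2 w3 where w123: "w = (w1, w2, w3)" "w1 \<in> univ F" "w2 \<in> univ F" "w3 \<in> univ F" using w by auto
    have "?L \<longleftrightarrow> radd F w1 u = u \<and> radd F w2 v = v \<and>
        radd F (radd F x y) (rmul F u v) = radd F (radd F w3 (radd F y x)) (rmul F w1 v)"
      using uv xy w123 by (auto simp: simps)
    also have "\<dots> \<longleftrightarrow> w1 = r0 F \<and> w2 = r0 F \<and> radd F (radd F x y) (rmul F u v) = radd F w3 (radd F x y)"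
      using uv xy w123 zero2 ring_model_comm[OF xy] by (auto simp: simps)
    also have "\<dots> \<longleftrightarrow> w1 = r0 F \<and> w2 = r0 F \<and> rmul F u v = w3"
      using ring_model_cancel[of "rmul F u v" w3 "radd F x y"] uv xy w123 by (simp add: simps)
    finally show ?thesis using w123 by auto
  qed
  have dom: "ring_dom (heis F) ?a ?b = (\<lambda>x. (r0 F, r0 F, x)) ` univ F"
  proof (intro equalityI subsetI)
    fix p assume "p \<in> ring_dom (heis F) ?a ?b"
    then obtain x y z where p: "p = (x, y, z)" "x \<in> univ F" "y \<in> univ F" "z \<in> univ F"
      "gmul (heis F) p ?a = gmul (heis F) ?a p" "gmul (heis F) p ?b = gmul (heis F) ?b p"
      unfolding ring_dom_def by (cases p) (simp del: heis_simps(4))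
    then have "y = r0 F" "x = r0 F" using comm_a comm_b by blast+
    then show "p \<in> (\<lambda>x. (r0 F, r0 F, x)) ` univ F" using p by blast
  next
    fix p assume "p \<in> (\<lambda>x. (r0 F, r0 F, x)) ` univ F"
    then obtain z where "p = (r0 F, r0 F, z)" "z \<in> univ F" by blast
    then show "p \<in> ring_dom (heis F) ?a ?b"
      unfolding ring_dom_def using comm_a[OF cl(1) cl(1)] comm_b[OF cl(1) cl(1)] cl by (simp del: heis_simps(4))
  qed
  have prod: "ring_prod (heis F) ?a ?b (r0 F, r0 F, u) (r0 F, r0 F, v) w \<longleftrightarrow> w = (r0 F, r0 F, rmul F u v)"
    if uv: "u \<in> univ F" "v \<in> univ F" and w: "w \<in> univ (heis F)" for u v w
  proof
    assume "ring_prod (heis F) ?a ?b (r0 F, r0 F, u) (r0 F, r0 F, v) w"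
    then obtain p q where pq: "p \<in> univ (heis F)" "q \<in> univ (heis F)"
      "gmul (heis F) p ?a = gmul (heis F) ?a p"
      "gmul (heis F) p ?b = gmul (heis F) (r0 F, r0 F, u) (gmul (heis F) ?b p)"
      "gmul (heis F) q ?b = gmul (heis F) ?b q"
      "gmul (heis F) ?a q = gmul (heis F) (r0 F, r0 F, v) (gmul (heis F) q ?a)"
      "gmul (heis F) p q = gmul (heis F) w (gmul (heis F) q p)"
      unfolding ring_prod_def by blast
    obtain p1 p2 p3 where p: "p = (p1, p2, p3)" "p1 \<in> univ F" "p2 \<in> univ F" "p3 \<in> univ F" using pq(1) by auto
    obtain q1 q2 q3 where q: "q = (q1, q2, q3)" "q1 \<in> univ F" "q2 \<in> univ F" "q3 \<in> univ F" using pq(2) by auto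
    have "p2 = r0 F" using comm_a[OF p(2-4)] pq(3) unfolding p(1) by blast
    moreover have "p1 = u" using com_b[OF p(2-4) uv(1)] pq(4) unfolding p(1) by blast
    moreover have "q1 = r0 F" using comm_b[OF q(2-4)] pq(5) unfolding q(1) by blast
    moreover have "q2 = v" using com_a[OF q(2-4) uv(2)] pq(6) unfolding q(1) by blast
    ultimately show "w = (r0 F, r0 F, rmul F u v)" using com[OF uv p(4) q(4) w] pq(7) unfolding p(1) q(1) by blast
  next
    assume "w = (r0 F, r0 F, rmul F u v)"
    then show "ring_prod (heis F) ?a ?b (r0 F, r0 F, u) (r0 F, r0 F, v) w"
      unfolding ring_prod_def
      using comm_a[OF uv(1) cl(1) cl(1)] com_b[OF uv(1) cl(1) cl(1) uv(1)] comm_b[OF cl(1) uv(2) cl(1)]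
        com_a[OF cl(1) uv(2) cl(1) uv(2)] com[OF uv cl(1) cl(1) w]
      by (intro bexI[of _ "(u, r0 F, r0 F)"] bexI[of _ "(r0 F, v, r0 F)"]) (use uv cl in \<open>simp_all del: heis_simps(4)\<close>)
  qed
  have one: "gmul (heis F) ?a ?b = gmul (heis F) w (gmul (heis F) ?b ?a) \<longleftrightarrow> w = (r0 F, r0 F, r1 F)"
    if "w \<in> univ (heis F)" for w
    using com[OF cl(2) cl(2) cl(1) cl(1) that] by (simp add: simps del: heis_simps(4))
  have "bij_betw (\<lambda>x. (r0 F, r0 F, x)) (univ F) (ring_dom (heis F) ?a ?b)"
    unfolding dom by (rule inj_on_imp_bij_betw) (simp add: inj_on_def)
  moreover have "(r0 F, r0 F, rneg F x) = ginv (heis F) (r0 F, r0 F, x)"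
    "y \<in> univ F \<Longrightarrow> (r0 F, r0 F, radd F x y) = gmul (heis F) (r0 F, r0 F, x) (r0 F, r0 F, y)"
    if "x \<in> univ F" for x y
    using that by (simp_all add: simps)
  moreover have "?a \<in> univ (heis F)" "?b \<in> univ (heis F)" "(r0 F, r0 F, r0 F) = g1 (heis F)"
    using cl by simp_all
  ultimately show ?thesis
    unfolding interprets_def using st is_struct_heis[OF st] one prod by blast
qed

end

lemma elementary_ring_models:
  fixes F :: "(ring_sym, 'a) struct" and E :: "(ring_sym, 'b) struct"
  assumes mc: "model_complete TYPE('u) group_arity (heis_field :: (group_sym, 'k::field \<times> 'k \<times> 'k) struct)"
    and inf: "infinite (UNIV :: 'u set)"
    and F: "is_model ring_arity (Th ring_arity (ring_struct :: (ring_sym, 'k) struct)) F"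
    and E: "is_model ring_arity (Th ring_arity (ring_struct :: (ring_sym, 'k) struct)) E"
    and h: "embedding ring_arity F E h"
  shows "elementary ring_arity F E h"
proof -
  have st: "is_struct ring_arity F" using F by (simp add: is_model_def)
  have el: "elementary group_arity (heis F) (heis E) (map3 h)"
    using mc inf is_model_heis[OF F is_struct_ring] is_model_heis[OF E is_struct_ring] embedding_heis[OF st h]
    by (rule model_complete_elementary)
  have h0: "h (r0 F) = r0 E" "h (r1 F) = r1 E" and hF: "h ` univ F \<subseteq> univ E"
    using h by (simp_all add: embedding_ring_iff)
  have "sat F e \<phi> \<longleftrightarrow> sat E (h \<circ> e) \<phi>" if wf: "wf_formula ring_arity \<phi>" and e: "range e \<subseteq> univ F" for \<phi> e
  proof -
    \<comment> \<open>The parameters occupy the variables 0 and 1, and the values of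
      \<open>e\<close> move to the centre, shifted by 2. Applying \<open>map3 h\<close> gives the
      same coding of \<open>h \<circ> e\<close>.\<close>
    define e' where "e' = (\<lambda>n. if n = 0 then (r1 F, r0 F, r0 F) else if n = 1 then (r0 F, r1 F, r0 F)
      else (r0 F, r0 F, e (n - 2)))"
    have "e n \<in> univ F" for n using e by blast
    then have e': "range e' \<subseteq> univ (heis F)" using st unfolding is_struct_ring_iff by (auto simp: e'_def)
    have he': "range (map3 h \<circ> e') \<subseteq> univ (heis E)" using el e' by (rule range_elementary)
    have he: "range (h \<circ> e) \<subseteq> univ E" using e hF by fastforce
    have "sat F e \<phi> \<longleftrightarrow> sat (heis F) e' (group_formula \<phi>)"
      by (rule sat_group_formula[OF interprets_heis[OF F] wf, symmetric])
        (use e e' in \<open>simp_all add: e'_def del: heis_simps\<close>)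
    also have "\<dots> \<longleftrightarrow> sat (heis E) (map3 h \<circ> e') (group_formula \<phi>)"
      using el wf_group_formula[OF wf] e' by (rule sat_elementary)
    also have "\<dots> \<longleftrightarrow> sat E (h \<circ> e) \<phi>"
      by (rule sat_group_formula[OF interprets_heis[OF E] wf])
        (use he he' in \<open>simp_all add: e'_def h0 del: heis_simps\<close>)
    finally show ?thesis .
  qed
  then show ?thesis using hF unfolding elementary_def by blast
qed

theorem mainTheorem1:
  assumes "infinite (UNIV :: 'u set)" and "infinite (UNIV :: 'v set)"
  shows "model_complete TYPE('u) group_arity (group_struct (Heisenberg :: ('k::field ^ 3 ^ 3) monoid))
     \<longleftrightarrow> model_complete TYPE('v) ring_arity (ring_struct :: (ring_sym, 'k) struct)"
proof -
  \<comment> \<open>Model completeness depends only on the theory, so the matrices can be replaced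
    by the isomorphic group of triples.\<close>
  have "Th group_arity (group_struct (Heisenberg :: ('k ^ 3 ^ 3) monoid)) =
      Th group_arity (heis_field :: (group_sym, 'k \<times> 'k \<times> 'k) struct)"
    using Th_isomorphism[OF isomorphism_Heisenberg_heis] by (rule sym)
  then have H: "model_complete TYPE('u) group_arity (group_struct (Heisenberg :: ('k ^ 3 ^ 3) monoid)) \<longleftrightarrow>
      model_complete TYPE('u) group_arity (heis_field :: (group_sym, 'k \<times> 'k \<times> 'k) struct)"
    by (simp add: model_complete_def)
  show ?thesis
    unfolding H
  proof
    assume mc: "model_complete TYPE('u) group_arity (heis_field :: (group_sym, 'k \<times> 'k \<times> 'k) struct)"
    show "model_complete TYPE('v) ring_arity (ring_struct :: (ring_sym, 'k) struct)"
      unfolding model_complete_def model_complete_theory_def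
      using elementary_ring_models[OF mc assms(1)] by blast
  next
    assume mc: "model_complete TYPE('v) ring_arity (ring_struct :: (ring_sym, 'k) struct)"
    show "model_complete TYPE('u) group_arity (heis_field :: (group_sym, 'k \<times> 'k \<times> 'k) struct)"
      unfolding model_complete_def model_complete_theory_def
      using elementary_heis_models[OF mc assms(2)] by blast
  qed
qed

end
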